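(* Let $m$ be a positive integer and let $(K,\partial_0,\dots,\partial_{m-1})$ be a field with $m$ commuting derivations. Let $r$ and $n$ be positive integers, and suppose $K$ has a field extension $K(a_h^{\xi}\colon|\xi|\le 2r\land h<n)$ that meets the differential condition, and such that $|\sigma|\le r$ whenever $a_k^{\sigma}$ is a minimal separable leader. Then $(K,\partial_0,\dots,\partial_{m-1})$ has an extension $(M,D_0,\dots,D_{m-1})$ (a field $M\supseteq K$ with $m$ commuting derivations $D_i$ extending the $\partial_i$) that is compatible with $K(a_h^{\xi}\colon|\xi|<2r\land h<n)$, i.e. $K(a_h^{\xi}\colon|\xi|<2r\land h<n)\subseteq M$ and $D_ia_k^{\sigma}=a_k^{\sigma+\varepsilon_i}$ whenever $i<m$, $k<n$ and $|\sigma|+1<2r$.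
   Context: $n$ denotes also $\{0,\dots,n-1\}$. For $\sigma\in\mathbb{N}^m$, $|\sigma|=\sum_{i<m}\sigma(i)$; $\le$ is the componentwise order on $\mathbb{N}^m$ ($\rho<\sigma$ means $\rho\le\sigma$, $\rho\ne\sigma$); $\varepsilon_i$ is the characteristic function of $\{i\}$ in $\mathbb{N}^m$. The total order $\unlhd$ on $\mathbb{N}^m\times n$: $(\xi,k)\unlhd(\eta,g)$ iff $(|\xi|,k,\xi(0),\dots,\xi(m-2))$ is lexicographically $\le(|\eta|,g,\eta(0),\dots,\eta(m-2))$; $\lhd$ is the strict version. The generators $a_h^\xi$ ($|\xi|\le 2r$, $h<n$) are indexed by an initial segment of this order. The extension meets the differential condition if: whenever $i<m$, $(\sigma+\varepsilon_i,k)$ is among the indices (i.e. $|\sigma|+1\le 2r$), and $f$ is a polynomial over $K$ in variables $(x_h^{\xi}\colon(\xi,h)\unlhd(\sigma,k))$ vanishing at $a=(a_h^{\xi}\colon(\xi,h)\unlhd(\sigma,k))$, then $\sum_{(\eta,g)\unlhd(\sigma,k)}\frac{\partial f}{\partial x_g^{\eta}}(a)\,a_g^{\eta+\varepsilon_i}+f^{\partial_i}(a)=0$, where $f^{\partial_i}$ is $f$ with $\partial_i$ applied to its coefficients. A generator $a_k^{\sigma}$ is a separable leader if it is separably algebraic over $K(a_h^{\xi}\colon(\xi,h)\lhd(\sigma,k))$; it is a minimal separable leader if moreover there is no separable leader $a_k^{\rho}$ with $\rho<\sigma$. *)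

theory Defs
  imports "HOL-Algebra.Algebra" "HOL-Algebra.Finite_Extensions"
begin

definition mindex :: "nat \<Rightarrow> (nat \<Rightarrow> nat) \<Rightarrow> bool" where
  "mindex m \<xi> \<longleftrightarrow> (\<forall>i\<ge>m. \<xi> i = 0)"

definition msize :: "nat \<Rightarrow> (nat \<Rightarrow> nat) \<Rightarrow> nat" where
  "msize m \<xi> = (\<Sum>i<m. \<xi> i)"

definition unitv :: "nat \<Rightarrow> nat \<Rightarrow> nat" where
  "unitv i = (\<lambda>j. if j = i then 1 else 0)"

definition madd :: "(nat \<Rightarrow> nat) \<Rightarrow> (nat \<Rightarrow> nat) \<Rightarrow> nat \<Rightarrow> nat" where
  "madd \<xi> \<eta> = (\<lambda>j. \<xi> j + \<eta> j)"

definition okey :: "nat \<Rightarrow> (nat \<Rightarrow> nat) \<times> nat \<Rightarrow> nat list" where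
  "okey m p = msize m (fst p) # snd p # map (fst p) [0..<m - 1]"

definition olt :: "nat \<Rightarrow> (nat \<Rightarrow> nat) \<times> nat \<Rightarrow> (nat \<Rightarrow> nat) \<times> nat \<Rightarrow> bool" where
  "olt m p q \<longleftrightarrow> (okey m p, okey m q) \<in> lexord {(x, y). x < (y::nat)}"

definition ole :: "nat \<Rightarrow> (nat \<Rightarrow> nat) \<times> nat \<Rightarrow> (nat \<Rightarrow> nat) \<times> nat \<Rightarrow> bool" where
  "ole m p q \<longleftrightarrow> okey m p = okey m q \<or> olt m p q"

definition idx_le :: "nat \<Rightarrow> nat \<Rightarrow> (nat \<Rightarrow> nat) \<Rightarrow> nat \<Rightarrow> ((nat \<Rightarrow> nat) \<times> nat) set" where
  "idx_le m n \<sigma> k = {(\<xi>, h). mindex m \<xi> \<and> h < n \<and> ole m (\<xi>, h) (\<sigma>, k)}"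

definition idx_lt :: "nat \<Rightarrow> nat \<Rightarrow> (nat \<Rightarrow> nat) \<Rightarrow> nat \<Rightarrow> ((nat \<Rightarrow> nat) \<times> nat) set" where
  "idx_lt m n \<sigma> k = {(\<xi>, h). mindex m \<xi> \<and> h < n \<and> olt m (\<xi>, h) (\<sigma>, k)}"

definition derivation :: "('a, 'b) ring_scheme \<Rightarrow> 'a set \<Rightarrow> ('a \<Rightarrow> 'a) \<Rightarrow> bool" where
  "derivation R S d \<longleftrightarrow>
     (\<forall>x\<in>S. d x \<in> S) \<and>
     (\<forall>x\<in>S. \<forall>y\<in>S. d (x \<oplus>\<^bsub>R\<^esub> y) = d x \<oplus>\<^bsub>R\<^esub> d y) \<and>
     (\<forall>x\<in>S. \<forall>y\<in>S. d (x \<otimes>\<^bsub>R\<^esub> y) = (d x \<otimes>\<^bsub>R\<^esub> y) \<oplus>\<^bsub>R\<^esub> (x \<otimes>\<^bsub>R\<^esub> d y))"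

definition comm_derivations :: "('a, 'b) ring_scheme \<Rightarrow> 'a set \<Rightarrow> nat \<Rightarrow> (nat \<Rightarrow> 'a \<Rightarrow> 'a) \<Rightarrow> bool" where
  "comm_derivations R S m d \<longleftrightarrow>
     (\<forall>i<m. derivation R S (d i)) \<and>
     (\<forall>i<m. \<forall>j<m. \<forall>x\<in>S. d i (d j x) = d j (d i x))"

text \<open>A polynomial in variables of type 'v is a coefficient function on monomials
  (multisets of variables) with finite support.\<close>

definition mpoly_over :: "('a, 'b) ring_scheme \<Rightarrow> 'a set \<Rightarrow> 'v set \<Rightarrow> ('v multiset \<Rightarrow> 'a) \<Rightarrow> bool" where
  "mpoly_over R K V f \<longleftrightarrow>
     finite {\<mu>. f \<mu> \<noteq> \<zero>\<^bsub>R\<^esub>} \<and> (\<forall>\<mu>. f \<mu> \<in> K) \<and>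
     (\<forall>\<mu>. f \<mu> \<noteq> \<zero>\<^bsub>R\<^esub> \<longrightarrow> set_mset \<mu> \<subseteq> V)"

definition mono_eval :: "('a, 'b) ring_scheme \<Rightarrow> ('v \<Rightarrow> 'a) \<Rightarrow> 'v multiset \<Rightarrow> 'a" where
  "mono_eval R a \<mu> = finprod R (\<lambda>v. a v [^]\<^bsub>R\<^esub> (count \<mu> v)) (set_mset \<mu>)"

definition mpoly_eval :: "('a, 'b) ring_scheme \<Rightarrow> ('v \<Rightarrow> 'a) \<Rightarrow> ('v multiset \<Rightarrow> 'a) \<Rightarrow> 'a" where
  "mpoly_eval R a f = finsum R (\<lambda>\<mu>. f \<mu> \<otimes>\<^bsub>R\<^esub> mono_eval R a \<mu>) {\<mu>. f \<mu> \<noteq> \<zero>\<^bsub>R\<^esub>}"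

definition mpoly_pderiv_eval :: "('a, 'b) ring_scheme \<Rightarrow> ('v \<Rightarrow> 'a) \<Rightarrow> ('v multiset \<Rightarrow> 'a) \<Rightarrow> 'v \<Rightarrow> 'a" where
  "mpoly_pderiv_eval R a f v =
     finsum R (\<lambda>\<mu>. f \<mu> \<otimes>\<^bsub>R\<^esub> add_pow R (count \<mu> v) (mono_eval R a (\<mu> - {#v#}))) {\<mu>. f \<mu> \<noteq> \<zero>\<^bsub>R\<^esub>}"

definition mpoly_coeffderiv_eval :: "('a, 'b) ring_scheme \<Rightarrow> ('a \<Rightarrow> 'a) \<Rightarrow> ('v \<Rightarrow> 'a) \<Rightarrow> ('v multiset \<Rightarrow> 'a) \<Rightarrow> 'a" where
  "mpoly_coeffderiv_eval R d a f =
     finsum R (\<lambda>\<mu>. d (f \<mu>) \<otimes>\<^bsub>R\<^esub> mono_eval R a \<mu>) {\<mu>. f \<mu> \<noteq> \<zero>\<^bsub>R\<^esub>}"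

text \<open>Formal derivative of a univariate polynomial in HOL-Algebra's list representation
  (highest coefficient first).\<close>
definition upoly_deriv :: "('a, 'b) ring_scheme \<Rightarrow> 'a list \<Rightarrow> 'a list" where
  "upoly_deriv R p =
     ring.normalize R (map (\<lambda>i. add_pow R (length p - 1 - i) (p ! i)) [0..<length p - 1])"

definition separable_poly :: "('a, 'b) ring_scheme \<Rightarrow> 'a set \<Rightarrow> 'a list \<Rightarrow> bool" where
  "separable_poly R F p \<longleftrightarrow>
     (\<exists>u\<in>carrier (univ_poly R F). \<exists>v\<in>carrier (univ_poly R F).
        (u \<otimes>\<^bsub>univ_poly R F\<^esub> p) \<oplus>\<^bsub>univ_poly R F\<^esub> (v \<otimes>\<^bsub>univ_poly R F\<^esub> upoly_deriv R p)
          = \<one>\<^bsub>univ_poly R F\<^esub>)"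

definition separably_algebraic :: "('a, 'b) ring_scheme \<Rightarrow> 'a set \<Rightarrow> 'a \<Rightarrow> bool" where
  "separably_algebraic R F x \<longleftrightarrow> ring.algebraic R F x \<and> separable_poly R F (ring.Irr R F x)"

definition diff_condition ::
  "('a, 'b) ring_scheme \<Rightarrow> 'a set \<Rightarrow> (nat \<Rightarrow> 'a \<Rightarrow> 'a) \<Rightarrow> nat \<Rightarrow> nat \<Rightarrow> nat
     \<Rightarrow> ((nat \<Rightarrow> nat) \<times> nat \<Rightarrow> 'a) \<Rightarrow> bool" where
  "diff_condition L K der m r n a \<longleftrightarrow>
     (\<forall>\<sigma> k i f. mindex m \<sigma> \<and> k < n \<and> i < m \<and> msize m \<sigma> + 1 \<le> 2 * r \<and>
        mpoly_over L K (idx_le m n \<sigma> k) f \<and> mpoly_eval L a f = \<zero>\<^bsub>L\<^esub> \<longrightarrow>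
        finsum L (\<lambda>(\<eta>, g). mpoly_pderiv_eval L a f (\<eta>, g) \<otimes>\<^bsub>L\<^esub> a (madd \<eta> (unitv i), g))
                 (idx_le m n \<sigma> k)
          \<oplus>\<^bsub>L\<^esub> mpoly_coeffderiv_eval L (der i) a f = \<zero>\<^bsub>L\<^esub>)"

definition sep_leader ::
  "('a, 'b) ring_scheme \<Rightarrow> 'a set \<Rightarrow> nat \<Rightarrow> nat \<Rightarrow> ((nat \<Rightarrow> nat) \<times> nat \<Rightarrow> 'a)
     \<Rightarrow> (nat \<Rightarrow> nat) \<Rightarrow> nat \<Rightarrow> bool" where
  "sep_leader L K m n a \<sigma> k \<longleftrightarrow>
     separably_algebraic L (generate_field L (K \<union> a ` idx_lt m n \<sigma> k)) (a (\<sigma>, k))"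

definition min_sep_leader ::
  "('a, 'b) ring_scheme \<Rightarrow> 'a set \<Rightarrow> nat \<Rightarrow> nat \<Rightarrow> nat \<Rightarrow> ((nat \<Rightarrow> nat) \<times> nat \<Rightarrow> 'a)
     \<Rightarrow> (nat \<Rightarrow> nat) \<Rightarrow> nat \<Rightarrow> bool" where
  "min_sep_leader L K m r n a \<sigma> k \<longleftrightarrow>
     sep_leader L K m n a \<sigma> k \<and>
     \<not> (\<exists>\<rho>. mindex m \<rho> \<and> msize m \<rho> \<le> 2 * r \<and> (\<forall>i. \<rho> i \<le> \<sigma> i) \<and> \<rho> \<noteq> \<sigma> \<and>
           sep_leader L K m n a \<rho> k)"

end

theory Submission
  imports Defs
begin

text \<open>A derivation is handled through its graph, a subset of the ring of dual numbers that contains no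
  pair \<open>(0, y)\<close> with \<open>y \<noteq> 0\<close>; the closure of a set of pairs under the field operations is
  the graph of a derivation as soon as it has this property. The differential condition says that
  the pairs \<open>(c, \<partial>\<^sub>i c)\<close> for \<open>c\<close> in \<open>K\<close> and \<open>(a\<^sub>p, a\<^sub>p\<^sub>+\<^sub>i)\<close> for \<open>p\<close> of size less than \<open>2r\<close> generate
  such a graph.

  A derivation can take any value at a transcendental generator. At a
  leader its value is forced by differentiating the separable equation, which also shows that all
  leaders of size more than \<open>r\<close> are rational over the preceding generators. Among the generators
  of size \<open>2r\<close> the non-leaders are linearly independent over the field of the smaller ones, so
  they may be replaced by new transcendental elements, with the leaders of that size following
  linearly. Beyond size \<open>2r\<close> the non-leaders are new transcendental elements, and a leader \<open>\<tau>\<close> is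
  forced by each of its leading predecessors. All these forced values agree: two predecessors
  \<open>\<tau> - \<epsilon>\<^sub>i\<close> and \<open>\<tau> - \<epsilon>\<^sub>l\<close> with \<open>\<tau> - \<epsilon>\<^sub>i - \<epsilon>\<^sub>l\<close> a leader force the same value, because two derivations
  that commute on a field commute on separable elements over it; and any two predecessors are
  connected by such steps, because the join of two minimal leaders has size at most \<open>2r\<close>, hence
  lies strictly below \<open>\<tau>\<close>.\<close>

section \<open>Dual numbers and graphs of derivations\<close>

text \<open>The obstacle is positive characteristic. A generator that is not a separable leader may
  still be inseparably algebraic over its predecessors. A derivation then has no freedom there: the
  derivative of the minimal equation is a condition on the coefficients alone. For generators of
  size less than \<open>2 * r\<close> the differential condition guarantees it. For those of size
  \<open>2 * r\<close> nothing does, so they are given up and the conclusion keeps only the smaller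
  ones. They may be exchanged because they occur only as values of derivations on the field F of the
  smaller generators, and a derivation followed by an F-linear map on its values is again a
  derivation. Linear independence is all that such a map requires, and it is cheap: a linear
  relation would put a non-leader into the field of its predecessors, whose elements are trivially
  separable over it. The order compares sizes first, so every index has finitely many predecessors
  and the new generators can be chosen by recursion on a number. The transcendental elements are
  adjoined beforehand, so that the recursion takes place in one field.\<close>

definition dual :: "('a, 'b) ring_scheme \<Rightarrow> ('a \<times> 'a) ring" where
  "dual R = \<lparr>carrier = carrier R \<times> carrier R,
     monoid.mult = (\<lambda>p q. (fst p \<otimes>\<^bsub>R\<^esub> fst q, (fst p \<otimes>\<^bsub>R\<^esub> snd q) \<oplus>\<^bsub>R\<^esub> (snd p \<otimes>\<^bsub>R\<^esub> fst q))),
     monoid.one = (\<one>\<^bsub>R\<^esub>, \<zero>\<^bsub>R\<^esub>), ring.zero = (\<zero>\<^bsub>R\<^esub>, \<zero>\<^bsub>R\<^esub>),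
     ring.add = (\<lambda>p q. (fst p \<oplus>\<^bsub>R\<^esub> fst q, snd p \<oplus>\<^bsub>R\<^esub> snd q))\<rparr>"

lemma dual_simps [simp]:
  "carrier (dual R) = carrier R \<times> carrier R"
  "p \<otimes>\<^bsub>dual R\<^esub> q = (fst p \<otimes>\<^bsub>R\<^esub> fst q, (fst p \<otimes>\<^bsub>R\<^esub> snd q) \<oplus>\<^bsub>R\<^esub> (snd p \<otimes>\<^bsub>R\<^esub> fst q))"
  "p \<oplus>\<^bsub>dual R\<^esub> q = (fst p \<oplus>\<^bsub>R\<^esub> fst q, snd p \<oplus>\<^bsub>R\<^esub> snd q)"
  "\<one>\<^bsub>dual R\<^esub> = (\<one>\<^bsub>R\<^esub>, \<zero>\<^bsub>R\<^esub>)"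
  "\<zero>\<^bsub>dual R\<^esub> = (\<zero>\<^bsub>R\<^esub>, \<zero>\<^bsub>R\<^esub>)"
  by (auto simp: dual_def)

text \<open>The derivative is not normalised, so that leading zeros are harmless and structural
  recursion suffices; \<open>upoly_deriv_eq\<close> relates it to
  \<open>upoly_deriv\<close>.\<close>

primrec deriv_list :: "('a, 'b) ring_scheme \<Rightarrow> 'a list \<Rightarrow> 'a list" where
  "deriv_list R [] = []"
| "deriv_list R (c # cs) = (if cs = [] then [] else add_pow R (length cs) c # deriv_list R cs)"

lemma length_deriv_list: "length (deriv_list R cs) = length cs - 1"
  by (induction cs) auto

context ring begin

lemma subring_eval:
  assumes "subring S R" "set p \<subseteq> S" "x \<in> S"
  shows "eval p x \<in> S"
  using ring.eval_in_carrier[OF subring_is_ring[OF assms(1)], of p x] assms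
  by (simp add: eval_consistent)

lemma subring_deriv_list:
  assumes "subring S R" "set p \<subseteq> S"
  shows "set (deriv_list R p) \<subseteq> S"
proof -
  have "add_pow R (n::nat) c \<in> S" if "c \<in> S" for n c
    using that subringE[OF assms(1)] by (induction n) auto
  then show ?thesis using assms(2) by (induction p) auto
qed

end

context cring begin

lemma dual_cring: "cring (dual R)"
proof (rule cringI)
  show "abelian_group (dual R)"
  proof (rule abelian_groupI)
    fix x assume "x \<in> carrier (dual R)"
    then show "\<exists>y\<in>carrier (dual R). y \<oplus>\<^bsub>dual R\<^esub> x = \<zero>\<^bsub>dual R\<^esub>"
      by (intro bexI[of _ "(\<ominus> fst x, \<ominus> snd x)"]) (auto simp: l_neg)
  qed (auto simp: a_ac)
  show "comm_monoid (dual R)"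
  proof (rule comm_monoidI)
    fix x y z assume "x \<in> carrier (dual R)" "y \<in> carrier (dual R)" "z \<in> carrier (dual R)"
    then show "x \<otimes>\<^bsub>dual R\<^esub> y \<otimes>\<^bsub>dual R\<^esub> z = x \<otimes>\<^bsub>dual R\<^esub> (y \<otimes>\<^bsub>dual R\<^esub> z)"
      by (auto simp: m_assoc) algebra
  qed (auto simp: m_comm a_comm)
qed (auto simp: l_distr r_distr a_ac)

lemma dual_neg:
  assumes "x \<in> carrier R" "y \<in> carrier R"
  shows "\<ominus>\<^bsub>dual R\<^esub> (x, y) = (\<ominus> x, \<ominus> y)"
proof -
  interpret D: cring "dual R" by (rule dual_cring)
  have "(\<ominus> x, \<ominus> y) \<oplus>\<^bsub>dual R\<^esub> (x, y) = \<zero>\<^bsub>dual R\<^esub>"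
    using assms by (simp add: l_neg)
  then show ?thesis using D.minus_equality[of "(\<ominus> x, \<ominus> y)" "(x, y)"] assms by simp
qed

text \<open>The exponent \<open>n - 1\<close> is truncated; at \<open>n = 0\<close> the multiple
  \<open>add_pow R 0\<close> is zero, so the formula still holds.\<close>

lemma dual_pow:
  assumes "x \<in> carrier R" "v \<in> carrier R"
  shows "(x, v) [^]\<^bsub>dual R\<^esub> (n::nat) = (x [^] n, add_pow R n (x [^] (n - 1)) \<otimes> v)"
proof (induction n)
  case 0
  then show ?case using assms by (simp add: add.nat_pow_0)
next
  case (Suc n)
  interpret D: cring "dual R" by (rule dual_cring)
  show ?case
  proof (cases n)
    case 0
    then show ?thesis using assms by simp
  next
    case (Suc k)
    have "(x, v) [^]\<^bsub>dual R\<^esub> Suc n = (x [^] n, add_pow R n (x [^] (n - 1)) \<otimes> v) \<otimes>\<^bsub>dual R\<^esub> (x, v)"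
      using Suc.IH by simp
    also have "\<dots> = (x [^] Suc n, x [^] n \<otimes> v \<oplus> (add_pow R n (x [^] (n - 1)) \<otimes> v) \<otimes> x)"
      using assms by simp
    also have "(add_pow R n (x [^] (n - 1)) \<otimes> v) \<otimes> x = (add_pow R n (x [^] (n - 1)) \<otimes> x) \<otimes> v"
      using assms by (simp add: m_ac)
    also have "add_pow R n (x [^] (n - 1)) \<otimes> x = add_pow R n (x [^] n)"
      using assms Suc add_pow_ldistr[of "x [^] (n - 1)" x n] by simp
    also have "x [^] n \<otimes> v \<oplus> add_pow R n (x [^] n) \<otimes> v = add_pow R (Suc n) (x [^] n) \<otimes> v"
      using assms l_distr[of "add_pow R n (x [^] n)" "x [^] n" v] by (simp add: a_comm)
    finally show ?thesis by simp
  qed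
qed

lemma deriv_list_carrier: "set cs \<subseteq> carrier R \<Longrightarrow> set (deriv_list R cs) \<subseteq> carrier R"
  by (induction cs) auto

text \<open>First-order Taylor expansion: the second component is the coefficientwise derivative
  evaluated at \<open>x\<close>, plus the formal derivative at \<open>x\<close> times
  \<open>v\<close>. Every univariate equation is differentiated through this chain rule.\<close>

lemma eval_dual:
  assumes "set zs \<subseteq> carrier R \<times> carrier R" "x \<in> carrier R" "v \<in> carrier R"
  shows "ring.eval (dual R) zs (x, v) =
    (eval (map fst zs) x,
     eval (map snd zs) x \<oplus> eval (deriv_list R (map fst zs)) x \<otimes> v)"
  using assms(1)
proof (induction zs)
  case Nil
  interpret D: cring "dual R" by (rule dual_cring)
  show ?case using assms by simp
next
  case (Cons z zs)
  interpret D: cring "dual R" by (rule dual_cring)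
  obtain c c' where z: "z = (c, c')" by force
  have c: "c \<in> carrier R" "c' \<in> carrier R" using Cons.prems z by auto
  have zs: "set (map fst zs) \<subseteq> carrier R" "set (map snd zs) \<subseteq> carrier R" using Cons.prems by auto
  define n where "n = length zs"
  define e1 where "e1 = eval (map snd zs) x"
  define e2 where "e2 = eval (deriv_list R (map fst zs)) x"
  define e3 where "e3 = eval (map fst zs) x"
  have e: "e1 \<in> carrier R" "e2 \<in> carrier R" "e3 \<in> carrier R"
    unfolding e1_def e2_def e3_def using zs assms deriv_list_carrier eval_in_carrier by auto
  have IH: "D.eval zs (x, v) = (e3, e1 \<oplus> e2 \<otimes> v)"
    using Cons unfolding e1_def e2_def e3_def by auto
  have d: "eval (deriv_list R (map fst (z # zs))) x = add_pow R n c \<otimes> x [^] (n - 1) \<oplus> e2"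
    using c assms by (auto simp: n_def e2_def z length_deriv_list)
  have "D.eval (z # zs) (x, v) = z \<otimes>\<^bsub>dual R\<^esub> ((x, v) [^]\<^bsub>dual R\<^esub> n) \<oplus>\<^bsub>dual R\<^esub> (e3, e1 \<oplus> e2 \<otimes> v)"
    by (simp add: IH n_def del: dual_simps)
  also have "\<dots> = (c \<otimes> x [^] n \<oplus> e3,
      (c \<otimes> (add_pow R n (x [^] (n - 1)) \<otimes> v) \<oplus> c' \<otimes> x [^] n) \<oplus> (e1 \<oplus> e2 \<otimes> v))"
    using assms c by (simp add: dual_pow z)
  also have "c \<otimes> (add_pow R n (x [^] (n - 1)) \<otimes> v) = (add_pow R n c \<otimes> x [^] (n - 1)) \<otimes> v"
    using assms c by (simp add: add_pow_ldistr add_pow_rdistr m_assoc)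
  also have "(add_pow R n c \<otimes> x [^] (n - 1)) \<otimes> v \<oplus> c' \<otimes> x [^] n \<oplus> (e1 \<oplus> e2 \<otimes> v)
     = (c' \<otimes> x [^] n \<oplus> e1) \<oplus> (add_pow R n c \<otimes> x [^] (n - 1) \<oplus> e2) \<otimes> v"
  proof -
    have "add_pow R n c \<otimes> x [^] (n - 1) \<in> carrier R" "c' \<otimes> x [^] n \<in> carrier R" using assms c by auto
    then show ?thesis using e assms by (simp add: l_distr a_ac)
  qed
  finally show ?case unfolding d
    using z by (simp add: e1_def e3_def n_def)
qed

lemma fst_deriv_list_dual:
  assumes "set zs \<subseteq> carrier R \<times> carrier R"
  shows "map fst (deriv_list (dual R) zs) = deriv_list R (map fst zs)"
proof -
  interpret D: cring "dual R" by (rule dual_cring)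
  have p: "fst (add_pow (dual R) n z) = add_pow R n (fst z)" if "z \<in> carrier R \<times> carrier R" for n :: nat and z
    using that by (induction n) (auto simp del: D.add.nat_pow_Suc simp add: add.nat_pow_Suc D.add.nat_pow_Suc)
  show ?thesis using assms by (induction zs) (auto simp: p)
qed

lemma snd_deriv_list_dual:
  assumes "set zs \<subseteq> carrier R \<times> carrier R"
  shows "map snd (deriv_list (dual R) zs) = deriv_list R (map snd zs)"
proof -
  interpret D: cring "dual R" by (rule dual_cring)
  have p: "snd (add_pow (dual R) n z) = add_pow R n (snd z)" if "z \<in> carrier R \<times> carrier R" for n :: nat and z
    using that by (induction n) (auto simp del: D.add.nat_pow_Suc simp add: add.nat_pow_Suc D.add.nat_pow_Suc)
  show ?thesis using assms by (induction zs) (auto simp: p)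
qed

end

section \<open>Closures of sets of pairs under the field operations\<close>

inductive_set dcl :: "('a, 'b) ring_scheme \<Rightarrow> ('a \<times> 'a) set \<Rightarrow> ('a \<times> 'a) set"
  for R and S where
  one: "(\<one>\<^bsub>R\<^esub>, \<zero>\<^bsub>R\<^esub>) \<in> dcl R S"
| incl: "z \<in> S \<Longrightarrow> z \<in> dcl R S"
| a_inv: "(x, y) \<in> dcl R S \<Longrightarrow> (\<ominus>\<^bsub>R\<^esub> x, \<ominus>\<^bsub>R\<^esub> y) \<in> dcl R S"
| m_inv: "(x, y) \<in> dcl R S \<Longrightarrow> x \<noteq> \<zero>\<^bsub>R\<^esub> \<Longrightarrow>
    (inv\<^bsub>R\<^esub> x, \<ominus>\<^bsub>R\<^esub> ((inv\<^bsub>R\<^esub> x \<otimes>\<^bsub>R\<^esub> inv\<^bsub>R\<^esub> x) \<otimes>\<^bsub>R\<^esub> y)) \<in> dcl R S"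
| add: "(x, x') \<in> dcl R S \<Longrightarrow> (y, y') \<in> dcl R S \<Longrightarrow> (x \<oplus>\<^bsub>R\<^esub> y, x' \<oplus>\<^bsub>R\<^esub> y') \<in> dcl R S"
| mult: "(x, x') \<in> dcl R S \<Longrightarrow> (y, y') \<in> dcl R S \<Longrightarrow>
    (x \<otimes>\<^bsub>R\<^esub> y, (x \<otimes>\<^bsub>R\<^esub> y') \<oplus>\<^bsub>R\<^esub> (x' \<otimes>\<^bsub>R\<^esub> y)) \<in> dcl R S"

text \<open>A closure \<open>dcl R S\<close> inside the dual numbers is an additive group, so it is
  single-valued as soon as zero has no value but zero; see \<open>fnl_unique\<close>.\<close>

definition fnl :: "('a, 'b) ring_scheme \<Rightarrow> ('a \<times> 'a) set \<Rightarrow> bool" where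
  "fnl R G \<longleftrightarrow> (\<forall>y. (\<zero>\<^bsub>R\<^esub>, y) \<in> G \<longrightarrow> y = \<zero>\<^bsub>R\<^esub>)"

lemma fnl_mono: "fnl R H \<Longrightarrow> G \<subseteq> H \<Longrightarrow> fnl R G"
  by (auto simp: fnl_def)

lemma dcl_mono:
  assumes "S \<subseteq> T"
  shows "dcl R S \<subseteq> dcl R T"
proof
  fix z assume "z \<in> dcl R S"
  then show "z \<in> dcl R T"
    by (induction rule: dcl.induct) (use assms in \<open>auto intro: dcl.intros\<close>)
qed

lemma dcl_subset_dcl:
  assumes "S \<subseteq> dcl R T"
  shows "dcl R S \<subseteq> dcl R T"
proof
  fix z assume "z \<in> dcl R S"
  then show "z \<in> dcl R T"
    by (induction rule: dcl.induct) (use assms in \<open>auto intro: dcl.intros\<close>)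
qed

context field begin

lemma dcl_carrier:
  assumes "S \<subseteq> carrier R \<times> carrier R"
  shows "dcl R S \<subseteq> carrier R \<times> carrier R"
proof
  fix z assume "z \<in> dcl R S"
  then show "z \<in> carrier R \<times> carrier R"
    by (induction rule: dcl.induct) (use assms in \<open>auto simp: field_Units\<close>)
qed

lemma dcl_subring:
  assumes "S \<subseteq> carrier R \<times> carrier R"
  shows "subring (dcl R S) (dual R)"
proof -
  interpret D: cring "dual R" by (rule dual_cring)
  note c = dcl_carrier[OF assms]
  show ?thesis
  proof (rule D.subringI)
    fix h assume "h \<in> dcl R S"
    then show "\<ominus>\<^bsub>dual R\<^esub> h \<in> dcl R S"
      using c dual_neg[of "fst h" "snd h"] dcl.a_inv[of "fst h" "snd h" R S]
      by (metis mem_Times_iff prod.collapse subsetD)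
  next
    fix h h' assume "h \<in> dcl R S" "h' \<in> dcl R S"
    then show "h \<otimes>\<^bsub>dual R\<^esub> h' \<in> dcl R S" "h \<oplus>\<^bsub>dual R\<^esub> h' \<in> dcl R S"
      using dcl.mult[of "fst h" "snd h" R S "fst h'" "snd h'"]
        dcl.add[of "fst h" "snd h" R S "fst h'" "snd h'"] by simp_all
  qed (use c in \<open>auto intro: dcl.one\<close>)
qed

lemma dcl_fst:
  assumes "S \<subseteq> carrier R \<times> carrier R"
  shows "fst ` dcl R S = generate_field R (fst ` S)"
proof
  show "fst ` dcl R S \<subseteq> generate_field R (fst ` S)"
  proof (rule image_subsetI)
    fix z assume "z \<in> dcl R S"
    then show "fst z \<in> generate_field R (fst ` S)"
      by (induction rule: dcl.induct) (auto intro: generate_field.intros)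
  qed
  show "generate_field R (fst ` S) \<subseteq> fst ` dcl R S"
  proof
    fix x assume "x \<in> generate_field R (fst ` S)"
    then have "\<exists>y. (x, y) \<in> dcl R S"
      by (induction rule: generate_field.induct) (fastforce intro: dcl.intros)+
    then show "x \<in> fst ` dcl R S" by force
  qed
qed

text \<open>Inverses cannot destroy single-valuedness, because a pair with nonzero first component
  is a unit of the dual numbers. It therefore suffices to check a subring that contains the
  generators.\<close>

lemma dcl_fnl:
  assumes R0: "subring R0 (dual R)" and S: "S \<subseteq> R0" and f: "fnl R R0"
  shows "fnl R (dcl R S)"
proof -
  interpret D: cring "dual R" by (rule dual_cring)
  interpret R0: subring R0 "dual R" by (rule R0)
  have R0c: "R0 \<subseteq> carrier R \<times> carrier R" using R0.subset by simp
  \<comment> \<open>The fractions of \<open>R0\<close>. Clearing the denominator \<open>d\<close>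
    turns (0, y) into (0, \<open>fst d\<close> times y) with \<open>fst d\<close> nonzero, so
    \<open>fnl\<close> passes from \<open>R0\<close> to \<open>Fr\<close>.\<close>
  define Fr where "Fr = {z \<in> carrier (dual R). \<exists>d\<in>R0. fst d \<noteq> \<zero> \<and> d \<otimes>\<^bsub>dual R\<^esub> z \<in> R0}"
  have fm: "fst (a \<otimes>\<^bsub>dual R\<^esub> b) = fst a \<otimes> fst b" for a b by simp
  have base: "z \<in> Fr" if "z \<in> R0" for z
  proof -
    have zc: "z \<in> carrier (dual R)" using that R0.subset by blast
    have "fst \<one>\<^bsub>dual R\<^esub> \<noteq> \<zero>" "\<one>\<^bsub>dual R\<^esub> \<otimes>\<^bsub>dual R\<^esub> z \<in> R0"
      using D.l_one[OF zc] that by (simp, metis)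
    then show ?thesis unfolding Fr_def using zc R0.one_closed by blast
  qed
  have sub: "dcl R S \<subseteq> Fr"
  proof
    fix z assume "z \<in> dcl R S"
    then show "z \<in> Fr"
    proof (induction rule: dcl.induct)
      case one
      then show ?case using base[OF R0.one_closed] by simp
    next
      case (incl z)
      then show ?case using base S by blast
    next
      case (a_inv x y)
      then obtain d where d: "d \<in> R0" "fst d \<noteq> \<zero>" "d \<otimes>\<^bsub>dual R\<^esub> (x, y) \<in> R0"
        and c: "(x, y) \<in> carrier (dual R)" unfolding Fr_def by blast
      have dc: "d \<in> carrier (dual R)" using d R0.subset by blast
      have xy: "x \<in> carrier R" "y \<in> carrier R" using c by simp_all
      have "d \<otimes>\<^bsub>dual R\<^esub> (\<ominus> x, \<ominus> y) = \<ominus>\<^bsub>dual R\<^esub> (d \<otimes>\<^bsub>dual R\<^esub> (x, y))"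
        using D.r_minus[OF dc c] unfolding dual_neg[OF xy] .
      then have "d \<otimes>\<^bsub>dual R\<^esub> (\<ominus> x, \<ominus> y) \<in> R0" using subringE(5)[OF assms(1) d(3)] by metis
      moreover have "(\<ominus> x, \<ominus> y) \<in> carrier (dual R)" using xy by simp
      ultimately show ?case using d(1,2) unfolding Fr_def by blast
    next
      case (m_inv x y)
      then obtain d where d: "d \<in> R0" "fst d \<noteq> \<zero>" "d \<otimes>\<^bsub>dual R\<^esub> (x, y) \<in> R0"
        and c: "(x, y) \<in> carrier (dual R)" unfolding Fr_def by blast
      have dc: "d \<in> carrier (dual R)" using d R0.subset by blast
      have xc: "x \<in> carrier R" "y \<in> carrier R" using c by auto
      have ic: "inv x \<in> carrier R" "x \<otimes> inv x = \<one>" using xc m_inv field_Units by auto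
      define w where "w = (inv x, \<ominus> (inv x \<otimes> inv x \<otimes> y))"
      have wc: "w \<in> carrier (dual R)" using ic xc by (simp add: w_def)
      have "x \<otimes> (\<ominus> (inv x \<otimes> inv x \<otimes> y)) \<oplus> y \<otimes> inv x = \<ominus> ((x \<otimes> inv x) \<otimes> (inv x \<otimes> y)) \<oplus> y \<otimes> inv x"
        using xc ic(1) by algebra
      also have "\<dots> = \<zero>" using xc ic(1) unfolding ic(2) by algebra
      finally have e1: "(x, y) \<otimes>\<^bsub>dual R\<^esub> w = \<one>\<^bsub>dual R\<^esub>" using ic xc by (simp add: w_def)
      have "(d \<otimes>\<^bsub>dual R\<^esub> (x, y)) \<otimes>\<^bsub>dual R\<^esub> w = d"
        using D.m_assoc[OF dc c wc] e1 dc D.r_one by metis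
      moreover have "fst (d \<otimes>\<^bsub>dual R\<^esub> (x, y)) \<noteq> \<zero>"
        using d(2) m_inv.hyps dc xc integral[of "fst d" x] by auto
      ultimately show ?case using d wc unfolding Fr_def w_def by (metis (mono_tags, lifting) mem_Collect_eq)
    next
      case (add x x' y y')
      then obtain d e where d: "d \<in> R0" "fst d \<noteq> \<zero>" "d \<otimes>\<^bsub>dual R\<^esub> (x, x') \<in> R0"
        and c: "(x, x') \<in> carrier (dual R)"
        and e: "e \<in> R0" "fst e \<noteq> \<zero>" "e \<otimes>\<^bsub>dual R\<^esub> (y, y') \<in> R0"
        and c': "(y, y') \<in> carrier (dual R)" unfolding Fr_def by blast
      have dc: "d \<in> carrier (dual R)" "e \<in> carrier (dual R)" using d e R0.subset by blast+
      have "(d \<otimes>\<^bsub>dual R\<^esub> e) \<otimes>\<^bsub>dual R\<^esub> ((x, x') \<oplus>\<^bsub>dual R\<^esub> (y, y')) =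
        e \<otimes>\<^bsub>dual R\<^esub> (d \<otimes>\<^bsub>dual R\<^esub> (x, x')) \<oplus>\<^bsub>dual R\<^esub> d \<otimes>\<^bsub>dual R\<^esub> (e \<otimes>\<^bsub>dual R\<^esub> (y, y'))"
        using dc c c' by (simp only: D.r_distr D.m_ac D.m_closed D.a_closed)
      then have "(d \<otimes>\<^bsub>dual R\<^esub> e) \<otimes>\<^bsub>dual R\<^esub> ((x, x') \<oplus>\<^bsub>dual R\<^esub> (y, y')) \<in> R0"
        using d e subringE(6,7)[OF assms(1)] by metis
      moreover have "fst (d \<otimes>\<^bsub>dual R\<^esub> e) \<noteq> \<zero>"
        using d(2) e(2) dc integral[of "fst d" "fst e"] by auto
      moreover have "d \<otimes>\<^bsub>dual R\<^esub> e \<in> R0" using d e R0.m_closed by blast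
      moreover have "(x, x') \<oplus>\<^bsub>dual R\<^esub> (y, y') \<in> carrier (dual R)"
        using c c' by (rule D.a_closed)
      ultimately have "(x, x') \<oplus>\<^bsub>dual R\<^esub> (y, y') \<in> Fr" unfolding Fr_def by blast
      then show ?case by simp
    next
      case (mult x x' y y')
      then obtain d e where d: "d \<in> R0" "fst d \<noteq> \<zero>" "d \<otimes>\<^bsub>dual R\<^esub> (x, x') \<in> R0"
        and c: "(x, x') \<in> carrier (dual R)"
        and e: "e \<in> R0" "fst e \<noteq> \<zero>" "e \<otimes>\<^bsub>dual R\<^esub> (y, y') \<in> R0"
        and c': "(y, y') \<in> carrier (dual R)" unfolding Fr_def by blast
      have dc: "d \<in> carrier (dual R)" "e \<in> carrier (dual R)" using d e R0.subset by blast+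
      have "(d \<otimes>\<^bsub>dual R\<^esub> e) \<otimes>\<^bsub>dual R\<^esub> ((x, x') \<otimes>\<^bsub>dual R\<^esub> (y, y')) =
        (d \<otimes>\<^bsub>dual R\<^esub> (x, x')) \<otimes>\<^bsub>dual R\<^esub> (e \<otimes>\<^bsub>dual R\<^esub> (y, y'))"
        using dc c c' by (simp only: D.m_ac D.m_closed)
      then have "(d \<otimes>\<^bsub>dual R\<^esub> e) \<otimes>\<^bsub>dual R\<^esub> ((x, x') \<otimes>\<^bsub>dual R\<^esub> (y, y')) \<in> R0"
        using d e subringE(6,7)[OF assms(1)] by metis
      moreover have "fst (d \<otimes>\<^bsub>dual R\<^esub> e) \<noteq> \<zero>"
        using d(2) e(2) dc integral[of "fst d" "fst e"] by auto
      moreover have "d \<otimes>\<^bsub>dual R\<^esub> e \<in> R0" using d e R0.m_closed by blast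
      moreover have "(x, x') \<otimes>\<^bsub>dual R\<^esub> (y, y') \<in> carrier (dual R)"
        using c c' by (rule D.m_closed)
      ultimately have "(x, x') \<otimes>\<^bsub>dual R\<^esub> (y, y') \<in> Fr" unfolding Fr_def by blast
      then show ?case by simp
    qed
  qed
  show ?thesis unfolding fnl_def
  proof (intro allI impI)
    fix y assume "(\<zero>, y) \<in> dcl R S"
    then have "(\<zero>, y) \<in> Fr" using sub by blast
    then obtain d where d: "d \<in> R0" "fst d \<noteq> \<zero>" "d \<otimes>\<^bsub>dual R\<^esub> (\<zero>, y) \<in> R0"
      and "(\<zero>, y) \<in> carrier (dual R)" unfolding Fr_def by blast
    then have "y \<in> carrier R" by simp
    have dc: "fst d \<in> carrier R" "snd d \<in> carrier R" 
      using subsetD[OF R0c d(1)] by (simp_all add: mem_Times_iff)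
    have "d \<otimes>\<^bsub>dual R\<^esub> (\<zero>, y) = (\<zero>, fst d \<otimes> y)"
      using \<open>y \<in> carrier R\<close> dc by simp
    then have "fst d \<otimes> y = \<zero>" using d(3) f unfolding fnl_def by metis
    then show "y = \<zero>" using d(2) dc \<open>y \<in> carrier R\<close> integral by blast
  qed
qed

lemma fnl_unique:
  assumes "S \<subseteq> carrier R \<times> carrier R" "fnl R (dcl R S)" "(x, y) \<in> dcl R S" "(x, y') \<in> dcl R S"
  shows "y = y'"
proof -
  have c: "x \<in> carrier R" "y \<in> carrier R" "y' \<in> carrier R" using dcl_carrier[OF assms(1)] assms by auto
  have "(x \<oplus> \<ominus> x, y \<oplus> \<ominus> y') \<in> dcl R S" using assms by (intro dcl.add dcl.a_inv)
  then have "y \<oplus> \<ominus> y' = \<zero>" using assms c by (auto simp: fnl_def r_neg)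
  then show ?thesis using c by (metis minus_equality minus_minus a_inv_closed a_comm)
qed

text \<open>The derivative of a rational expression is a linear combination of the derivatives of
  the generators, with coefficients in the field. \<open>V\<close> is only a subspace because the
  values of size \<open>2 * r\<close> will be controlled only linearly.\<close>

lemma dcl_snd:
  assumes S: "S \<subseteq> carrier R \<times> carrier R" and F: "subfield F R" "fst ` S \<subseteq> F"
    and V: "snd ` S \<subseteq> V" "V \<subseteq> carrier R" "\<zero> \<in> V" "\<And>u v. u \<in> V \<Longrightarrow> v \<in> V \<Longrightarrow> u \<oplus> v \<in> V"
      "\<And>c v. c \<in> F \<Longrightarrow> v \<in> V \<Longrightarrow> c \<otimes> v \<in> V"
    and z: "z \<in> dcl R S"
  shows "fst z \<in> F \<and> snd z \<in> V"
proof -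
  have Fc: "F \<subseteq> carrier R" and F1: "\<one> \<in> F"
    and Fn: "\<And>x. x \<in> F \<Longrightarrow> \<ominus> x \<in> F"
    and Fa: "\<And>x y. x \<in> F \<Longrightarrow> y \<in> F \<Longrightarrow> x \<oplus> y \<in> F"
    and Fm: "\<And>x y. x \<in> F \<Longrightarrow> y \<in> F \<Longrightarrow> x \<otimes> y \<in> F"
    and Fi: "\<And>x. x \<in> F \<Longrightarrow> x \<noteq> \<zero> \<Longrightarrow> inv x \<in> F"
    using subfieldE(3)[OF F(1)] subringE[OF subfieldE(1)[OF F(1)]] subfield_m_inv(1)[OF F(1)] by auto
  have neg: "\<ominus> v \<in> V" if "v \<in> V" for v
  proof -
    have "\<ominus> \<one> \<otimes> v = \<ominus> v" using that V(2) by (simp add: l_minus subsetD)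
    then show ?thesis using V(5)[OF Fn[OF F1] that] by simp
  qed
  show ?thesis using z
  proof (induction rule: dcl.induct)
    case (m_inv x y)
    then show ?case using Fi Fm V(5) neg by simp
  next
    case (mult x x' y y')
    then have "x' \<otimes> y = y \<otimes> x'" using Fc V(2) by (auto intro: m_comm)
    then show ?case using mult Fm V(4,5) by simp
  qed (use F1 F V Fn Fa neg in auto)
qed

lemma dcl_snd_field:
  assumes "S \<subseteq> carrier R \<times> carrier R" "subfield F R" "fst ` S \<subseteq> F" "snd ` S \<subseteq> F" "z \<in> dcl R S"
  shows "fst z \<in> F \<and> snd z \<in> F"
  using assms subringE[OF subfieldE(1)[OF assms(2)]] subfieldE(3)[OF assms(2)]
  by (intro dcl_snd[of S F F z]) auto

lemma lift_list:
  assumes "set p \<subseteq> fst ` G"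
  shows "\<exists>zs. set zs \<subseteq> G \<and> map fst zs = p"
  using assms
proof (induction p)
  case (Cons c p)
  then obtain zs z where "set zs \<subseteq> G" "map fst zs = p" "z \<in> G" "fst z = c" by auto
  then show ?case by (intro exI[of _ "z # zs"]) auto
qed simp

text \<open>The lifted polynomial evaluated at \<open>(x, v)\<close> is an element of the closure
  with first component zero; the claim is that its second component vanishes.\<close>

lemma fnl_relation:
  assumes S: "S \<subseteq> carrier R \<times> carrier R" and f: "fnl R (dcl R S)"
    and zs: "set zs \<subseteq> dcl R S" and x: "(x, v) \<in> dcl R S" and e: "eval (map fst zs) x = \<zero>"
  shows "eval (map snd zs) x \<oplus> eval (deriv_list R (map fst zs)) x \<otimes> v = \<zero>"
proof -
  interpret D: cring "dual R" by (rule dual_cring)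
  note c = dcl_carrier[OF S]
  have "D.eval zs (x, v) \<in> dcl R S"
    using D.subring_eval[OF dcl_subring[OF S] zs x] .
  moreover have "set zs \<subseteq> carrier R \<times> carrier R" "x \<in> carrier R" "v \<in> carrier R" using c zs x by auto
  ultimately show ?thesis using f e unfolding fnl_def by (simp add: eval_dual)
qed

end

section \<open>Transcendental, separable and commuting elements\<close>

definition transc :: "('a, 'b) ring_scheme \<Rightarrow> 'a set \<Rightarrow> 'a \<Rightarrow> bool" where
  "transc R F x \<longleftrightarrow> (\<forall>p. set p \<subseteq> F \<longrightarrow> ring.eval R p x = \<zero>\<^bsub>R\<^esub> \<longrightarrow> set p \<subseteq> {\<zero>\<^bsub>R\<^esub>})"

definition sep_root :: "('a, 'b) ring_scheme \<Rightarrow> 'a set \<Rightarrow> 'a \<Rightarrow> bool" where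
  "sep_root R F x \<longleftrightarrow> (\<exists>p. set p \<subseteq> F \<and> ring.eval R p x = \<zero>\<^bsub>R\<^esub> \<and> ring.eval R (deriv_list R p) x \<noteq> \<zero>\<^bsub>R\<^esub>)"

lemma transc_mono: "transc R F x \<Longrightarrow> E \<subseteq> F \<Longrightarrow> transc R E x"
  unfolding transc_def by blast

text \<open>For the graphs of two derivations these are the elements at which both composites are
  defined and agree.\<close>

definition comm_set :: "('a \<times> 'a) set \<Rightarrow> ('a \<times> 'a) set \<Rightarrow> 'a set" where
  "comm_set G H = {x. \<exists>y z w. (x, y) \<in> G \<and> (x, z) \<in> H \<and> (y, w) \<in> H \<and> (z, w) \<in> G}"

context field begin

text \<open>The polynomial expressions in \<open>(x, v)\<close> over the closure form a ring to
  which \<open>dcl_fnl\<close> applies. If such an expression has first component zero,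
  transcendence makes the first components of its coefficients vanish, and \<open>fnl\<close> then
  makes the coefficients themselves vanish.\<close>

lemma fnl_transc:
  assumes S: "S \<subseteq> carrier R \<times> carrier R" and f: "fnl R (dcl R S)"
    and x: "x \<in> carrier R" "transc R (fst ` dcl R S) x" and v: "v \<in> carrier R"
  shows "fnl R (dcl R (insert (x, v) S))"
proof -
  interpret D: cring "dual R" by (rule dual_cring)
  note c = dcl_carrier[OF S]
  note G = dcl_subring[OF S]
  define R0 where "R0 = {D.eval zs (x, v) | zs. set zs \<subseteq> dcl R S}"
  have xv: "(x, v) \<in> carrier (dual R)" using x v by simp
  have cl: "set zs \<subseteq> carrier (dual R)" if "set zs \<subseteq> dcl R S" for zs using that c by auto
  have const: "z \<in> R0" if "z \<in> dcl R S" for z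
  proof -
    have "D.eval [z] (x, v) = z" using that c D.r_one[of z] D.r_zero[of z] by auto
    then show ?thesis using that unfolding R0_def by (metis (mono_tags, lifting) empty_subsetI insert_subset list.simps(15) mem_Collect_eq set_empty)
  qed
  have poly: "set (D.poly_add p q) \<subseteq> dcl R S" "set (D.poly_mult p q) \<subseteq> dcl R S"
    if "set p \<subseteq> dcl R S" "set q \<subseteq> dcl R S" for p q
  proof -
    interpret G: ring "dual R \<lparr>carrier := dcl R S\<rparr>" using D.subring_is_ring[OF G] .
    show "set (D.poly_add p q) \<subseteq> dcl R S" using G.poly_add_in_carrier[of p q] that
      by (simp add: D.poly_add_consistent[OF G])
    show "set (D.poly_mult p q) \<subseteq> dcl R S" using G.poly_mult_in_carrier[of p q] that
      by (simp add: D.poly_mult_consistent[OF G])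
  qed
  have sub: "subring R0 (dual R)"
  proof (rule D.subringI)
    show "R0 \<subseteq> carrier (dual R)" unfolding R0_def using D.eval_in_carrier[OF cl xv] by blast
    show "\<one>\<^bsub>dual R\<^esub> \<in> R0" using const[OF dcl.one] by simp
  next
    fix h h' assume "h \<in> R0" "h' \<in> R0"
    then obtain p q where p: "set p \<subseteq> dcl R S" "h = D.eval p (x, v)"
      and q: "set q \<subseteq> dcl R S" "h' = D.eval q (x, v)" unfolding R0_def by blast
    show "h \<otimes>\<^bsub>dual R\<^esub> h' \<in> R0" unfolding R0_def
      using D.eval_poly_mult[OF cl[OF p(1)] cl[OF q(1)] xv] p q poly by (metis (mono_tags, lifting) mem_Collect_eq)
    show "h \<oplus>\<^bsub>dual R\<^esub> h' \<in> R0" unfolding R0_def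
      using D.eval_poly_add[OF cl[OF p(1)] cl[OF q(1)] xv] p q poly by (metis (mono_tags, lifting) mem_Collect_eq)
  next
    fix h assume "h \<in> R0"
    then obtain p where p: "set p \<subseteq> dcl R S" "h = D.eval p (x, v)" unfolding R0_def by blast
    have hc: "h \<in> carrier (dual R)" using D.eval_in_carrier[OF cl xv] p by blast
    define m where "m = [(\<ominus> \<one>, \<ominus> \<zero>)]"
    have m: "set m \<subseteq> dcl R S" unfolding m_def using dcl.a_inv[OF dcl.one, of R S] by simp
    have "D.eval m (x, v) = \<ominus>\<^bsub>dual R\<^esub> \<one>\<^bsub>dual R\<^esub>"
      unfolding m_def using dual_neg[of \<one> \<zero>] by simp
    then have "D.eval (D.poly_mult m p) (x, v) = \<ominus>\<^bsub>dual R\<^esub> \<one>\<^bsub>dual R\<^esub> \<otimes>\<^bsub>dual R\<^esub> h"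
      using D.eval_poly_mult[OF cl[OF m] cl[OF p(1)] xv] p(2) by metis
    also have "\<dots> = \<ominus>\<^bsub>dual R\<^esub> h" using D.l_minus[OF D.one_closed hc] D.l_one[OF hc] by metis
    finally show "\<ominus>\<^bsub>dual R\<^esub> h \<in> R0" using poly(2)[OF m p(1)] unfolding R0_def by (metis (mono_tags, lifting) mem_Collect_eq)
  qed
  have "(x, v) \<in> R0"
  proof -
    \<comment> \<open>The polynomial X. Its zero coefficient is written as -1 + 1 because
      \<open>dcl\<close> has rules for these operations and none for zero.\<close>
    define l where "l = [(\<one>, \<zero>), (\<ominus> \<one> \<oplus> \<one>, \<ominus> \<zero> \<oplus> \<zero>)]"
    have "set l \<subseteq> dcl R S" unfolding l_def using dcl.add[OF dcl.a_inv[OF dcl.one] dcl.one, of R S] dcl.one[of R S] by simp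
    moreover have "D.eval l (x, v) = (x, v)" unfolding l_def using x v by (simp add: l_neg eval_dual)
    ultimately show ?thesis unfolding R0_def by (metis (mono_tags, lifting) mem_Collect_eq)
  qed
  moreover have "S \<subseteq> R0" using const dcl.incl by blast
  moreover have "fnl R R0" unfolding fnl_def
  proof (intro allI impI)
    fix y assume "(\<zero>, y) \<in> R0"
    then obtain zs where zs: "set zs \<subseteq> dcl R S" "D.eval zs (x, v) = (\<zero>, y)" unfolding R0_def by force
    have zc: "set zs \<subseteq> carrier R \<times> carrier R" using zs c by auto
    have "eval (map fst zs) x = \<zero>" using zs(2) eval_dual[OF zc x(1) v] by simp
    then have "set (map fst zs) \<subseteq> {\<zero>}" using x(2) zs(1) unfolding transc_def by (metis image_mono set_map)
    then have z0: "set zs \<subseteq> {\<zero>\<^bsub>dual R\<^esub>}" using zs(1) f unfolding fnl_def by fastforce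
    have "D.eval zs (x, v) = \<zero>\<^bsub>dual R\<^esub>" using z0
    proof (induction zs)
      case (Cons a zs)
      have "(x, v) [^]\<^bsub>dual R\<^esub> length zs \<in> carrier (dual R)" using xv by (rule D.nat_pow_closed)
      then have "\<zero>\<^bsub>dual R\<^esub> \<otimes>\<^bsub>dual R\<^esub> (x, v) [^]\<^bsub>dual R\<^esub> length zs = \<zero>\<^bsub>dual R\<^esub>" by (rule D.l_null)
      then show ?case using Cons D.l_zero[OF D.zero_closed] by (simp del: dual_simps)
    qed simp
    then show "y = \<zero>" using zs(2) by simp
  qed
  ultimately show ?thesis using sub by (intro dcl_fnl) auto
qed

text \<open>The commutator of two derivations is a derivation, so the elements that it kills form a
  field. The computation is done on witnesses of the relations and works without
  \<open>fnl\<close>.\<close>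

lemma comm_set_generate_field:
  assumes S: "S \<subseteq> carrier R \<times> carrier R" and T: "T \<subseteq> carrier R \<times> carrier R"
    and A: "A \<subseteq> comm_set (dcl R S) (dcl R T)"
  shows "generate_field R A \<subseteq> comm_set (dcl R S) (dcl R T)"
proof
  note c = dcl_carrier[OF S] dcl_carrier[OF T]
  fix x assume "x \<in> generate_field R A"
  then have "\<exists>y z w. (x, y) \<in> dcl R S \<and> (x, z) \<in> dcl R T \<and> (y, w) \<in> dcl R T \<and> (z, w) \<in> dcl R S"
  proof (induction rule: generate_field.induct)
    case one
    have "(\<one> \<oplus> \<ominus> \<one>, \<zero> \<oplus> \<ominus> \<zero>) \<in> dcl R U" for U by (intro dcl.intros)
    then have "(\<zero>, \<zero>) \<in> dcl R U" for U by (simp add: r_neg)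
    then show ?case using dcl.one by blast
  next
    case (incl h)
    then show ?case using A unfolding comm_set_def by blast
  next
    case (a_inv h)
    then obtain y z w where "(h, y) \<in> dcl R S" "(h, z) \<in> dcl R T" "(y, w) \<in> dcl R T" "(z, w) \<in> dcl R S"
      by blast
    then show ?case by (intro exI conjI) (rule dcl.a_inv, assumption)+
  next
    case (m_inv x)
    then obtain y z w where h: "(x, y) \<in> dcl R S" "(x, z) \<in> dcl R T" "(y, w) \<in> dcl R T" "(z, w) \<in> dcl R S"
      by blast
    define i where "i = inv x"
    have cc: "x \<in> carrier R" "y \<in> carrier R" "z \<in> carrier R" "w \<in> carrier R" using h c by auto
    have ic: "i \<in> carrier R" using cc m_inv field_Units by (simp add: i_def)
    have 1: "(i, \<ominus> (i \<otimes> i \<otimes> y)) \<in> dcl R S" "(i, \<ominus> (i \<otimes> i \<otimes> z)) \<in> dcl R T"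
      unfolding i_def using dcl.m_inv h m_inv by metis+
    have 2: "(\<ominus> (i \<otimes> i \<otimes> y), \<ominus> (i \<otimes> i \<otimes> w \<oplus> (i \<otimes> \<ominus> (i \<otimes> i \<otimes> z) \<oplus> \<ominus> (i \<otimes> i \<otimes> z) \<otimes> i) \<otimes> y)) \<in> dcl R T"
      by (intro dcl.a_inv dcl.mult 1 h)
    have 3: "(\<ominus> (i \<otimes> i \<otimes> z), \<ominus> (i \<otimes> i \<otimes> w \<oplus> (i \<otimes> \<ominus> (i \<otimes> i \<otimes> y) \<oplus> \<ominus> (i \<otimes> i \<otimes> y) \<otimes> i) \<otimes> z)) \<in> dcl R S"
      by (intro dcl.a_inv dcl.mult 1 h)
    have "\<ominus> (i \<otimes> i \<otimes> w \<oplus> (i \<otimes> \<ominus> (i \<otimes> i \<otimes> z) \<oplus> \<ominus> (i \<otimes> i \<otimes> z) \<otimes> i) \<otimes> y) =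
      \<ominus> (i \<otimes> i \<otimes> w \<oplus> (i \<otimes> \<ominus> (i \<otimes> i \<otimes> y) \<oplus> \<ominus> (i \<otimes> i \<otimes> y) \<otimes> i) \<otimes> z)"
      using ic cc by algebra
    then show ?case using 1 2 3 unfolding i_def by metis
  next
    case (eng_add x x')
    then obtain y z w y' z' w' where h: "(x, y) \<in> dcl R S" "(x, z) \<in> dcl R T" "(y, w) \<in> dcl R T" "(z, w) \<in> dcl R S"
      and h': "(x', y') \<in> dcl R S" "(x', z') \<in> dcl R T" "(y', w') \<in> dcl R T" "(z', w') \<in> dcl R S"
      by blast
    show ?case by (intro exI conjI) (rule dcl.add, rule h, rule h')+
  next
    case (eng_mult x x')
    then obtain y z w y' z' w' where h: "(x, y) \<in> dcl R S" "(x, z) \<in> dcl R T" "(y, w) \<in> dcl R T" "(z, w) \<in> dcl R S"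
      and h': "(x', y') \<in> dcl R S" "(x', z') \<in> dcl R T" "(y', w') \<in> dcl R T" "(z', w') \<in> dcl R S"
      by blast
    have cc: "x \<in> carrier R" "y \<in> carrier R" "z \<in> carrier R" "w \<in> carrier R"
      "x' \<in> carrier R" "y' \<in> carrier R" "z' \<in> carrier R" "w' \<in> carrier R" using h h' c by auto
    have 1: "(x \<otimes> x', x \<otimes> y' \<oplus> y \<otimes> x') \<in> dcl R S" "(x \<otimes> x', x \<otimes> z' \<oplus> z \<otimes> x') \<in> dcl R T"
      by (intro dcl.mult h h')+
    have 2: "(x \<otimes> y' \<oplus> y \<otimes> x', (x \<otimes> w' \<oplus> z \<otimes> y') \<oplus> (y \<otimes> z' \<oplus> w \<otimes> x')) \<in> dcl R T"
      by (intro dcl.mult dcl.add h h')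
    have 3: "(x \<otimes> z' \<oplus> z \<otimes> x', (x \<otimes> w' \<oplus> y \<otimes> z') \<oplus> (z \<otimes> y' \<oplus> w \<otimes> x')) \<in> dcl R S"
      by (intro dcl.mult dcl.add h h')
    have "(x \<otimes> w' \<oplus> z \<otimes> y') \<oplus> (y \<otimes> z' \<oplus> w \<otimes> x') = (x \<otimes> w' \<oplus> y \<otimes> z') \<oplus> (z \<otimes> y' \<oplus> w \<otimes> x')"
      using cc by algebra
    then show ?case using 1 2 3 by metis
  qed
  then show "x \<in> comm_set (dcl R S) (dcl R T)" unfolding comm_set_def by blast
qed

text \<open>Two derivations that commute on \<open>F\<close> also commute at a separable element: applying one after
  the other to a separable equation gives, in both orders, the same linear equation for the result.\<close>

lemma comm_sep_root:
  assumes S: "S \<subseteq> carrier R \<times> carrier R" and T: "T \<subseteq> carrier R \<times> carrier R"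
    and fS: "fnl R (dcl R S)" and fT: "fnl R (dcl R T)"
    and F: "F \<subseteq> comm_set (dcl R S) (dcl R T)" and x: "sep_root R F x"
    and h: "(x, y) \<in> dcl R S" "(x, z) \<in> dcl R T" "(y, w) \<in> dcl R T" "(z, w') \<in> dcl R S"
  shows "w = w'"
proof -
  interpret D: cring "dual R" by (rule dual_cring)
  note c = dcl_carrier[OF S] dcl_carrier[OF T]
  obtain p where p: "set p \<subseteq> F" "eval p x = \<zero>" "eval (deriv_list R p) x \<noteq> \<zero>"
    using x unfolding sep_root_def by blast
  have "\<exists>qs. p = map fst qs \<and> (\<forall>(c, ci, cj, w) \<in> set qs. (c, ci) \<in> dcl R S \<and> (c, cj) \<in> dcl R T \<and> (ci, w) \<in> dcl R T \<and> (cj, w) \<in> dcl R S)"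
    using p(1)
  proof (induction p)
    case (Cons a p)
    then obtain qs where qs: "p = map fst qs" "\<forall>(c, ci, cj, w) \<in> set qs. (c, ci) \<in> dcl R S \<and> (c, cj) \<in> dcl R T \<and> (ci, w) \<in> dcl R T \<and> (cj, w) \<in> dcl R S"
      by auto
    have "a \<in> comm_set (dcl R S) (dcl R T)" using Cons F by auto
    then obtain ci cj w where "(a, ci) \<in> dcl R S \<and> (a, cj) \<in> dcl R T \<and> (ci, w) \<in> dcl R T \<and> (cj, w) \<in> dcl R S"
      unfolding comm_set_def by blast
    then show ?case using qs by (intro exI[of _ "(a, ci, cj, w) # qs"]) auto
  qed simp
  then obtain qs where qs: "p = map fst qs" and
    q: "\<And>c ci cj w. (c, ci, cj, w) \<in> set qs \<Longrightarrow> (c, ci) \<in> dcl R S \<and> (c, cj) \<in> dcl R T \<and> (ci, w) \<in> dcl R T \<and> (cj, w) \<in> dcl R S"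
    by blast
  define pi where "pi = map (\<lambda>(c, ci, cj, w). ci) qs"
  define pj where "pj = map (\<lambda>(c, ci, cj, w). cj) qs"
  define pw where "pw = map (\<lambda>(c, ci, cj, w). w) qs"
  have p_eq: "p = map (\<lambda>(c, ci, cj, w). c) qs" using qs by (auto simp: split_def)
  \<comment> \<open>The derivative of the equation along \<open>S\<close> is differentiated once
    more along \<open>T\<close>. Stating this for arbitrary \<open>S\<close> and \<open>T\<close>
    gives the opposite order by exchanging their roles.\<close>
  have key: "(eval pw x \<oplus> eval (deriv_list R pi) x \<otimes> z) \<oplus>
      (eval (deriv_list R p) x \<otimes> w \<oplus> (eval (deriv_list R pj) x \<oplus> eval (deriv_list R (deriv_list R p)) x \<otimes> z) \<otimes> y) = \<zero>"
    if ST: "S \<subseteq> carrier R \<times> carrier R" "T \<subseteq> carrier R \<times> carrier R" "fnl R (dcl R S)" "fnl R (dcl R T)"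
      and h: "(x, y) \<in> dcl R S" "(x, z) \<in> dcl R T" "(y, w) \<in> dcl R T"
      and l: "set (zip p pi) \<subseteq> dcl R S" "set (zip p pj) \<subseteq> dcl R T" "set (zip pi pw) \<subseteq> dcl R T"
      and len: "length pi = length p" "length pj = length p" "length pw = length p"
    for S T y z w pi pj pw
  proof -
    note c = dcl_carrier[OF ST(1)] dcl_carrier[OF ST(2)]
    have cc: "set (zip p pi) \<subseteq> carrier R \<times> carrier R" "set (zip p pj) \<subseteq> carrier R \<times> carrier R"
      "set (zip pi pw) \<subseteq> carrier R \<times> carrier R"
      and xc: "x \<in> carrier R" "y \<in> carrier R" "z \<in> carrier R" "w \<in> carrier R"
      using c l h by auto
    have T: "subring (dcl R T) (dual R)" using dcl_subring ST by blast
    \<comment> \<open>The derivative polynomial of \<open>p\<close>, its coefficients paired with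
      their values under \<open>T\<close>. The pair \<open>E\<close> below has first component zero
      by the first differentiation, so its second component is zero too.\<close>
    let ?d = "deriv_list (dual R) (zip p pj)"
    have E: "D.eval (zip pi pw) (x, z) \<oplus>\<^bsub>dual R\<^esub> D.eval ?d (x, z) \<otimes>\<^bsub>dual R\<^esub> (y, w) \<in> dcl R T"
      by (intro subringE(6,7)[OF T] D.subring_eval[OF T] D.subring_deriv_list[OF T] l h)
    have dc: "set ?d \<subseteq> carrier R \<times> carrier R" using D.deriv_list_carrier[of "zip p pj"] cc by simp
    have e0: "eval pi x \<oplus> eval (deriv_list R p) x \<otimes> y = \<zero>"
      using fnl_relation[OF ST(1,3) l(1) h(1)] p(2) len by simp
    define EE where "EE = D.eval (zip pi pw) (x, z) \<oplus>\<^bsub>dual R\<^esub> D.eval ?d (x, z) \<otimes>\<^bsub>dual R\<^esub> (y, w)"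
    have fst: "fst EE = \<zero>"
      using e0 cc xc dc len unfolding EE_def by (simp add: eval_dual fst_deriv_list_dual)
    have snd: "snd EE =
      (eval pw x \<oplus> eval (deriv_list R pi) x \<otimes> z) \<oplus>
      (eval (deriv_list R p) x \<otimes> w \<oplus> (eval (deriv_list R pj) x \<oplus> eval (deriv_list R (deriv_list R p)) x \<otimes> z) \<otimes> y)"
      using cc xc dc len unfolding EE_def by (simp add: eval_dual fst_deriv_list_dual snd_deriv_list_dual)
    have "EE \<in> dcl R T" unfolding EE_def by (rule E)
    then have "(\<zero>, snd EE) \<in> dcl R T" unfolding fst[symmetric] by simp
    then have "snd EE = \<zero>" using ST(4) unfolding fnl_def by blast
    then show ?thesis unfolding snd .
  qed
  have sets: "set (zip p pi) \<subseteq> dcl R S" "set (zip p pj) \<subseteq> dcl R T" "set (zip pi pw) \<subseteq> dcl R T" "set (zip pj pw) \<subseteq> dcl R S"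
    unfolding p_eq pi_def pj_def pw_def zip_map_map by (auto simp: zip_same_conv_map dest: q)
  have len: "length pi = length p" "length pj = length p" "length pw = length p"
    by (simp_all add: qs pi_def pj_def pw_def)
  have 1: "(eval pw x \<oplus> eval (deriv_list R pi) x \<otimes> z) \<oplus>
      (eval (deriv_list R p) x \<otimes> w \<oplus> (eval (deriv_list R pj) x \<oplus> eval (deriv_list R (deriv_list R p)) x \<otimes> z) \<otimes> y) = \<zero>"
    by (rule key[OF S T fS fT h(1-3) sets(1-3) len])
  have 2: "(eval pw x \<oplus> eval (deriv_list R pj) x \<otimes> y) \<oplus>
      (eval (deriv_list R p) x \<otimes> w' \<oplus> (eval (deriv_list R pi) x \<oplus> eval (deriv_list R (deriv_list R p)) x \<otimes> y) \<otimes> z) = \<zero>"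
    by (rule key[OF T S fT fS h(2,1,4) sets(2,1,4) len(2,1,3)])
  have lc: "set p \<subseteq> carrier R" "set pi \<subseteq> carrier R" "set pj \<subseteq> carrier R" "set pw \<subseteq> carrier R"
    using q c unfolding p_eq pi_def pj_def pw_def by fastforce+
  have xc: "x \<in> carrier R" "y \<in> carrier R" "z \<in> carrier R" "w \<in> carrier R" "w' \<in> carrier R" using c h by auto
  define A where "A = eval (deriv_list R p) x"
  define B where "B = eval (deriv_list R (deriv_list R p)) x"
  define I where "I = eval (deriv_list R pi) x"
  define J where "J = eval (deriv_list R pj) x"
  define W where "W = eval pw x"
  have ec: "A \<in> carrier R" "B \<in> carrier R" "I \<in> carrier R" "J \<in> carrier R" "W \<in> carrier R"
    unfolding A_def B_def I_def J_def W_def by (intro eval_in_carrier deriv_list_carrier lc xc)+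
  \<comment> \<open>The two second-order equations have the same mixed terms and differ only in
    \<open>A\<close> times the unknown; \<open>A\<close> is nonzero because the root is
    simple.\<close>
  have "A \<otimes> (w \<ominus> w') = ((W \<oplus> I \<otimes> z) \<oplus> (A \<otimes> w \<oplus> (J \<oplus> B \<otimes> z) \<otimes> y)) \<ominus> ((W \<oplus> J \<otimes> y) \<oplus> (A \<otimes> w' \<oplus> (I \<oplus> B \<otimes> y) \<otimes> z))"
    using ec xc by algebra
  also have "\<dots> = \<zero>" using 1 2 unfolding A_def B_def I_def J_def W_def by (simp add: minus_eq r_neg)
  finally have "w \<ominus> w' = \<zero>" using p(3) ec xc integral unfolding A_def[symmetric] by blast
  then show ?thesis using xc by (metis r_right_minus_eq)
qed

end

section \<open>Extending derivations along a sequence of generators\<close>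

text \<open>The polynomial X - x. With it, leaders that are rational over their predecessors are
  treated in \<open>commuting_values\<close> like merely separable ones.\<close>

lemma (in field) sep_root_mem:
  assumes "subfield F R" "x \<in> F"
  shows "sep_root R F x"
proof -
  have x: "x \<in> carrier R" using assms subfieldE(3) by blast
  have "set [\<one>, \<ominus> x] \<subseteq> F" using assms subringE[OF subfieldE(1)[OF assms(1)]] by auto
  moreover have "eval [\<one>, \<ominus> x] x = \<zero>" "eval (deriv_list R [\<one>, \<ominus> x]) x \<noteq> \<zero>"
    using x by (simp_all add: r_neg)
  ultimately show ?thesis unfolding sep_root_def by blast
qed

lemma comm_set_mono: "G \<subseteq> G' \<Longrightarrow> H \<subseteq> H' \<Longrightarrow> comm_set G H \<subseteq> comm_set G' H'"
  unfolding comm_set_def by blast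

text \<open>The generators are numbered along the order: \<open>u x\<close> is the generator with number \<open>x\<close> and its image
  under the derivation with index \<open>i\<close> is to be \<open>u (sh i x)\<close>. The numbers in \<open>Lam\<close> are those of the
  leaders, the generators with number below \<open>N1\<close> are given by \<open>u0\<close>, and the tower \<open>A\<close>, \<open>t\<close> supplies
  the remaining non-leaders.\<close>

locale jet_extension = field R for R (structure) +
  fixes K :: "'a set" and m :: nat and B :: "nat \<Rightarrow> ('a \<times> 'a) set"
    and A :: "nat \<Rightarrow> 'a set" and t :: "nat \<Rightarrow> 'a"
    and Lam :: "nat set" and sh :: "nat \<Rightarrow> nat \<Rightarrow> nat" and N0 N1 :: nat and u0 :: "nat \<Rightarrow> 'a"
  assumes B_mem: "i < m \<Longrightarrow> B i \<subseteq> K \<times> K"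
    and B_fst: "i < m \<Longrightarrow> fst ` B i = K"
    and B_comm: "i < m \<Longrightarrow> j < m \<Longrightarrow> K \<subseteq> comm_set (B i) (B j)"
    and A_field: "subfield (A s) R" and A_Suc: "A s \<subseteq> A (Suc s)" and K_A: "K \<subseteq> A 0"
    and t_mem: "t s \<in> A (Suc s)" and t_transc: "transc R (A s) (t s)"
    and sh_mono: "i < m \<Longrightarrow> x < y \<Longrightarrow> sh i x < sh i y"
    and sh_gt: "i < m \<Longrightarrow> x < sh i x"
    and sh_comm: "i < m \<Longrightarrow> j < m \<Longrightarrow> sh i (sh j x) = sh j (sh i x)"
    and N01: "N0 \<le> N1"
    and sh_N0: "i < m \<Longrightarrow> x < N0 \<Longrightarrow> sh i x < N1"
    and sh_N1: "i < m \<Longrightarrow> N0 \<le> x \<Longrightarrow> N1 \<le> sh i x"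
    and Lam_sh: "i < m \<Longrightarrow> x \<in> Lam \<Longrightarrow> sh i x \<in> Lam"
    and u0_low: "x < N0 \<Longrightarrow> u0 x \<in> A 0"
    and u0_t: "N0 \<le> x \<Longrightarrow> x < N1 \<Longrightarrow> x \<notin> Lam \<Longrightarrow> u0 x = t x"
    and u0_Lam: "N0 \<le> x \<Longrightarrow> x < N1 \<Longrightarrow> x \<in> Lam \<Longrightarrow> u0 x \<in> generate_field R (K \<union> u0 ` {..<x})"
    and u0_sep: "x < N0 \<Longrightarrow> x \<in> Lam \<Longrightarrow> sep_root R (generate_field R (K \<union> u0 ` {..<x})) (u0 x)"
    and base: "i < m \<Longrightarrow> fnl R (dcl R (B i \<union> {(u0 x, u0 (sh i x)) | x. x < N0}))"
    and Lam_pred: "y \<in> Lam \<Longrightarrow> N1 \<le> y \<Longrightarrow> \<exists>i<m. \<exists>p\<in>Lam. sh i p = y"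
    and confluence: "N1 \<le> y \<Longrightarrow> i < m \<Longrightarrow> j < m \<Longrightarrow> p \<in> Lam \<Longrightarrow> q \<in> Lam \<Longrightarrow> sh i p = y \<Longrightarrow> sh j q = y \<Longrightarrow>
      \<exists>l<m. \<exists>s\<in>Lam. sh l s = y \<and>
        ((i = l \<and> p = s) \<or> (\<exists>z\<in>Lam. p = sh l z \<and> s = sh i z)) \<and>
        ((j = l \<and> q = s) \<or> (\<exists>z\<in>Lam. q = sh l z \<and> s = sh j z))"
begin

section \<open>Admissible values\<close>

definition U :: "(nat \<Rightarrow> 'a) \<Rightarrow> nat \<Rightarrow> 'a set" where
  "U u s = generate_field R (K \<union> u ` {..<s})"

definition G :: "(nat \<Rightarrow> 'a) \<Rightarrow> nat \<Rightarrow> nat \<Rightarrow> ('a \<times> 'a) set" where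
  "G u i s = B i \<union> {(u x, u (sh i x)) | x. x < s}"

text \<open>\<open>adm u z r\<close>: the value \<open>r\<close> may be chosen for \<open>u z\<close> when \<open>u\<close> is already known below \<open>z\<close>. At a leader it is
  forced by every leader \<open>p\<close> with \<open>sh i p = z\<close>.\<close>

definition adm :: "(nat \<Rightarrow> 'a) \<Rightarrow> nat \<Rightarrow> 'a \<Rightarrow> bool" where
  "adm u z r \<longleftrightarrow> (z < N1 \<longrightarrow> r = u0 z) \<and> (N1 \<le> z \<and> z \<notin> Lam \<longrightarrow> r = t z) \<and>
    (N1 \<le> z \<and> z \<in> Lam \<longrightarrow> r \<in> U u z \<and>
      (\<forall>i<m. \<forall>p\<in>Lam. sh i p = z \<longrightarrow> (u p, r) \<in> dcl R (G u i p)))"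

lemma A_mono: "s \<le> s' \<Longrightarrow> A s \<subseteq> A s'"
  using A_Suc by (rule lift_Suc_mono_le)

lemma A_carrier: "A s \<subseteq> carrier R"
  using A_field subfieldE(3) by blast

lemma K_carrier: "K \<subseteq> carrier R"
  using K_A A_carrier by blast

lemma U_cong: "(\<And>x. x < s \<Longrightarrow> u x = w x) \<Longrightarrow> U u s = U w s"
  unfolding U_def by (metis (no_types, lifting) image_cong lessThan_iff)

lemma G_cong:
  assumes "i < m" "\<And>x. x < sh i s \<Longrightarrow> u x = w x"
  shows "G u i s = G w i s"
proof -
  have "u x = w x \<and> u (sh i x) = w (sh i x)" if "x < s" for x
    using assms sh_gt[of i s] sh_mono[of i x s] that by simp
  then show ?thesis unfolding G_def by (metis (no_types, opaque_lifting))
qed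

text \<open>If \<open>sh i p = z\<close>, the pairs in \<open>G u i p\<close> involve only values
  below \<open>z\<close>. Hence \<open>adm\<close> can serve as the clause of a recursion.\<close>

lemma adm_cong:
  assumes "\<And>x. x < z \<Longrightarrow> u x = w x"
  shows "adm u z r = adm w z r"
proof -
  have U: "U u z = U w z" using assms by (rule U_cong)
  have "G u i p = G w i p \<and> u p = w p" if "i < m" "sh i p = z" for i p
    using G_cong[OF that(1), of p u w] that assms sh_gt[of i p] by simp
  then show ?thesis unfolding adm_def U by auto
qed

text \<open>Only the values below \<open>Y\<close> are assumed admissible. The same facts then serve
  both for finding a value at \<open>Y\<close> and for the complete sequence.\<close>

context
  fixes u :: "nat \<Rightarrow> 'a" and Y :: nat
  assumes u: "\<And>z. z < Y \<Longrightarrow> adm u z (u z)"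
begin

lemma u_eq_u0: "x < Y \<Longrightarrow> x < N1 \<Longrightarrow> u x = u0 x"
  using u unfolding adm_def by blast

lemma U_eq_u0: "s \<le> Y \<Longrightarrow> s \<le> N1 \<Longrightarrow> U u s = U u0 s"
  using u_eq_u0 by (intro U_cong) auto

text \<open>From \<open>N0\<close> on only non-leaders enlarge the field, and the one with number
  \<open>z\<close> is \<open>t z\<close>. The field generated before stage \<open>z\<close>
  therefore stays inside \<open>A z\<close>, over which \<open>t z\<close> is
  transcendental.\<close>

lemma u_mem_Suc: "z < Y \<Longrightarrow> u z \<in> A (Suc z)"
proof (induction z rule: less_induct)
  case (less z)
  have "u ` {..<z} \<subseteq> A z"
  proof (rule image_subsetI)
    fix x assume "x \<in> {..<z}"
    then show "u x \<in> A z" using less A_mono[of "Suc x" z] by auto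
  qed
  then have Uz: "U u z \<subseteq> A z"
    unfolding U_def using K_A A_mono[of 0 z] A_carrier[of z] by (intro generate_field_min_subfield1 A_field) blast+
  have low: "A 0 \<subseteq> A (Suc z)" by (rule A_mono) simp
  consider "z < N0" | "N0 \<le> z" "z \<notin> Lam" | "N0 \<le> z" "z \<in> Lam" by linarith
  then show ?case
  proof cases
    case 1
    then show ?thesis using u_eq_u0 less N01 u0_low low by auto
  next
    case 2
    then have "u z = t z" using u_eq_u0[of z] u0_t[of z] u[of z] less unfolding adm_def by (cases "z < N1") auto
    then show ?thesis using t_mem by simp
  next
    case 3
    have "u z \<in> U u z"
    proof (cases "z < N1")
      case True
      then show ?thesis using u_eq_u0[of z] u0_Lam[of z] U_eq_u0[of z] 3 less by (simp add: U_def)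
    next
      case False
      then show ?thesis using u[of z] 3 less unfolding adm_def by auto
    qed
    then show ?thesis using Uz A_Suc by blast
  qed
qed

lemma u_Lam: "N0 \<le> z \<Longrightarrow> z < Y \<Longrightarrow> z \<in> Lam \<Longrightarrow> u z \<in> U u z"
proof (cases "z < N1")
  case True
  assume "N0 \<le> z" "z < Y" "z \<in> Lam"
  then show ?thesis using True u_eq_u0[of z] u0_Lam[of z] U_eq_u0[of z] by (simp add: U_def)
next
  case False
  assume "N0 \<le> z" "z < Y" "z \<in> Lam"
  then show ?thesis using False u[of z] unfolding adm_def by auto
qed

lemma u_nonLam: "N0 \<le> z \<Longrightarrow> z < Y \<Longrightarrow> z \<notin> Lam \<Longrightarrow> u z = t z"
  using u_eq_u0[of z] u0_t[of z] u[of z] unfolding adm_def by (cases "z < N1") auto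

lemma u_carrier: "z < Y \<Longrightarrow> u z \<in> carrier R"
  using u_mem_Suc A_carrier by blast

lemma gens_U: "s \<le> Y \<Longrightarrow> K \<union> u ` {..<s} \<subseteq> carrier R"
  using K_carrier u_carrier by auto

lemma U_subfield: "s \<le> Y \<Longrightarrow> subfield (U u s) R"
  unfolding U_def using gens_U generate_field_is_subfield by blast

lemma U_A: "s \<le> Y \<Longrightarrow> U u s \<subseteq> A s"
proof -
  assume s: "s \<le> Y"
  have "u ` {..<s} \<subseteq> A s"
  proof (rule image_subsetI)
    fix x assume "x \<in> {..<s}"
    then show "u x \<in> A s" using s u_mem_Suc[of x] A_mono[of "Suc x" s] by auto
  qed
  then show ?thesis
    unfolding U_def using K_A A_mono[of 0 s] A_carrier[of s] by (intro generate_field_min_subfield1 A_field) blast+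
qed

lemma U_mem: "x < s \<Longrightarrow> u x \<in> U u s" "c \<in> K \<Longrightarrow> c \<in> U u s"
  unfolding U_def by (auto intro: generate_field.incl)

lemma G_carrier:
  assumes "i < m" "s \<le> Y" "\<And>x. x < s \<Longrightarrow> sh i x < Y"
  shows "G u i s \<subseteq> carrier R \<times> carrier R"
  unfolding G_def using B_mem[OF assms(1)] K_carrier u_carrier assms by fastforce

lemma G_fst:
  assumes "i < m" "s \<le> Y" "\<And>x. x < s \<Longrightarrow> sh i x < Y"
  shows "fst ` dcl R (G u i s) = U u s"
proof -
  have "fst ` G u i s = K \<union> u ` {..<s}" unfolding G_def image_Un B_fst[OF assms(1)] by force
  then show ?thesis using dcl_fst[OF G_carrier[OF assms]] by (simp add: U_def)
qed

text \<open>One generator is added at a time. Below \<open>N0\<close> the assumption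
  \<open>base\<close> applies. At a non-leader any value may be prescribed, by
  \<open>fnl_transc\<close>. At a leader the new pair lies in the closure of the earlier ones by
  \<open>adm\<close>, so nothing is added.\<close>

lemma G_fnl:
  assumes "i < m" "s \<le> Y" "\<And>x. x < s \<Longrightarrow> sh i x < Y"
  shows "fnl R (dcl R (G u i s))"
  using assms(2,3)
proof (induction s)
  case 0
  have "G u i 0 \<subseteq> B i \<union> {(u0 x, u0 (sh i x)) | x. x < N0}" unfolding G_def by auto
  then show ?case by (intro fnl_mono[OF base[OF assms(1)]] dcl_mono)
next
  case (Suc s)
  have IH: "fnl R (dcl R (G u i s))" using Suc by simp
  have ins: "G u i (Suc s) = insert (u s, u (sh i s)) (G u i s)"
    unfolding G_def by (auto simp: less_Suc_eq)
  have sY: "s < Y" "sh i s < Y" using Suc.prems by auto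
  note Gc = G_carrier[OF assms(1), of s] and Gf = G_fst[OF assms(1), of s]
  consider "s < N0" | "N0 \<le> s" "s \<notin> Lam" | "N0 \<le> s" "s \<in> Lam" by linarith
  then show ?case
  proof cases
    case 1
    have "G u i (Suc s) \<subseteq> B i \<union> {(u0 x, u0 (sh i x)) | x. x < N0}"
    proof -
      have "(u x, u (sh i x)) \<in> {(u0 x, u0 (sh i x)) | x. x < N0}" if "x < Suc s" for x
      proof -
        have "x < N0" "sh i x < Y" "x < Y" using that 1 Suc.prems by auto
        then show ?thesis using u_eq_u0 N01 sh_N0[OF assms(1), of x] by auto
      qed
      then show ?thesis unfolding G_def by blast
    qed
    then show ?thesis by (intro fnl_mono[OF base[OF assms(1)]] dcl_mono)
  next
    case 2
    then have "transc R (fst ` dcl R (G u i s)) (u s)"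
      using u_nonLam[of s] sY U_A[of s] Gf Suc.prems transc_mono[OF t_transc, of "U u s" s] by simp
    then show ?thesis unfolding ins
      using fnl_transc[OF Gc IH] u_carrier sY Suc.prems by simp
  next
    case 3
    have a: "adm u (sh i s) (u (sh i s))" using u sY by blast
    have "N1 \<le> sh i s" "sh i s \<in> Lam" using 3 sh_N1[OF assms(1)] Lam_sh[OF assms(1)] by auto
    then have v: "(u s, u (sh i s)) \<in> dcl R (G u i s)"
      using a 3 assms(1) unfolding adm_def by blast
    have "dcl R (G u i (Suc s)) \<subseteq> dcl R (G u i s)"
      unfolding ins
    proof (rule dcl_subset_dcl, rule insert_subsetI[OF v])
      show "G u i s \<subseteq> dcl R (G u i s)" by (rule subsetI, rule dcl.incl)
    qed
    then show ?thesis by (rule fnl_mono[OF IH])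
  qed
qed

text \<open>A single confluence step: \<open>sh l z\<close> and \<open>sh i z\<close> are
  predecessors of \<open>Y\<close> with the common predecessor \<open>z\<close>. For
  \<open>x < z\<close> both orders of differentiation lead from \<open>u x\<close> to the value of
  \<open>u\<close> at one number below \<open>Y\<close>. So the derivations commute on
  \<open>U u z\<close>, over which \<open>u z\<close> is separable.\<close>

lemma commuting_values:
  assumes z: "z \<in> Lam" and i: "i < m" and l: "l < m" and Y: "sh i (sh l z) = Y"
    and v: "(u (sh l z), v) \<in> dcl R (G u i (sh l z))" and w: "(u (sh i z), w) \<in> dcl R (G u l (sh i z))"
  shows "v = w"
proof -
  have pY: "sh l z < Y" "sh i z < Y" using sh_gt[OF i] sh_gt[OF l] Y sh_comm[OF i l, of z] by metis+
  have lt: "z < sh l z" "z < sh i z" using sh_gt i l by auto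
  have bi: "sh i x < Y" if "x < sh l z" for x using sh_mono[OF i that] Y by simp
  have bl: "sh l x < Y" if "x < sh i z" for x using sh_mono[OF l that] Y sh_comm[OF i l] by simp
  have Gc: "G u i (sh l z) \<subseteq> carrier R \<times> carrier R" "G u l (sh i z) \<subseteq> carrier R \<times> carrier R"
    using G_carrier[OF i] G_carrier[OF l] bi bl pY by auto
  have Gf: "fnl R (dcl R (G u i (sh l z)))" "fnl R (dcl R (G u l (sh i z)))"
    using G_fnl[OF i] G_fnl[OF l] bi bl pY by auto
  have "U u z \<subseteq> comm_set (dcl R (G u l (sh i z))) (dcl R (G u i (sh l z)))"
    unfolding U_def
  proof (rule comm_set_generate_field[OF Gc(2,1)], rule Un_least)
    show "K \<subseteq> comm_set (dcl R (G u l (sh i z))) (dcl R (G u i (sh l z)))"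
      by (rule subset_trans[OF B_comm[OF l i] comm_set_mono]) (auto simp: G_def intro: dcl.incl)
    show "u ` {..<z} \<subseteq> comm_set (dcl R (G u l (sh i z))) (dcl R (G u i (sh l z)))"
    proof (rule image_subsetI)
      fix x assume "x \<in> {..<z}"
      then have x: "x < z" "x < sh i z" "x < sh l z" "sh l x < sh l z" "sh i x < sh i z"
        using lt sh_mono i l by auto
      have "(u x, u (sh l x)) \<in> dcl R (G u l (sh i z))" "(u x, u (sh i x)) \<in> dcl R (G u i (sh l z))"
        "(u (sh l x), u (sh i (sh l x))) \<in> dcl R (G u i (sh l z))"
        "(u (sh i x), u (sh l (sh i x))) \<in> dcl R (G u l (sh i z))"
        using x by (auto intro!: dcl.incl simp: G_def)
      then show "u x \<in> comm_set (dcl R (G u l (sh i z))) (dcl R (G u i (sh l z)))"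
        unfolding comm_set_def using sh_comm[OF i l, of x] by auto
    qed
  qed
  moreover have "sep_root R (U u z) (u z)"
  proof (cases "z < N0")
    case True
    then show ?thesis using u0_sep[OF True z] u_eq_u0[of z] U_eq_u0[of z] N01 lt pY by (simp add: U_def)
  next
    case False
    then show ?thesis using sep_root_mem[OF U_subfield u_Lam] z lt pY by simp
  qed
  moreover have "(u z, u (sh l z)) \<in> dcl R (G u l (sh i z))" "(u z, u (sh i z)) \<in> dcl R (G u i (sh l z))"
    using lt by (auto intro!: dcl.incl simp: G_def)
  ultimately show ?thesis using comm_sep_root[OF Gc(2,1) Gf(2,1) _ _ _ _ v w] by blast
qed

lemma adm_exists: "\<exists>r. adm u Y r"
proof (cases "N1 \<le> Y \<and> Y \<in> Lam")
  case False
  then show ?thesis unfolding adm_def by (metis not_le)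
next
  case True
  have val: "\<exists>v. (u p, v) \<in> dcl R (G u i p)" and vU: "\<And>v. (u p, v) \<in> dcl R (G u i p) \<Longrightarrow> v \<in> U u Y"
    and fn: "\<And>v w. (u p, v) \<in> dcl R (G u i p) \<Longrightarrow> (u p, w) \<in> dcl R (G u i p) \<Longrightarrow> v = w"
    if i: "i < m" and p: "p \<in> Lam" "sh i p = Y" for i p
  proof -
    have pY: "p < Y" using sh_gt[OF i, of p] p by simp
    have b: "sh i x < Y" if "x < p" for x using sh_mono[OF i that] p by simp
    \<comment> \<open>A leader whose shift reaches \<open>N1\<close> has number at least
      \<open>N0\<close>. It is therefore rational over its predecessors, and its derivative is
      already defined.\<close>
    have "N0 \<le> p" using sh_N0[OF i, of p] True p by (meson not_le)
    then have "u p \<in> fst ` dcl R (G u i p)" using G_fst[OF i] u_Lam pY b p by simp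
    then show "\<exists>v. (u p, v) \<in> dcl R (G u i p)" by force
    note Gc = G_carrier[OF i less_imp_le[OF pY] b]
    show "v = w" if "(u p, v) \<in> dcl R (G u i p)" "(u p, w) \<in> dcl R (G u i p)" for v w
      using fnl_unique[OF Gc G_fnl[OF i less_imp_le[OF pY] b] that] .
    show "v \<in> U u Y" if "(u p, v) \<in> dcl R (G u i p)" for v
    proof -
      have "(x, y) \<in> G u i p \<Longrightarrow> x \<in> U u Y \<and> y \<in> U u Y" for x y
        unfolding G_def using U_mem[of _ Y] B_mem[OF i] pY b by auto
      then have "fst ` G u i p \<subseteq> U u Y" "snd ` G u i p \<subseteq> U u Y" by force+
      then show ?thesis using dcl_snd_field[OF Gc U_subfield _ _ that] by simp
    qed
  qed
  obtain i p where ip: "i < m" "p \<in> Lam" "sh i p = Y" using Lam_pred True by blast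
  obtain v where v: "(u p, v) \<in> dcl R (G u i p)" using val[OF ip] by blast
  have "(u q, v) \<in> dcl R (G u j q)" if jq: "j < m" "q \<in> Lam" "sh j q = Y" for j q
  proof -
    obtain w where w: "(u q, w) \<in> dcl R (G u j q)" using val[OF jq] by blast
    \<comment> \<open>The values coming from \<open>p\<close> and \<open>q\<close> are compared
      through a third predecessor \<open>s\<close>, to which each of them is equal or connected by
      one step.\<close>
    obtain l s where l: "l < m" and s: "s \<in> Lam" "sh l s = Y"
      and 1: "(i = l \<and> p = s) \<or> (\<exists>z\<in>Lam. p = sh l z \<and> s = sh i z)"
      and 2: "(j = l \<and> q = s) \<or> (\<exists>z\<in>Lam. q = sh l z \<and> s = sh j z)"
      using confluence[of Y i j p q] True ip jq by blast
    obtain v' where v': "(u s, v') \<in> dcl R (G u l s)" using val[OF l s] by blast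
    have "v = v'" using 1
    proof
      assume "i = l \<and> p = s"
      then show ?thesis using fn[OF ip] v v' by blast
    next
      assume "\<exists>z\<in>Lam. p = sh l z \<and> s = sh i z"
      then obtain z where "z \<in> Lam" "p = sh l z" "s = sh i z" by blast
      then show ?thesis using commuting_values[of z i l v v'] ip l v v' by simp
    qed
    moreover have "w = v'" using 2
    proof
      assume "j = l \<and> q = s"
      then show ?thesis using fn[OF jq] w v' by blast
    next
      assume "\<exists>z\<in>Lam. q = sh l z \<and> s = sh j z"
      then obtain z where "z \<in> Lam" "q = sh l z" "s = sh j z" by blast
      then show ?thesis using commuting_values[of z j l w v'] jq l w v' by simp
    qed
    ultimately show ?thesis using w by simp
  qed
  then have "adm u Y v" using True vU[OF ip v] unfolding adm_def by auto
  then show ?thesis by blast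
qed

end

theorem extension:
  "\<exists>u D. (\<forall>x<N1. u x = u0 x) \<and> range u \<subseteq> carrier R \<and>
    comm_derivations R (generate_field R (K \<union> range u)) m D \<and>
    (\<forall>i<m. (\<forall>(x, y)\<in>B i. D i x = y) \<and> (\<forall>x. D i (u x) = u (sh i x)))"
proof -
  have "\<exists>u. \<forall>z. adm u z (u z)"
  proof (rule dependent_wellorder_choice)
    show "adm f x r = adm g x r" if "\<And>y. y < x \<Longrightarrow> f y = g y" for r f g x
      using adm_cong that by blast
    show "\<exists>r. adm f x r" if "\<And>y. y < x \<Longrightarrow> adm f y (f y)" for x f
      using adm_exists that by blast
  qed
  then obtain u where adm: "\<And>z. adm u z (u z)" by blast
  have uc: "u x \<in> carrier R" for x using u_carrier[of "Suc x" u] adm by blast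
  define S where "S i = B i \<union> {(u x, u (sh i x)) | x. True}" for i
  define M where "M = generate_field R (K \<union> range u)"
  have gc: "K \<union> range u \<subseteq> carrier R" using uc K_carrier by blast
  have M: "subfield M R" unfolding M_def using gc by (rule generate_field_is_subfield)
  have Sc: "S i \<subseteq> carrier R \<times> carrier R" if "i < m" for i
    unfolding S_def using B_mem[OF that] K_carrier uc by auto
  have S_fnl: "fnl R (dcl R (S i))" if i: "i < m" for i
  proof -
    have G_mono: "dcl R (G u i s) \<subseteq> dcl R (G u i s')" if "s \<le> s'" for s s'
      using that by (intro dcl_mono) (force simp: G_def)
    \<comment> \<open>The closure is finitary: each of its elements involves finitely many
      generators.\<close>
    have "\<exists>s. z \<in> dcl R (G u i s)" if "z \<in> dcl R (S i)" for z
      using that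
    proof (induction rule: dcl.induct)
      case one
      then show ?case using dcl.one by blast
    next
      case (incl z)
      then have "\<exists>s. z \<in> G u i s" unfolding S_def G_def by blast
      then show ?case using dcl.incl by blast
    next
      case (a_inv x y)
      then obtain s where "(x, y) \<in> dcl R (G u i s)" by blast
      then show ?case by (intro exI[of _ s] dcl.a_inv)
    next
      case (m_inv x y)
      then obtain s where "(x, y) \<in> dcl R (G u i s)" by blast
      then show ?case using m_inv by (intro exI[of _ s] dcl.m_inv)
    next
      case (add x x' y y')
      then obtain s s' where "(x, x') \<in> dcl R (G u i s)" "(y, y') \<in> dcl R (G u i s')" by blast
      then have "(x, x') \<in> dcl R (G u i (max s s'))" "(y, y') \<in> dcl R (G u i (max s s'))"
        using subsetD[OF G_mono[of s "max s s'"]] subsetD[OF G_mono[of s' "max s s'"]] by simp_all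
      then show ?case by (intro exI[of _ "max s s'"] dcl.add)
    next
      case (mult x x' y y')
      then obtain s s' where "(x, x') \<in> dcl R (G u i s)" "(y, y') \<in> dcl R (G u i s')" by blast
      then have "(x, x') \<in> dcl R (G u i (max s s'))" "(y, y') \<in> dcl R (G u i (max s s'))"
        using subsetD[OF G_mono[of s "max s s'"]] subsetD[OF G_mono[of s' "max s s'"]] by simp_all
      then show ?case by (intro exI[of _ "max s s'"] dcl.mult)
    qed
    moreover have "fnl R (dcl R (G u i s))" for s
      \<comment> \<open>The bound \<open>s + sh i s\<close> is at least \<open>s\<close> and exceeds
        \<open>sh i x\<close> for every \<open>x < s\<close>.\<close>
      using G_fnl[of "s + sh i s" u i s] adm i sh_mono[OF i, of _ s] by (auto simp: trans_less_add2)
    ultimately show ?thesis unfolding fnl_def by blast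
  qed
  have S_fst: "fst ` dcl R (S i) = M" if "i < m" for i
  proof -
    have "fst ` S i = K \<union> range u" unfolding S_def image_Un B_fst[OF that] by force
    then show ?thesis using dcl_fst[OF Sc[OF that]] by (simp add: M_def)
  qed
  have S_M: "y \<in> M" if "i < m" "(x, y) \<in> dcl R (S i)" for i x y
  proof -
    have "fst ` S i \<subseteq> M" "snd ` S i \<subseteq> M"
      unfolding S_def M_def using B_mem[OF that(1)] by (fastforce intro: generate_field.incl)+
    then show ?thesis using dcl_snd_field[OF Sc[OF that(1)] M _ _ that(2)] by simp
  qed
  define D where "D i x = (THE y. (x, y) \<in> dcl R (S i))" for i x
  have D_eq: "D i x = y" if "i < m" "(x, y) \<in> dcl R (S i)" for i x y
    unfolding D_def using that fnl_unique[OF Sc S_fnl] by blast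
  have D_mem: "(x, D i x) \<in> dcl R (S i)" if "i < m" "x \<in> M" for i x
  proof -
    have "x \<in> fst ` dcl R (S i)" using S_fst that by simp
    then obtain y where "(x, y) \<in> dcl R (S i)" by force
    then show ?thesis using D_eq that by metis
  qed
  have der: "derivation R M (D i)" if i: "i < m" for i
    unfolding derivation_def
  proof (intro conjI ballI)
    show "D i x \<in> M" if "x \<in> M" for x using S_M D_mem i that by blast
    show "D i (x \<oplus> y) = D i x \<oplus> D i y" if "x \<in> M" "y \<in> M" for x y
      using that by (intro D_eq i dcl.add D_mem)
    show "D i (x \<otimes> y) = D i x \<otimes> y \<oplus> x \<otimes> D i y" if "x \<in> M" "y \<in> M" for x y
    proof -
      have "D i (x \<otimes> y) = x \<otimes> D i y \<oplus> D i x \<otimes> y" using that by (intro D_eq i dcl.mult D_mem)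
      moreover have "x \<in> carrier R" "y \<in> carrier R" "D i x \<in> carrier R" "D i y \<in> carrier R"
        using that S_M[OF i D_mem[OF i that(1)]] S_M[OF i D_mem[OF i that(2)]] subfieldE(3)[OF M] by blast+
      ultimately show ?thesis by (simp add: a_comm)
    qed
  qed
  have comm: "D i (D j x) = D j (D i x)" if i: "i < m" and j: "j < m" and x: "x \<in> M" for i j x
  proof -
    have "M \<subseteq> comm_set (dcl R (S i)) (dcl R (S j))"
      unfolding M_def
    proof (rule comm_set_generate_field[OF Sc[OF i] Sc[OF j]], rule Un_least)
      show "K \<subseteq> comm_set (dcl R (S i)) (dcl R (S j))"
        by (rule subset_trans[OF B_comm[OF i j] comm_set_mono]) (auto simp: S_def intro: dcl.incl)
      show "range u \<subseteq> comm_set (dcl R (S i)) (dcl R (S j))"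
      proof (rule image_subsetI)
        fix x
        have g: "(u x, u (sh k x)) \<in> dcl R (S k)" for k x by (auto intro!: dcl.incl simp: S_def)
        have "(u (sh j x), u (sh j (sh i x))) \<in> dcl R (S i)" using g[of "sh j x" i] sh_comm[OF i j, of x] by simp
        then show "u x \<in> comm_set (dcl R (S i)) (dcl R (S j))"
          unfolding comm_set_def using g[of x i] g[of x j] g[of "sh i x" j] by blast
      qed
    qed
    then obtain y z w where "(x, y) \<in> dcl R (S i)" "(x, z) \<in> dcl R (S j)" "(y, w) \<in> dcl R (S j)" "(z, w) \<in> dcl R (S i)"
      using x unfolding comm_set_def by blast
    then show ?thesis using D_eq[OF i] D_eq[OF j] by simp
  qed
  have "comm_derivations R M m D" unfolding comm_derivations_def using der comm by blast
  moreover have "\<forall>(x, y)\<in>B i. D i x = y" "\<forall>x. D i (u x) = u (sh i x)" if "i < m" for i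
  proof -
    have "S i \<subseteq> dcl R (S i)" by (rule subsetI, rule dcl.incl)
    then have "(x, y) \<in> dcl R (S i)" if "(x, y) \<in> S i" for x y using that by blast
    then show "\<forall>(x, y)\<in>B i. D i x = y" "\<forall>x. D i (u x) = u (sh i x)"
      using D_eq[OF that] by (auto simp: S_def)
  qed
  moreover have "\<forall>x<N1. u x = u0 x" using adm unfolding adm_def by blast
  ultimately show ?thesis using uc unfolding M_def by (intro exI[of _ u] exI[of _ D]) auto
qed

end

section \<open>Adjoining infinitely many transcendental elements\<close>

definition frac_eq :: "('a, 'b) ring_scheme \<Rightarrow> 'a \<times> 'a \<Rightarrow> 'a \<times> 'a \<Rightarrow> bool" where
  "frac_eq D p q \<longleftrightarrow> fst p \<otimes>\<^bsub>D\<^esub> snd q = fst q \<otimes>\<^bsub>D\<^esub> snd p"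

definition frac_pairs :: "('a, 'b) ring_scheme \<Rightarrow> ('a \<times> 'a) set" where
  "frac_pairs D = carrier D \<times> (carrier D - {\<zero>\<^bsub>D\<^esub>})"

definition frac_nf :: "('a, 'b) ring_scheme \<Rightarrow> 'a \<times> 'a \<Rightarrow> 'a \<times> 'a" where
  "frac_nf D p = (SOME q. q \<in> frac_pairs D \<and> frac_eq D p q)"

definition frac_mult :: "('a, 'b) ring_scheme \<Rightarrow> 'a \<times> 'a \<Rightarrow> 'a \<times> 'a \<Rightarrow> 'a \<times> 'a" where
  "frac_mult D p q = (fst p \<otimes>\<^bsub>D\<^esub> fst q, snd p \<otimes>\<^bsub>D\<^esub> snd q)"

definition frac_add :: "('a, 'b) ring_scheme \<Rightarrow> 'a \<times> 'a \<Rightarrow> 'a \<times> 'a \<Rightarrow> 'a \<times> 'a" where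
  "frac_add D p q = ((fst p \<otimes>\<^bsub>D\<^esub> snd q) \<oplus>\<^bsub>D\<^esub> (fst q \<otimes>\<^bsub>D\<^esub> snd p), snd p \<otimes>\<^bsub>D\<^esub> snd q)"

text \<open>The fraction field is carried by chosen representatives rather than by equivalence classes,
  so that its elements can be injected into the base type by coding pairs of polynomials.\<close>

definition frac_field :: "('a, 'b) ring_scheme \<Rightarrow> ('a \<times> 'a) ring" where
  "frac_field D = \<lparr>carrier = frac_nf D ` frac_pairs D,
     monoid.mult = (\<lambda>p q. frac_nf D (frac_mult D p q)),
     monoid.one = frac_nf D (\<one>\<^bsub>D\<^esub>, \<one>\<^bsub>D\<^esub>), ring.zero = frac_nf D (\<zero>\<^bsub>D\<^esub>, \<one>\<^bsub>D\<^esub>),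
     ring.add = (\<lambda>p q. frac_nf D (frac_add D p q))\<rparr>"

lemma frac_field_sel:
  "carrier (frac_field D) = frac_nf D ` frac_pairs D"
  "p \<otimes>\<^bsub>frac_field D\<^esub> q = frac_nf D (frac_mult D p q)"
  "\<one>\<^bsub>frac_field D\<^esub> = frac_nf D (\<one>\<^bsub>D\<^esub>, \<one>\<^bsub>D\<^esub>)"
  "\<zero>\<^bsub>frac_field D\<^esub> = frac_nf D (\<zero>\<^bsub>D\<^esub>, \<one>\<^bsub>D\<^esub>)"
  "p \<oplus>\<^bsub>frac_field D\<^esub> q = frac_nf D (frac_add D p q)"
  by (simp_all add: frac_field_def)

context domain begin

lemma frac_pairsD: "p \<in> frac_pairs R \<Longrightarrow> fst p \<in> carrier R \<and> snd p \<in> carrier R \<and> snd p \<noteq> \<zero>"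
  by (auto simp: frac_pairs_def)

lemma frac_closed:
  assumes "p \<in> frac_pairs R" "q \<in> frac_pairs R"
  shows "frac_mult R p q \<in> frac_pairs R" "frac_add R p q \<in> frac_pairs R"
  using frac_pairsD[OF assms(1)] frac_pairsD[OF assms(2)] integral
  by (auto simp: frac_pairs_def frac_mult_def frac_add_def)

lemma frac_eq_trans:
  assumes "p \<in> frac_pairs R" "q \<in> frac_pairs R" "r \<in> frac_pairs R" "frac_eq R p q" "frac_eq R q r"
  shows "frac_eq R p r"
proof -
  note c = frac_pairsD[OF assms(1)] frac_pairsD[OF assms(2)] frac_pairsD[OF assms(3)]
  have "snd q \<otimes> (fst p \<otimes> snd r) = (fst p \<otimes> snd q) \<otimes> snd r" using c by (simp add: m_ac)
  also have "\<dots> = (fst q \<otimes> snd r) \<otimes> snd p" using c assms(4) by (simp add: frac_eq_def m_ac)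
  also have "\<dots> = snd q \<otimes> (fst r \<otimes> snd p)" using c assms(5) by (simp add: frac_eq_def m_ac)
  finally show ?thesis unfolding frac_eq_def using c m_lcancel[of "snd q"] by simp
qed

lemma frac_nf:
  assumes "p \<in> frac_pairs R"
  shows "frac_nf R p \<in> frac_pairs R" "frac_eq R p (frac_nf R p)"
proof -
  have "frac_eq R p p" by (simp add: frac_eq_def)
  then have "frac_nf R p \<in> frac_pairs R \<and> frac_eq R p (frac_nf R p)"
    unfolding frac_nf_def
    using assms by (intro someI[where P = "\<lambda>q. q \<in> frac_pairs R \<and> frac_eq R p q" and x = p] conjI)
  then show "frac_nf R p \<in> frac_pairs R" "frac_eq R p (frac_nf R p)" by auto
qed

lemma frac_nf_eq_iff:
  assumes "p \<in> frac_pairs R" "q \<in> frac_pairs R"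
  shows "frac_nf R p = frac_nf R q \<longleftrightarrow> frac_eq R p q"
proof
  assume "frac_nf R p = frac_nf R q"
  then show "frac_eq R p q"
    using frac_eq_trans[OF assms(1) frac_nf(1)[OF assms(1)] assms(2) frac_nf(2)[OF assms(1)]]
      frac_nf(2)[OF assms(2)] by (simp add: frac_eq_def)
next
  assume e: "frac_eq R p q"
  then have "frac_eq R q p" by (simp add: frac_eq_def)
  \<comment> \<open>\<open>SOME\<close> depends only on the predicate, so equivalent fractions
    receive the same representative.\<close>
  then have "(\<lambda>r. r \<in> frac_pairs R \<and> frac_eq R p r) = (\<lambda>r. r \<in> frac_pairs R \<and> frac_eq R q r)"
    using e frac_eq_trans[OF assms(1,2)] frac_eq_trans[OF assms(2,1)] assms by blast
  then show "frac_nf R p = frac_nf R q" unfolding frac_nf_def by simp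
qed

lemma frac_nf_ops:
  assumes "p \<in> frac_pairs R" "q \<in> frac_pairs R"
  shows "frac_nf R (frac_mult R (frac_nf R p) q) = frac_nf R (frac_mult R p q)"
    "frac_nf R (frac_mult R q (frac_nf R p)) = frac_nf R (frac_mult R q p)"
    "frac_nf R (frac_add R (frac_nf R p) q) = frac_nf R (frac_add R p q)"
    "frac_nf R (frac_add R q (frac_nf R p)) = frac_nf R (frac_add R q p)"
proof -
  define p' where "p' = frac_nf R p"
  have p': "p' \<in> frac_pairs R" and e: "fst p \<otimes> snd p' = fst p' \<otimes> snd p"
    using frac_nf[OF assms(1)] unfolding p'_def frac_eq_def by auto
  note c = frac_pairsD[OF assms(1)] frac_pairsD[OF assms(2)] frac_pairsD[OF p']
  have mc: "frac_mult R p' q = frac_mult R q p'" "frac_mult R p q = frac_mult R q p"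
    "frac_add R p' q = frac_add R q p'" "frac_add R p q = frac_add R q p"
    using c by (simp_all add: frac_mult_def frac_add_def m_comm a_comm)
  have "(fst p' \<otimes> fst q) \<otimes> (snd p \<otimes> snd q) = (fst p' \<otimes> snd p) \<otimes> (fst q \<otimes> snd q)"
    using c by (simp add: m_ac)
  also have "\<dots> = (fst p \<otimes> fst q) \<otimes> (snd p' \<otimes> snd q)"
    unfolding e[symmetric] using c by (simp add: m_ac)
  finally have 1: "frac_nf R (frac_mult R p' q) = frac_nf R (frac_mult R p q)"
    using frac_nf_eq_iff[OF frac_closed(1)[OF p' assms(2)] frac_closed(1)[OF assms]]
    by (simp add: frac_eq_def frac_mult_def)
  have "(fst p' \<otimes> snd q \<oplus> fst q \<otimes> snd p') \<otimes> (snd p \<otimes> snd q)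
      = (fst p' \<otimes> snd p) \<otimes> (snd q \<otimes> snd q) \<oplus> fst q \<otimes> snd p' \<otimes> (snd p \<otimes> snd q)"
    using c by (simp add: l_distr r_distr m_ac)
  also have "\<dots> = (fst p \<otimes> snd q \<oplus> fst q \<otimes> snd p) \<otimes> (snd p' \<otimes> snd q)"
    unfolding e[symmetric] using c by (simp add: l_distr r_distr m_ac)
  finally have 2: "frac_nf R (frac_add R p' q) = frac_nf R (frac_add R p q)"
    using frac_nf_eq_iff[OF frac_closed(2)[OF p' assms(2)] frac_closed(2)[OF assms]]
    by (simp add: frac_eq_def frac_add_def)
  show "frac_nf R (frac_mult R (frac_nf R p) q) = frac_nf R (frac_mult R p q)"
    "frac_nf R (frac_mult R q (frac_nf R p)) = frac_nf R (frac_mult R q p)"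
    "frac_nf R (frac_add R (frac_nf R p) q) = frac_nf R (frac_add R p q)"
    "frac_nf R (frac_add R q (frac_nf R p)) = frac_nf R (frac_add R q p)"
    using 1 2 mc unfolding p'_def by simp_all
qed

lemma frac_const: "x \<in> carrier R \<Longrightarrow> (x, \<one>) \<in> frac_pairs R"
  by (simp add: frac_pairs_def)

lemma frac_field_is_field: "field (frac_field R)"
proof -
  note S = frac_field_sel frac_nf_ops frac_closed frac_nf(1)
  have add: "abelian_group (frac_field R)"
  proof (rule abelian_groupI)
    fix x y z assume "x \<in> carrier (frac_field R)" "y \<in> carrier (frac_field R)" "z \<in> carrier (frac_field R)"
    then obtain p q r where pqr: "p \<in> frac_pairs R" "q \<in> frac_pairs R" "r \<in> frac_pairs R"
      and x: "x = frac_nf R p" and y: "y = frac_nf R q" and z: "z = frac_nf R r"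
      by (auto simp: frac_field_sel)
    note c = frac_pairsD[OF pqr(1)] frac_pairsD[OF pqr(2)] frac_pairsD[OF pqr(3)]
    have "frac_add R (frac_add R p q) r = frac_add R p (frac_add R q r)"
      unfolding frac_add_def using c by (simp add: l_distr r_distr m_ac a_ac)
    then show "x \<oplus>\<^bsub>frac_field R\<^esub> y \<oplus>\<^bsub>frac_field R\<^esub> z = x \<oplus>\<^bsub>frac_field R\<^esub> (y \<oplus>\<^bsub>frac_field R\<^esub> z)"
      using pqr by (simp add: S x y z)
    have "frac_add R p q = frac_add R q p" unfolding frac_add_def using c by (simp add: m_comm a_comm)
    then show "x \<oplus>\<^bsub>frac_field R\<^esub> y = y \<oplus>\<^bsub>frac_field R\<^esub> x" using pqr by (simp add: S x y)
    show "x \<oplus>\<^bsub>frac_field R\<^esub> y \<in> carrier (frac_field R)" using pqr by (simp add: S x y)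
  next
    show "\<zero>\<^bsub>frac_field R\<^esub> \<in> carrier (frac_field R)" using frac_const[of \<zero>] by (simp add: S)
  next
    fix x assume "x \<in> carrier (frac_field R)"
    then obtain p where p: "p \<in> frac_pairs R" and x: "x = frac_nf R p" by (auto simp: frac_field_sel)
    note c = frac_pairsD[OF p]
    have "frac_add R (\<zero>, \<one>) p = p" unfolding frac_add_def using c by simp
    then show "\<zero>\<^bsub>frac_field R\<^esub> \<oplus>\<^bsub>frac_field R\<^esub> x = x"
      using p frac_const[of \<zero>] by (simp add: S x)
    define p' where "p' = (\<ominus> fst p, snd p)"
    have p': "p' \<in> frac_pairs R" unfolding p'_def using c by (auto simp: frac_pairs_def)
    have "fst p \<otimes> snd p \<oplus> \<ominus> fst p \<otimes> snd p = \<zero>" "\<ominus> fst p \<otimes> snd p \<oplus> fst p \<otimes> snd p = \<zero>"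
      using c by (simp_all add: l_minus r_neg l_neg)
    then have "frac_eq R (frac_add R p' p) (\<zero>, \<one>)"
      unfolding frac_eq_def frac_add_def p'_def using c by simp
    then have "frac_nf R (frac_add R p' p) = frac_nf R (\<zero>, \<one>)"
      using frac_nf_eq_iff[OF frac_closed(2)[OF p' p] frac_const[of \<zero>]] by simp
    then show "\<exists>y\<in>carrier (frac_field R). y \<oplus>\<^bsub>frac_field R\<^esub> x = \<zero>\<^bsub>frac_field R\<^esub>"
      using p p' by (intro bexI[of _ "frac_nf R p'"]) (simp_all add: S x)
  qed
  have mult: "comm_monoid (frac_field R)"
  proof (rule comm_monoidI)
    fix x y z assume "x \<in> carrier (frac_field R)" "y \<in> carrier (frac_field R)" "z \<in> carrier (frac_field R)"
    then obtain p q r where pqr: "p \<in> frac_pairs R" "q \<in> frac_pairs R" "r \<in> frac_pairs R"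
      and x: "x = frac_nf R p" and y: "y = frac_nf R q" and z: "z = frac_nf R r"
      by (auto simp: frac_field_sel)
    note c = frac_pairsD[OF pqr(1)] frac_pairsD[OF pqr(2)] frac_pairsD[OF pqr(3)]
    have "frac_mult R (frac_mult R p q) r = frac_mult R p (frac_mult R q r)"
      unfolding frac_mult_def using c by (simp add: m_ac)
    then show "x \<otimes>\<^bsub>frac_field R\<^esub> y \<otimes>\<^bsub>frac_field R\<^esub> z = x \<otimes>\<^bsub>frac_field R\<^esub> (y \<otimes>\<^bsub>frac_field R\<^esub> z)"
      using pqr by (simp add: S x y z)
    have "frac_mult R p q = frac_mult R q p" unfolding frac_mult_def using c by (simp add: m_comm)
    then show "x \<otimes>\<^bsub>frac_field R\<^esub> y = y \<otimes>\<^bsub>frac_field R\<^esub> x" using pqr by (simp add: S x y)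
    show "x \<otimes>\<^bsub>frac_field R\<^esub> y \<in> carrier (frac_field R)" using pqr by (simp add: S x y)
  next
    show "\<one>\<^bsub>frac_field R\<^esub> \<in> carrier (frac_field R)" using frac_const[of \<one>] by (simp add: S)
  next
    fix x assume "x \<in> carrier (frac_field R)"
    then obtain p where p: "p \<in> frac_pairs R" and x: "x = frac_nf R p" by (auto simp: frac_field_sel)
    have "frac_mult R (\<one>, \<one>) p = p" unfolding frac_mult_def using frac_pairsD[OF p] by simp
    then show "\<one>\<^bsub>frac_field R\<^esub> \<otimes>\<^bsub>frac_field R\<^esub> x = x"
      using p frac_const[of \<one>] by (simp add: S x)
  qed
  have "cring (frac_field R)"
  proof (rule cringI[OF add mult])
    fix x y z assume "x \<in> carrier (frac_field R)" "y \<in> carrier (frac_field R)" "z \<in> carrier (frac_field R)"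
    then obtain p q r where pqr: "p \<in> frac_pairs R" "q \<in> frac_pairs R" "r \<in> frac_pairs R"
      and x: "x = frac_nf R p" and y: "y = frac_nf R q" and z: "z = frac_nf R r"
      by (auto simp: frac_field_sel)
    note c = frac_pairsD[OF pqr(1)] frac_pairsD[OF pqr(2)] frac_pairsD[OF pqr(3)]
    \<comment> \<open>Unlike associativity, distributivity fails for raw fractions: the denominator
      on the right has the additional factor \<open>snd r\<close>.\<close>
    have "frac_eq R (frac_mult R (frac_add R p q) r) (frac_add R (frac_mult R p r) (frac_mult R q r))"
      unfolding frac_eq_def frac_mult_def frac_add_def using c by (simp add: l_distr r_distr m_ac)
    then show "(x \<oplus>\<^bsub>frac_field R\<^esub> y) \<otimes>\<^bsub>frac_field R\<^esub> z =
        x \<otimes>\<^bsub>frac_field R\<^esub> z \<oplus>\<^bsub>frac_field R\<^esub> y \<otimes>\<^bsub>frac_field R\<^esub> z"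
      using pqr by (simp add: S x y z frac_nf_eq_iff)
  qed
  then show ?thesis
  proof (rule cring.cring_fieldI2)
    show "\<zero>\<^bsub>frac_field R\<^esub> \<noteq> \<one>\<^bsub>frac_field R\<^esub>"
      using frac_nf_eq_iff[OF frac_const[of \<zero>] frac_const[of \<one>]] by (simp add: S frac_eq_def)
  next
    fix x assume "x \<in> carrier (frac_field R)" and nz: "x \<noteq> \<zero>\<^bsub>frac_field R\<^esub>"
    then obtain p where p: "p \<in> frac_pairs R" and x: "x = frac_nf R p" by (auto simp: frac_field_sel)
    note c = frac_pairsD[OF p]
    have "fst p \<noteq> \<zero>"
      using nz frac_nf_eq_iff[OF p frac_const[of \<zero>]] c by (auto simp: S x frac_eq_def)
    then have q: "(snd p, fst p) \<in> frac_pairs R" using c by (auto simp: frac_pairs_def)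
    have "frac_eq R (frac_mult R p (snd p, fst p)) (\<one>, \<one>)"
      unfolding frac_eq_def frac_mult_def using c by (simp add: m_comm)
    then have "frac_nf R (frac_mult R p (snd p, fst p)) = frac_nf R (\<one>, \<one>)"
      using frac_nf_eq_iff[OF frac_closed(1)[OF p q] frac_const[of \<one>]] by simp
    then show "\<exists>y\<in>carrier (frac_field R). x \<otimes>\<^bsub>frac_field R\<^esub> y = \<one>\<^bsub>frac_field R\<^esub>"
      using p q by (intro bexI[of _ "frac_nf R (snd p, fst p)"]) (simp_all add: S x)
  qed
qed

lemma frac_embed_hom: "(\<lambda>x. frac_nf R (x, \<one>)) \<in> ring_hom R (frac_field R)"
proof (rule ring_hom_memI)
  fix x y assume "x \<in> carrier R" "y \<in> carrier R"
  moreover have "frac_mult R (x, \<one>) (y, \<one>) = (x \<otimes> y, \<one>)" "frac_add R (x, \<one>) (y, \<one>) = (x \<oplus> y, \<one>)"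
    using calculation by (simp_all add: frac_mult_def frac_add_def)
  ultimately show "frac_nf R (x \<otimes> y, \<one>) = frac_nf R (x, \<one>) \<otimes>\<^bsub>frac_field R\<^esub> frac_nf R (y, \<one>)"
    "frac_nf R (x \<oplus> y, \<one>) = frac_nf R (x, \<one>) \<oplus>\<^bsub>frac_field R\<^esub> frac_nf R (y, \<one>)"
    by (simp_all add: frac_field_sel frac_nf_ops frac_const frac_nf(1))
qed (auto simp: frac_field_sel frac_const)

lemma frac_embed_inj: "inj_on (\<lambda>x. frac_nf R (x, \<one>)) (carrier R)"
  by (rule inj_onI) (simp add: frac_nf_eq_iff frac_const frac_eq_def)

end

lemma (in ring) normalize_eq_Nil: "normalize p = [] \<Longrightarrow> set p \<subseteq> {\<zero>}"
  by (induction p) (auto split: if_splits)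

text \<open>In the field of rational functions \<open>t\<close> is X, because evaluating a
  polynomial at X returns that polynomial.\<close>

lemma (in field) transcendental_extension:
  "\<exists>(P :: ('a list \<times> 'a list) ring) e t. field P \<and> e \<in> ring_hom R P \<and> inj_on e (carrier R) \<and>
    t \<in> carrier P \<and> transc P (e ` carrier R) t"
proof -
  define D where "D = univ_poly R (carrier R)"
  have sr: "subring (carrier R) R" by (rule carrier_is_subring)
  interpret D: domain D unfolding D_def using univ_poly_is_domain[OF sr] .
  interpret P: field "frac_field D" by (rule D.frac_field_is_field)
  define f where "f x = frac_nf D (x, \<one>\<^bsub>D\<^esub>)" for x
  define e where "e = f \<circ> poly_of_const"
  have f: "f \<in> ring_hom D (frac_field D)" "inj_on f (carrier D)"
    using D.frac_embed_hom D.frac_embed_inj unfolding f_def[abs_def] by auto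
  have c: "poly_of_const \<in> ring_hom R D"
    using canonical_embedding_is_hom[OF sr] unfolding D_def by simp
  have e: "e \<in> ring_hom R (frac_field D)" unfolding e_def by (rule ring_hom_trans[OF c f(1)])
  have "inj_on poly_of_const (carrier R)"
    by (rule inj_onI) (simp add: poly_of_const_def split: if_splits)
  then have e_inj: "inj_on e (carrier R)"
    unfolding e_def using f(2) ring_hom_closed[OF c] by (intro comp_inj_on) (auto intro: inj_on_subset)
  interpret f: ring_hom_ring D "frac_field D" f
    using f by (intro ring_hom_ringI2 D.ring_axioms P.ring_axioms)
  have X: "X \<in> carrier D" unfolding D_def using var_closed(1)[OF sr] .
  have "transc (frac_field D) (e ` carrier R) (f X)"
    unfolding transc_def
  proof (intro allI impI)
    fix q assume q: "set q \<subseteq> e ` carrier R" and z: "P.eval q (f X) = \<zero>\<^bsub>frac_field D\<^esub>"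
    define p where "p = map (inv_into (carrier R) e) q"
    have "map e p = q" unfolding p_def map_map using q by (intro map_idI) (auto simp: f_inv_into_f)
    moreover have "set p \<subseteq> carrier R" unfolding p_def using q inv_into_into[of _ e "carrier R"] by auto
    ultimately have p: "set p \<subseteq> carrier R" "q = map e p" by auto
    have pc: "set (map poly_of_const p) \<subseteq> carrier D" using p ring_hom_closed[OF c] by auto
    have "f (D.eval (map poly_of_const p) X) = P.eval (map f (map poly_of_const p)) (f X)"
      using f.eval_hom'[OF X pc] .
    also have "\<dots> = f \<zero>\<^bsub>D\<^esub>" using z p by (simp add: e_def)
    finally have ev: "D.eval (map poly_of_const p) X = \<zero>\<^bsub>D\<^esub>"
      using f(2) D.eval_in_carrier[OF pc X] D.zero_closed by (simp add: inj_on_def)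
    \<comment> \<open>\<open>transc\<close> allows lists with leading zeros, whereas
      \<open>eval_rewrite\<close> speaks of proper polynomials; the zeros are split off
      first.\<close>
    obtain n where n: "p = replicate n \<zero> @ normalize p" using normalize_def' by metis
    have np: "normalize p \<in> carrier D"
      using normalize_gives_polynomial[OF p(1)] by (simp add: D_def univ_poly_carrier)
    have z0: "poly_of_const \<zero> = \<zero>\<^bsub>D\<^esub>" by (simp add: poly_of_const_def D_def univ_poly_zero)
    have pc': "set (map poly_of_const (normalize p)) \<subseteq> carrier D"
      using normalize_in_carrier[OF p(1)] ring_hom_closed[OF c] by auto
    have "D.eval (map poly_of_const p) X = D.eval (replicate n \<zero>\<^bsub>D\<^esub> @ map poly_of_const (normalize p)) X"
      by (subst n) (simp add: z0)
    also have "\<dots> = D.eval (map poly_of_const (normalize p)) X" by (rule D.eval_replicate[OF pc' X])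
    also have "\<dots> = normalize p" using eval_rewrite[OF sr] np unfolding D_def by metis
    finally have "normalize p = []" using ev by (simp add: D_def univ_poly_zero)
    then have "set p \<subseteq> {\<zero>}" by (rule normalize_eq_Nil)
    then have "set q \<subseteq> e ` {\<zero>}" unfolding p(2) by auto
    then show "set q \<subseteq> {\<zero>\<^bsub>frac_field D\<^esub>}"
      using ring_hom_zero[OF e ring_axioms P.ring_axioms] by simp
  qed
  moreover have "f X \<in> carrier (frac_field D)" using f.hom_closed[OF X] .
  ultimately show ?thesis using e e_inj P.field_axioms by blast
qed

text \<open>Rational functions over a field carried by \<open>'a \<times> nat\<close> are pairs of
  lists over that type. This code brings them back into the type, so that the tower never leaves
  it.\<close>

lemma infinite_times_nat_code:
  "\<exists>c :: ('a \<times> nat) list \<times> ('a \<times> nat) list \<Rightarrow> 'a \<times> nat. inj c"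
proof -
  have "infinite (UNIV :: ('a \<times> nat) set)"
    by (simp add: UNIV_Times_UNIV[symmetric] finite_cartesian_product_iff del: UNIV_Times_UNIV)
  then have "|(UNIV :: ('a \<times> nat) set) \<times> (UNIV :: ('a \<times> nat) set)| =o |UNIV :: ('a \<times> nat) set|"
    by (rule card_of_Times_same_infinite)
  then obtain g :: "('a \<times> nat) \<times> ('a \<times> nat) \<Rightarrow> 'a \<times> nat" where "inj g"
    unfolding card_of_ordIso[symmetric] bij_betw_def by auto
  then have g: "g p = g q \<longleftrightarrow> p = q" for p q by (auto dest: injD)
  define z :: "'a \<times> nat" where "z = (undefined, 0)"
  \<comment> \<open>\<open>c1\<close> is injective only among lists of equal length, so
    \<open>c2\<close> stores the length as well.\<close>
  define c1 where "c1 xs = foldr (\<lambda>x y. g (x, y)) xs z" for xs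
  define c2 where "c2 xs = g ((undefined, length xs), c1 xs)" for xs
  have "length xs = length ys \<Longrightarrow> c1 xs = c1 ys \<Longrightarrow> xs = ys" for xs ys
    by (induction xs ys rule: list_induct2) (auto simp: c1_def g)
  then have "c2 xs = c2 ys \<Longrightarrow> xs = ys" for xs ys by (simp add: c2_def g)
  then have "inj (\<lambda>(xs, ys). g (c2 xs, c2 ys))" by (auto intro!: injI simp: g)
  then show ?thesis by blast
qed

text \<open>The step from one layer to the next adds a copy of the whole type, which leaves room for
  infinitely many extensions.\<close>

definition layer :: "nat \<Rightarrow> ('a \<times> nat) set" where
  "layer s = {(x, k) | x k. fst (prod_decode k) \<le> s}"

lemma transc_iso:
  assumes P: "ring P" and h: "h \<in> ring_hom P Q" "inj_on h (carrier P)" and Q: "ring Q"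
    and F: "F \<subseteq> carrier P" and t: "t \<in> carrier P" "transc P F t"
  shows "transc Q (h ` F) (h t)"
  unfolding transc_def
proof (intro allI impI)
  interpret h: ring_hom_ring P Q h using ring_hom_ringI2[OF P Q h(1)] .
  fix q assume q: "set q \<subseteq> h ` F" and z: "h.S.eval q (h t) = \<zero>\<^bsub>Q\<^esub>"
  define p where "p = map (inv_into F h) q"
  have "map h p = q" unfolding p_def map_map using q by (intro map_idI) (auto simp: f_inv_into_f)
  moreover have pF: "set p \<subseteq> F" unfolding p_def using q inv_into_into[of _ h F] by auto
  ultimately have "h (h.R.eval p t) = h \<zero>\<^bsub>P\<^esub>"
    using h.eval_hom'[OF t(1), of p] F z by auto
  then have "h.R.eval p t = \<zero>\<^bsub>P\<^esub>"
    using h(2) h.R.eval_in_carrier[of p t] pF F t(1) h.R.zero_closed unfolding inj_on_def by blast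
  then have "set p \<subseteq> {\<zero>\<^bsub>P\<^esub>}" using t(2) pF unfolding transc_def by blast
  then have "h ` set p \<subseteq> h ` {\<zero>\<^bsub>P\<^esub>}" by (rule image_mono)
  moreover have "set q = h ` set p" using \<open>map h p = q\<close> by auto
  ultimately show "set q \<subseteq> {\<zero>\<^bsub>Q\<^esub>}" by simp
qed

lemma layer_extension:
  fixes F :: "('a \<times> nat) ring"
  assumes F: "field F" "carrier F \<subseteq> layer s"
  shows "\<exists>(Q :: ('a \<times> nat) ring) t. field Q \<and> carrier Q \<subseteq> layer (Suc s) \<and> id \<in> ring_hom F Q \<and>
    t \<in> carrier Q \<and> transc Q (carrier F) t"
proof -
  interpret F: field F by (rule F(1))
  obtain P :: "(('a \<times> nat) list \<times> ('a \<times> nat) list) ring" and e t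
    where P: "field P" and e: "e \<in> ring_hom F P" "inj_on e (carrier F)"
      and t: "t \<in> carrier P" "transc P (e ` carrier F) t"
    using F.transcendental_extension by blast
  interpret P: field P by (rule P)
  obtain c :: "('a \<times> nat) list \<times> ('a \<times> nat) list \<Rightarrow> 'a \<times> nat" where c: "inj c"
    using infinite_times_nat_code by blast
  define j where "j p = (fst (c p), prod_encode (Suc s, snd (c p)))" for p
  have j_inj: "j p = j q \<Longrightarrow> p = q" for p q
    by (rule injD[OF c]) (simp add: j_def prod_eq_iff)
  have j_layer: "j p \<in> layer (Suc s)" "j p \<notin> layer s" for p
    by (auto simp: j_def layer_def)
  have layer_le: "layer s \<subseteq> layer (Suc s)" by (auto simp: layer_def)
  \<comment> \<open>Elements coming from \<open>F\<close> are sent back to themselves, so that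
    \<open>F\<close> becomes a subset of \<open>Q\<close> with the same operations. All others go
    into the fresh part of the next layer.\<close>
  define h where "h p = (if p \<in> e ` carrier F then inv_into (carrier F) e p else j p)" for p
  have he: "h (e x) = x" if "x \<in> carrier F" for x
    unfolding h_def using that e(2) by (simp add: inv_into_f_f)
  have h_in: "h p \<in> carrier F" if "p \<in> e ` carrier F" for p using that he by auto
  have h_out: "h p = j p" if "p \<notin> e ` carrier F" for p using that by (simp add: h_def)
  have h_inj: "inj_on h (carrier P)"
  proof (rule inj_onI)
    fix p q assume eq: "h p = h q"
    show "p = q"
    proof (cases "p \<in> e ` carrier F")
      case True
      then have "q \<in> e ` carrier F" using eq h_in F(2) h_out j_layer by (metis subsetD)
      then show ?thesis using True eq he by auto
    next
      case False
      then have "q \<notin> e ` carrier F" using eq h_in F(2) h_out j_layer by (metis subsetD)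
      then show ?thesis using False eq h_out j_inj by metis
    qed
  qed
  define Q where "Q = image_ring h P"
  have Q: "field Q" unfolding Q_def by (rule P.inj_imp_image_ring_is_field[OF h_inj])
  interpret Q: field Q by (rule Q)
  have hom: "h \<in> ring_hom P Q" using inj_imp_image_ring_iso[OF h_inj] unfolding Q_def ring_iso_def by blast
  have Qc: "carrier Q = h ` carrier P" by (simp add: Q_def image_ring_carrier)
  have "h p \<in> layer (Suc s)" for p
    using h_in[of p] h_out[of p] F(2) layer_le j_layer(1)[of p] by (cases "p \<in> e ` carrier F") auto
  then have "carrier Q \<subseteq> layer (Suc s)" unfolding Qc by blast
  moreover have "id \<in> ring_hom F Q"
  proof -
    have "h \<circ> e \<in> ring_hom F Q" by (rule ring_hom_trans[OF e(1) hom])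
    moreover have "(h \<circ> e) x = id x" if "x \<in> carrier F" for x using he that by simp
    ultimately show ?thesis using F.ring_hom_restrict by blast
  qed
  moreover have "h t \<in> carrier Q" using t(1) unfolding Qc by blast
  moreover have "transc Q (carrier F) (h t)"
  proof -
    have "h ` (e ` carrier F) = carrier F" using he by force
    moreover have "e ` carrier F \<subseteq> carrier P" using ring_hom_closed[OF e(1)] by blast
    from transc_iso[OF P.ring_axioms hom h_inj Q.ring_axioms this t]
    have "transc Q (h ` (e ` carrier F)) (h t)" .
    ultimately show ?thesis by simp
  qed
  ultimately show ?thesis using Q by blast
qed

text \<open>The fields are included in each other by the identity, so their union is a field, and
  transcendence over one of them persists in the union.\<close>

lemma transcendental_tower:
  fixes L :: "'a ring"
  assumes L: "field L"
  shows "\<exists>(W :: ('a \<times> nat) ring) \<iota> A t. field W \<and> \<iota> \<in> ring_hom L W \<and> inj_on \<iota> (carrier L) \<and>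
    \<iota> ` carrier L \<subseteq> A 0 \<and>
    (\<forall>s. subfield (A s) W \<and> A s \<subseteq> A (Suc s) \<and> t s \<in> A (Suc s) \<and> transc W (A s) (t s))"
proof -
  interpret L: field L by (rule L)
  define \<iota> :: "'a \<Rightarrow> 'a \<times> nat" where "\<iota> x = (x, prod_encode (0, 0))" for x
  have \<iota>_inj: "inj_on \<iota> (carrier L)" by (auto simp: \<iota>_def inj_on_def)
  \<comment> \<open>A state consists of a field and the element adjoined last. At stage 0 that
    element is arbitrary, whence the shift by one in the definition of \<open>t\<close>
    below.\<close>
  define P :: "nat \<Rightarrow> ('a \<times> nat) ring \<times> ('a \<times> nat) \<Rightarrow> bool" where
    "P s = (\<lambda>(F, t). field F \<and> carrier F \<subseteq> layer s \<and> (s = 0 \<longrightarrow> F = image_ring \<iota> L))" for s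
  define E :: "nat \<Rightarrow> ('a \<times> nat) ring \<times> ('a \<times> nat) \<Rightarrow> ('a \<times> nat) ring \<times> ('a \<times> nat) \<Rightarrow> bool" where
    "E s = (\<lambda>(F, _) (Q, t). id \<in> ring_hom F Q \<and> t \<in> carrier Q \<and> transc Q (carrier F) t)" for s
  have "\<exists>f. \<forall>s. P s (f s) \<and> E s (f s) (f (Suc s))"
  proof (rule dependent_nat_choice)
    have "P 0 (image_ring \<iota> L, t)" for t
      unfolding P_def using L.inj_imp_image_ring_is_field[OF \<iota>_inj]
      by (auto simp: image_ring_carrier layer_def \<iota>_def)
    then show "\<exists>x. P 0 x" by blast
  next
    fix x s assume "P s x"
    then have "field (fst x)" "carrier (fst x) \<subseteq> layer s" unfolding P_def by auto
    from layer_extension[OF this] obtain Q :: "('a \<times> nat) ring" and t where "field Q \<and> carrier Q \<subseteq> layer (Suc s) \<and> id \<in> ring_hom (fst x) Q \<and>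
        t \<in> carrier Q \<and> transc Q (carrier (fst x)) t"
      by blast
    then have "P (Suc s) (Q, t)" "E s x (Q, t)"
      by (simp_all add: P_def E_def split_def)
    then show "\<exists>y. P (Suc s) y \<and> E s x y" by blast
  qed
  then obtain f where f: "\<And>s. P s (f s)" "\<And>s. E s (f s) (f (Suc s))" by blast
  define F where "F s = fst (f s)" for s
  define t where "t s = snd (f (Suc s))" for s
  have F: "field (F s)" for s using f(1)[of s] unfolding P_def F_def by auto
  have F0: "F 0 = image_ring \<iota> L" using f(1)[of 0] unfolding P_def F_def by auto
  have step: "id \<in> ring_hom (F s) (F (Suc s))" "t s \<in> carrier (F (Suc s))" "transc (F (Suc s)) (carrier (F s)) (t s)" for s
    using f(2)[of s] unfolding E_def F_def t_def by auto
  have incl: "iso_incl (F s) (F s')" if "s \<le> s'" for s s'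
    using that
  proof (induction s' rule: dec_induct)
    case base
    show ?case by (rule iso_incl_refl)
  next
    case (step k)
    then show ?case using iso_incl_trans iso_inclI[OF \<open>id \<in> ring_hom (F k) (F (Suc k))\<close>] by blast
  qed
  define W where "W = union_ring (range F)"
  have chain: "iso_incl R S \<or> iso_incl S R" if "R \<in> range F" "S \<in> range F" for R S
    using that incl nat_le_linear by blast
  have field_chain: "field R" if "R \<in> range F" for R using that F by blast
  have W: "field W" unfolding W_def using union_ring_is_field[OF field_chain chain] by blast
  interpret W: field W by (rule W)
  have FW: "iso_incl (F s) W" for s
  proof -
    have "id \<in> ring_hom (F s) W"
      unfolding W_def
      using same_laws[OF field_chain chain, where R = "F s"] same_one_same_zero[OF field_chain chain, where R = "F s"]
      by (intro ring_hom_memI) (auto simp: union_ring_carrier)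
    then show ?thesis by (rule iso_inclI)
  qed
  have FW': "id \<in> ring_hom (F s) W" for s using iso_incl_backwards[OF FW] .
  have sub: "subfield (carrier (F s)) W" for s
  proof -
    interpret Fs: field "F s" by (rule F)
    interpret h: ring_hom_ring "F s" W id using ring_hom_ringI2[OF Fs.ring_axioms W.ring_axioms FW'] .
    have "subfield (id ` carrier (F s)) W"
      using h.img_is_subfield[OF Fs.carrier_is_subfield] W.one_not_zero by simp
    then show ?thesis by simp
  qed
  have "carrier (F s) \<subseteq> carrier (F (Suc s))" for s
    using ring_hom_closed[OF step(1)[of s]] by auto
  moreover have "transc W (carrier (F s)) (t s)" for s
    using transc_iso[OF field.is_ring[OF F] FW' _ W.ring_axioms _ step(2,3)[of s]] calculation[of s]
    by simp
  moreover have "\<iota> \<in> ring_hom L W"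
  proof -
    have "\<iota> \<in> ring_hom L (F 0)"
      using inj_imp_image_ring_iso[OF \<iota>_inj] unfolding F0 ring_iso_def by blast
    from ring_hom_trans[OF this FW'] show ?thesis by simp
  qed
  moreover have "\<iota> ` carrier L \<subseteq> carrier (F 0)" unfolding F0 by (simp add: image_ring_carrier)
  ultimately show ?thesis
    using W \<iota>_inj sub step(2)
    by (intro exI[of _ W] exI[of _ \<iota>] exI[of _ "\<lambda>s. carrier (F s)"] exI[of _ t]) auto
qed

section \<open>Polynomial relations and derivations\<close>

lemma (in comm_monoid) finprod_superset:
  assumes "finite B" "A \<subseteq> B" "\<And>x. x \<in> B - A \<Longrightarrow> f x = \<one>" "\<And>x. x \<in> B \<Longrightarrow> f x \<in> carrier G"
  shows "finprod G f A = finprod G f B"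
  using assms by (intro finprod_mono_neutral_cong_left) auto

lemma (in abelian_monoid) finsum_superset:
  assumes "finite B" "A \<subseteq> B" "\<And>x. x \<in> B - A \<Longrightarrow> f x = \<zero>" "\<And>x. x \<in> B \<Longrightarrow> f x \<in> carrier G"
  shows "finsum G f A = finsum G f B"
  using assms by (intro add.finprod_mono_neutral_cong_left) auto

lemma (in abelian_monoid) finsum_swap:
  assumes "finite A" "finite B" "\<And>x y. x \<in> A \<Longrightarrow> y \<in> B \<Longrightarrow> g x y \<in> carrier G"
  shows "finsum G (\<lambda>x. finsum G (\<lambda>y. g x y) B) A = finsum G (\<lambda>y. finsum G (\<lambda>x. g x y) A) B"
  using assms(1,3)
proof (induction A rule: finite_induct)
  case empty
  then show ?case by (simp add: finsum_zero)
next
  case (insert x A)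
  have c: "(\<lambda>y. g x y) \<in> B \<rightarrow> carrier G" "(\<lambda>y. finsum G (\<lambda>x. g x y) A) \<in> B \<rightarrow> carrier G"
    using insert.prems by (auto intro!: finsum_closed)
  have "finsum G (\<lambda>x. finsum G (\<lambda>y. g x y) B) (insert x A) =
      finsum G (\<lambda>y. g x y) B \<oplus> finsum G (\<lambda>x. finsum G (\<lambda>y. g x y) B) A"
    using insert.hyps insert.prems by (intro finsum_insert) (auto intro!: finsum_closed)
  also have "\<dots> = finsum G (\<lambda>y. g x y \<oplus> finsum G (\<lambda>x. g x y) A) B"
    using insert by (simp add: finsum_addf[OF c])
  also have "\<dots> = finsum G (\<lambda>y. finsum G (\<lambda>x. g x y) (insert x A)) B"
    using insert.hyps insert.prems c by (intro finsum_cong') (auto intro!: finsum_insert[symmetric] finsum_closed)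
  finally show ?case .
qed

context cring begin

lemma mono_eval_superset:
  assumes "finite A" "set_mset \<mu> \<subseteq> A" "\<And>v. v \<in> A \<Longrightarrow> b v \<in> carrier R"
  shows "mono_eval R b \<mu> = finprod R (\<lambda>v. b v [^] count \<mu> v) A"
  unfolding mono_eval_def using assms
  by (intro finprod_superset) (auto simp: not_in_iff)

lemma mono_eval_empty: "mono_eval R b {#} = \<one>"
  by (simp add: mono_eval_def)

lemma mono_eval_closed: "(\<And>v. v \<in># \<mu> \<Longrightarrow> b v \<in> carrier R) \<Longrightarrow> mono_eval R b \<mu> \<in> carrier R"
  unfolding mono_eval_def by (intro finprod_closed) auto

lemma mono_eval_add_mset:
  assumes "b v \<in> carrier R" "\<And>v. v \<in># \<mu> \<Longrightarrow> b v \<in> carrier R"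
  shows "mono_eval R b (add_mset v \<mu>) = b v \<otimes> mono_eval R b \<mu>"
proof -
  define A where "A = set_mset \<mu> - {v}"
  have A: "finite A" "v \<notin> A" "insert v A = insert v (set_mset \<mu>)" unfolding A_def by auto
  have bA: "b x \<in> carrier R" if "x \<in> insert v A" for x using that assms A(3) by auto
  define rest where "rest = finprod R (\<lambda>x. b x [^] count \<mu> x) A"
  have rc: "rest \<in> carrier R" unfolding rest_def using bA by (intro finprod_closed) auto
  have "mono_eval R b (add_mset v \<mu>) = finprod R (\<lambda>x. b x [^] count (add_mset v \<mu>) x) (insert v A)"
    using A bA by (intro mono_eval_superset) auto
  also have "\<dots> = b v [^] count (add_mset v \<mu>) v \<otimes> finprod R (\<lambda>x. b x [^] count (add_mset v \<mu>) x) A"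
    using A bA by (intro finprod_insert) auto
  also have "finprod R (\<lambda>x. b x [^] count (add_mset v \<mu>) x) A = rest"
    unfolding rest_def using A bA by (intro finprod_cong') auto
  also have "b v [^] count (add_mset v \<mu>) v \<otimes> rest = b v \<otimes> (b v [^] count \<mu> v \<otimes> rest)"
    using assms(1) rc by (simp add: m_ac)
  also have "b v [^] count \<mu> v \<otimes> rest = finprod R (\<lambda>x. b x [^] count \<mu> x) (insert v A)"
    unfolding rest_def using A bA by (intro finprod_insert[symmetric]) auto
  also have "\<dots> = mono_eval R b \<mu>"
    using A bA by (intro mono_eval_superset[symmetric]) auto
  finally show ?thesis .
qed

lemma mono_eval_union:
  assumes "\<And>v. v \<in># \<mu> + \<nu> \<Longrightarrow> b v \<in> carrier R"
  shows "mono_eval R b (\<mu> + \<nu>) = mono_eval R b \<mu> \<otimes> mono_eval R b \<nu>"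
  using assms
proof (induction \<mu>)
  case empty
  then show ?case by (simp add: mono_eval_empty mono_eval_closed)
next
  case (add v \<mu>)
  then have c: "mono_eval R b \<mu> \<in> carrier R" "mono_eval R b \<nu> \<in> carrier R" "b v \<in> carrier R"
    by (auto intro!: mono_eval_closed)
  have "mono_eval R b (add_mset v (\<mu> + \<nu>)) = b v \<otimes> mono_eval R b (\<mu> + \<nu>)"
    "mono_eval R b (add_mset v \<mu>) = b v \<otimes> mono_eval R b \<mu>"
    using add.prems by (auto intro!: mono_eval_add_mset)
  then show ?case using add c by (simp add: m_assoc)
qed

lemma finsum_dual:
  assumes "finite A" "\<And>x. x \<in> A \<Longrightarrow> g x \<in> carrier R \<times> carrier R"
  shows "finsum (dual R) g A = (finsum R (\<lambda>x. fst (g x)) A, finsum R (\<lambda>x. snd (g x)) A)"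
  using assms
proof (induction A rule: finite_induct)
  case empty
  interpret D: cring "dual R" by (rule dual_cring)
  show ?case by simp
next
  case (insert x A)
  interpret D: cring "dual R" by (rule dual_cring)
  have "(\<lambda>x. fst (g x)) \<in> insert x A \<rightarrow> carrier R" "(\<lambda>x. snd (g x)) \<in> insert x A \<rightarrow> carrier R"
    using insert.prems by (auto simp: mem_Times_iff)
  moreover have "g \<in> insert x A \<rightarrow> carrier (dual R)" using insert.prems by simp
  ultimately show ?case using insert by (simp add: finsum_insert D.finsum_insert)
qed

text \<open>The Leibniz rule for monomials. Summing over a fixed \<open>V\<close> instead of the
  variables of \<mu> lets the contributions of different monomials be added up; variables outside
  \<mu> have count zero.\<close>

lemma mono_eval_dual:
  assumes "finite V" "set_mset \<mu> \<subseteq> V" "\<And>v. v \<in> V \<Longrightarrow> a v \<in> carrier R" "\<And>v. v \<in> V \<Longrightarrow> w v \<in> carrier R"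
  shows "mono_eval (dual R) (\<lambda>v. (a v, w v)) \<mu> =
    (mono_eval R a \<mu>, finsum R (\<lambda>v. add_pow R (count \<mu> v) (mono_eval R a (\<mu> - {#v#})) \<otimes> w v) V)"
  using assms(2)
proof (induction \<mu>)
  case empty
  interpret D: cring "dual R" by (rule dual_cring)
  have "finsum R (\<lambda>v. add_pow R (count {#} v) (mono_eval R a ({#} - {#v#})) \<otimes> w v) V = finsum R (\<lambda>v. \<zero>) V"
    using assms(4) by (intro finsum_cong') auto
  then show ?case by (simp add: D.mono_eval_empty mono_eval_empty finsum_zero)
next
  case (add x \<mu>)
  interpret D: cring "dual R" by (rule dual_cring)
  define t where "t v = add_pow R (count \<mu> v) (mono_eval R a (\<mu> - {#v#})) \<otimes> w v" for v
  have x: "x \<in> V" "set_mset \<mu> \<subseteq> V" using add.prems by auto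
  have mc: "mono_eval R a \<nu> \<in> carrier R" if "set_mset \<nu> \<subseteq> V" for \<nu>
    using that assms(3) by (intro mono_eval_closed) auto
  have sub: "set_mset (\<mu> - {#v#}) \<subseteq> V" for v using x(2) by (meson in_diffD subset_iff)
  have tc: "t v \<in> carrier R" if "v \<in> V" for v unfolding t_def using mc[OF sub] assms(4) that by simp
  have ax: "a x \<in> carrier R" "w x \<in> carrier R" using assms x by auto
  have Mc: "mono_eval R a \<mu> \<in> carrier R" using mc x by blast
  \<comment> \<open>A further factor \<open>x\<close> multiplies every old summand by
    \<open>a x\<close> and contributes one new summand at \<open>x\<close>.\<close>
  have tm: "add_pow R (count (add_mset x \<mu>) v) (mono_eval R a (add_mset x \<mu> - {#v#})) \<otimes> w v
      = a x \<otimes> t v \<oplus> (if v = x then mono_eval R a \<mu> \<otimes> w x else \<zero>)" if v: "v \<in> V" for v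
  proof (cases "v \<in># \<mu>")
    case True
    have wv: "w v \<in> carrier R" using assms v by blast
    have mv: "mono_eval R a (\<mu> - {#v#}) \<in> carrier R" using mc sub by blast
    have e: "mono_eval R a (add_mset x \<mu> - {#v#}) = a x \<otimes> mono_eval R a (\<mu> - {#v#})"
    proof -
      have "add_mset x \<mu> - {#v#} = add_mset x (\<mu> - {#v#})"
        using True by (simp add: multiset_eq_iff)
      moreover have "mono_eval R a (add_mset x (\<mu> - {#v#})) = a x \<otimes> mono_eval R a (\<mu> - {#v#})"
        using ax(1) sub[of v] assms(3) by (intro mono_eval_add_mset) blast+
      ultimately show ?thesis by simp
    qed
    have 1: "add_pow R (count \<mu> v) (a x \<otimes> mono_eval R a (\<mu> - {#v#})) \<otimes> w v = a x \<otimes> t v"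
      unfolding t_def add_pow_rdistr[OF ax(1) mv, symmetric] using ax mv wv by (intro m_assoc) simp_all
    show ?thesis
    proof (cases "v = x")
      case True
      have "a x \<otimes> mono_eval R a (\<mu> - {#v#}) = mono_eval R a \<mu>"
        using e True by simp
      then show ?thesis using 1 e True ax mv wv Mc tc[OF v] by (simp add: l_distr)
    next
      case False
      then show ?thesis using 1 e ax tc[OF v] by simp
    qed
  next
    case False
    then have "count \<mu> v = 0" by (simp add: not_in_iff)
    moreover have "w v \<in> carrier R" using assms v by blast
    ultimately show ?thesis using ax Mc by (auto simp: t_def)
  qed
  have c1: "(\<lambda>v. a x \<otimes> t v) \<in> V \<rightarrow> carrier R" using tc ax by simp
  have c2: "(\<lambda>v. if v = x then mono_eval R a \<mu> \<otimes> w x else \<zero>) \<in> V \<rightarrow> carrier R" using Mc ax by simp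
  have "finsum R (\<lambda>v. add_pow R (count (add_mset x \<mu>) v) (mono_eval R a (add_mset x \<mu> - {#v#})) \<otimes> w v) V
      = finsum R (\<lambda>v. a x \<otimes> t v \<oplus> (if v = x then mono_eval R a \<mu> \<otimes> w x else \<zero>)) V"
    using tm c1 c2 by (intro finsum_cong') auto
  also have "\<dots> = finsum R (\<lambda>v. a x \<otimes> t v) V \<oplus> finsum R (\<lambda>v. if v = x then mono_eval R a \<mu> \<otimes> w x else \<zero>) V"
    by (rule finsum_addf[OF c1 c2])
  also have "finsum R (\<lambda>v. if v = x then mono_eval R a \<mu> \<otimes> w x else \<zero>) V = mono_eval R a \<mu> \<otimes> w x"
    using finsum_singleton[OF x(1) assms(1), of "\<lambda>_. mono_eval R a \<mu> \<otimes> w x"] Mc ax by (simp add: eq_commute[of x] Pi_I)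
  also have "finsum R (\<lambda>v. a x \<otimes> t v) V = a x \<otimes> finsum R t V"
    using finsum_rdistr[OF assms(1) ax(1), of t] tc by auto
  finally have s: "finsum R (\<lambda>v. add_pow R (count (add_mset x \<mu>) v) (mono_eval R a (add_mset x \<mu> - {#v#})) \<otimes> w v) V
      = a x \<otimes> finsum R t V \<oplus> mono_eval R a \<mu> \<otimes> w x" .
  have "mono_eval (dual R) (\<lambda>v. (a v, w v)) (add_mset x \<mu>) =
      (a x, w x) \<otimes>\<^bsub>dual R\<^esub> mono_eval (dual R) (\<lambda>v. (a v, w v)) \<mu>"
    using x assms(3,4) by (intro D.mono_eval_add_mset) auto
  also have "\<dots> = (a x \<otimes> mono_eval R a \<mu>, a x \<otimes> finsum R t V \<oplus> w x \<otimes> mono_eval R a \<mu>)"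
    using add.IH[OF x(2)] unfolding t_def[abs_def, symmetric] by simp
  also have "w x \<otimes> mono_eval R a \<mu> = mono_eval R a \<mu> \<otimes> w x" using Mc ax by (simp add: m_comm)
  also have "a x \<otimes> mono_eval R a \<mu> = mono_eval R a (add_mset x \<mu>)"
    using x assms(3) by (intro mono_eval_add_mset[symmetric]) auto
  finally show ?case unfolding s .
qed

end

text \<open>The dual numbers obtained from polynomials over \<open>K\<close> by evaluation. Building
  them term by term makes closure under products an induction and spares a multiplication of
  coefficient functions.\<close>

inductive_set term_span :: "('a, 'b) ring_scheme \<Rightarrow> 'a set \<Rightarrow> ('a \<Rightarrow> 'a) \<Rightarrow> ('v \<Rightarrow> 'a \<times> 'a) \<Rightarrow> 'v set \<Rightarrow> ('a \<times> 'a) set"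
  for R K d b V where
  zero: "\<zero>\<^bsub>dual R\<^esub> \<in> term_span R K d b V"
| step: "z \<in> term_span R K d b V \<Longrightarrow> c \<in> K \<Longrightarrow> set_mset \<mu> \<subseteq> V \<Longrightarrow>
    z \<oplus>\<^bsub>dual R\<^esub> ((c, d c) \<otimes>\<^bsub>dual R\<^esub> mono_eval (dual R) b \<mu>) \<in> term_span R K d b V"

context field begin

context
  fixes K :: "'a set" and d :: "'a \<Rightarrow> 'a" and V :: "'v set" and a w :: "'v \<Rightarrow> 'a" and b T
  assumes K: "subfield K R" and d: "derivation R K d" and V: "finite V"
    and a: "\<And>v. v \<in> V \<Longrightarrow> a v \<in> carrier R" and w: "\<And>v. v \<in> V \<Longrightarrow> w v \<in> carrier R"
    and b_def: "b = (\<lambda>v. (a v, w v))"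
    and T_def: "T = (\<lambda>c \<mu>. (c, d c) \<otimes>\<^bsub>dual R\<^esub> mono_eval (dual R) b \<mu>)"
begin

interpretation D: cring "dual R" by (rule dual_cring)

lemma K_props:
  "c \<in> K \<Longrightarrow> c \<in> carrier R" "\<one> \<in> K" "\<zero> \<in> K" "c \<in> K \<Longrightarrow> \<ominus> c \<in> K"
  "c \<in> K \<Longrightarrow> c' \<in> K \<Longrightarrow> c \<oplus> c' \<in> K" "c \<in> K \<Longrightarrow> c' \<in> K \<Longrightarrow> c \<otimes> c' \<in> K"
  using subfieldE(3)[OF K] subringE[OF subfieldE(1)[OF K]] by auto

lemma d_props:
  "c \<in> K \<Longrightarrow> d c \<in> K" "c \<in> K \<Longrightarrow> c' \<in> K \<Longrightarrow> d (c \<oplus> c') = d c \<oplus> d c'"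
  "c \<in> K \<Longrightarrow> c' \<in> K \<Longrightarrow> d (c \<otimes> c') = d c \<otimes> c' \<oplus> c \<otimes> d c'"
  using d unfolding derivation_def by auto

lemma d_zero: "d \<zero> = \<zero>"
proof -
  have "d \<zero> \<oplus> d \<zero> = d \<zero>" using d_props(2)[of \<zero> \<zero>] K_props(3) by simp
  moreover have "d \<zero> \<in> carrier R" using d_props(1) K_props by blast
  ultimately show ?thesis by (metis add.l_cancel_one' add.r_cancel_one' zero_closed add.r_cancel_one)
qed

lemma d_one: "d \<one> = \<zero>"
proof -
  have c: "d \<one> \<in> carrier R" using d_props(1) K_props by blast
  have "d \<one> \<oplus> d \<one> = d \<one>" using d_props(3)[of \<one> \<one>] K_props(2) c by simp
  then show ?thesis using c by (metis add.r_cancel_one)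
qed

lemma mono_carrier: "set_mset \<mu> \<subseteq> V \<Longrightarrow> mono_eval (dual R) b \<mu> \<in> carrier (dual R)"
  unfolding b_def using a w by (intro D.mono_eval_closed) auto

lemma const_carrier: "c \<in> K \<Longrightarrow> (c, d c) \<in> carrier (dual R)"
  using K_props d_props by auto

lemma T_carrier: "c \<in> K \<Longrightarrow> set_mset \<mu> \<subseteq> V \<Longrightarrow> T c \<mu> \<in> carrier (dual R)"
  unfolding T_def using mono_carrier const_carrier D.m_closed by blast

lemma T_add: "c \<in> K \<Longrightarrow> c' \<in> K \<Longrightarrow> set_mset \<mu> \<subseteq> V \<Longrightarrow> T (c \<oplus> c') \<mu> = T c \<mu> \<oplus>\<^bsub>dual R\<^esub> T c' \<mu>"
  unfolding T_def using D.l_distr[OF const_carrier const_carrier mono_carrier, of c c' \<mu>] d_props(2)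
  by (simp del: dual_simps(2))

lemma T_zero: "set_mset \<mu> \<subseteq> V \<Longrightarrow> T \<zero> \<mu> = \<zero>\<^bsub>dual R\<^esub>"
  using mono_carrier[of \<mu>] unfolding T_def d_zero by (auto simp: mem_Times_iff)

lemma T_mult:
  assumes "c \<in> K" "c' \<in> K" "set_mset \<mu> \<subseteq> V" "set_mset \<nu> \<subseteq> V"
  shows "T c \<mu> \<otimes>\<^bsub>dual R\<^esub> T c' \<nu> = T (c \<otimes> c') (\<mu> + \<nu>)"
proof -
  have "d c \<otimes> c' \<oplus> c \<otimes> d c' = c \<otimes> d c' \<oplus> d c \<otimes> c'"
    using K_props(1) d_props(1) assms by (simp add: a_comm)
  then have 1: "(c \<otimes> c', d (c \<otimes> c')) = (c, d c) \<otimes>\<^bsub>dual R\<^esub> (c', d c')"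
    using assms d_props(3) by simp
  have 2: "mono_eval (dual R) b (\<mu> + \<nu>) = mono_eval (dual R) b \<mu> \<otimes>\<^bsub>dual R\<^esub> mono_eval (dual R) b \<nu>"
    using assms a w by (intro D.mono_eval_union) (auto simp: b_def)
  show ?thesis unfolding T_def 1 2
    using const_carrier[OF assms(1)] const_carrier[OF assms(2)] mono_carrier[OF assms(3)] mono_carrier[OF assms(4)]
    by (simp only: D.m_ac D.m_closed)
qed

abbreviation "TS \<equiv> term_span R K d b V"

lemma TS_step:
  assumes "z \<in> TS" "c \<in> K" "set_mset \<mu> \<subseteq> V"
  shows "z \<oplus>\<^bsub>dual R\<^esub> T c \<mu> \<in> TS"
  unfolding T_def by (rule term_span.step[of z R K d b V c \<mu>, OF assms])

lemma TS_induct [consumes 1, case_names zero step]: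
  assumes "z \<in> TS" "P \<zero>\<^bsub>dual R\<^esub>"
    and "\<And>y c \<mu>. y \<in> TS \<Longrightarrow> P y \<Longrightarrow> c \<in> K \<Longrightarrow> set_mset \<mu> \<subseteq> V \<Longrightarrow> P (y \<oplus>\<^bsub>dual R\<^esub> T c \<mu>)"
  shows "P z"
  using assms(1)
proof (induction rule: term_span.induct)
  case zero
  show ?case by (rule assms(2))
next
  case (step y c \<mu>)
  from assms(3)[OF this(1,4,2,3)] show ?case unfolding T_def .
qed

lemma TS_carrier: "z \<in> TS \<Longrightarrow> z \<in> carrier (dual R)"
proof (induction rule: TS_induct)
  case zero
  show ?case by (rule D.zero_closed)
next
  case (step z c \<mu>)
  show ?case by (rule D.a_closed[OF step(4) T_carrier[OF step(2,3)]])
qed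

lemma T_in_TS:
  assumes "c \<in> K" "set_mset \<mu> \<subseteq> V"
  shows "T c \<mu> \<in> TS"
  using TS_step[OF term_span.zero assms] unfolding D.l_zero[OF T_carrier[OF assms]] .

lemma TS_add:
  assumes z': "z' \<in> TS" and z: "z \<in> TS"
  shows "z \<oplus>\<^bsub>dual R\<^esub> z' \<in> TS"
  using z'
proof (induction rule: TS_induct)
  case zero
  show ?case unfolding D.r_zero[OF TS_carrier[OF z]] by (rule z)
next
  case (step y c \<mu>)
  show ?case
    unfolding D.a_assoc[OF TS_carrier[OF z] TS_carrier[OF step(1)] T_carrier[OF step(2,3)], symmetric]
    by (rule TS_step[OF step(4,2,3)])
qed

lemma TS_mult_T:
  assumes z: "z \<in> TS" and c: "c \<in> K" "set_mset \<mu> \<subseteq> V"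
  shows "T c \<mu> \<otimes>\<^bsub>dual R\<^esub> z \<in> TS"
  using z
proof (induction rule: TS_induct)
  case zero
  show ?case unfolding D.r_null[OF T_carrier[OF c]] by (rule term_span.zero)
next
  case (step y c' \<nu>)
  have u: "set_mset (\<mu> + \<nu>) \<subseteq> V" using step c by simp
  show ?case
    unfolding D.r_distr[OF TS_carrier[OF step(1)] T_carrier[OF step(2,3)] T_carrier[OF c]]
      T_mult[OF c(1) step(2) c(2) step(3)]
    by (rule TS_step[OF step(4) K_props(6)[OF c(1) step(2)] u])
qed

lemma TS_mult:
  assumes z': "z' \<in> TS" and z: "z \<in> TS"
  shows "z' \<otimes>\<^bsub>dual R\<^esub> z \<in> TS"
  using z'
proof (induction rule: TS_induct)
  case zero
  show ?case unfolding D.l_null[OF TS_carrier[OF z]] by (rule term_span.zero)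
next
  case (step y c \<mu>)
  show ?case
    unfolding D.l_distr[OF TS_carrier[OF step(1)] T_carrier[OF step(2,3)] TS_carrier[OF z]]
    by (rule TS_add[OF TS_mult_T[OF z step(2,3)] step(4)])
qed

lemma T_const: "c \<in> K \<Longrightarrow> T c {#} = (c, d c)"
  unfolding T_def D.mono_eval_empty using D.r_one[OF const_carrier] by blast

lemma TS_subring: "subring TS (dual R)"
proof (rule D.subringI)
  show "TS \<subseteq> carrier (dual R)" using TS_carrier by blast
  show one: "\<one>\<^bsub>dual R\<^esub> \<in> TS" using T_in_TS[of \<one> "{#}"] T_const[of \<one>] K_props(2) d_one by simp
  fix h assume h: "h \<in> TS"
  \<comment> \<open>Negation is multiplication by the constant -1, whose derivative is zero.\<close>
  have "d (\<ominus> \<one>) \<oplus> d \<one> = \<zero>" using d_props(2)[of "\<ominus> \<one>" \<one>] K_props(2,4) d_zero by (simp add: l_neg)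
  then have "d (\<ominus> \<one>) = \<zero>" using d_one K_props(1)[OF d_props(1)[OF K_props(4)[OF K_props(2)]]] by simp
  then have "T (\<ominus> \<one>) {#} = \<ominus>\<^bsub>dual R\<^esub> \<one>\<^bsub>dual R\<^esub>"
    using T_const K_props(2,4) dual_neg[of \<one> \<zero>] by simp
  then have "\<ominus>\<^bsub>dual R\<^esub> \<one>\<^bsub>dual R\<^esub> \<otimes>\<^bsub>dual R\<^esub> h \<in> TS"
    using TS_mult_T[OF h, of "\<ominus> \<one>" "{#}"] K_props(2,4) by (metis empty_subsetI set_mset_empty)
  then show "\<ominus>\<^bsub>dual R\<^esub> h \<in> TS" using D.l_minus[OF D.one_closed TS_carrier[OF h]] D.l_one[OF TS_carrier[OF h]] by metis
qed (use TS_add TS_mult in blast)+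

lemma gens_TS: "{(c, d c) | c. c \<in> K} \<union> {(a v, w v) | v. v \<in> V} \<subseteq> TS"
proof (rule Un_least)
  show "{(c, d c) | c. c \<in> K} \<subseteq> TS" using T_in_TS[of _ "{#}"] T_const by fastforce
  show "{(a v, w v) | v. v \<in> V} \<subseteq> TS"
  proof clarify
    fix v assume v: "v \<in> V"
    have bv: "b v \<in> carrier (dual R)" using a w v by (simp add: b_def)
    have "mono_eval (dual R) b {#v#} = b v"
      using D.mono_eval_add_mset[of b v "{#}"] bv D.r_one[OF bv] D.mono_eval_empty[of b] by simp
    then have "T \<one> {#v#} = b v" unfolding T_def d_one using D.l_one[OF bv] by simp
    then show "(a v, w v) \<in> TS" using T_in_TS[of \<one> "{#v#}"] K_props(2) v by (simp add: b_def)
  qed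
qed

definition term_sum :: "('v multiset \<Rightarrow> 'a) \<Rightarrow> 'a \<times> 'a" where
  "term_sum f = finsum (dual R) (\<lambda>\<mu>. T (f \<mu>) \<mu>) {\<mu>. f \<mu> \<noteq> \<zero>}"

lemma term_sum_superset:
  assumes "mpoly_over R K V f" "finite A" "{\<mu>. f \<mu> \<noteq> \<zero>} \<subseteq> A" "\<And>\<mu>. \<mu> \<in> A \<Longrightarrow> set_mset \<mu> \<subseteq> V"
  shows "term_sum f = finsum (dual R) (\<lambda>\<mu>. T (f \<mu>) \<mu>) A"
  unfolding term_sum_def using assms T_zero T_carrier unfolding mpoly_over_def
  by (intro D.finsum_superset) (auto simp del: dual_simps)

lemma TS_term_sum: "z \<in> TS \<Longrightarrow> \<exists>f. mpoly_over R K V f \<and> z = term_sum f"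
proof (induction rule: TS_induct)
  case zero
  have "mpoly_over R K V (\<lambda>_. \<zero>)" using K_props(3) by (simp add: mpoly_over_def)
  moreover have "term_sum (\<lambda>_. \<zero>) = \<zero>\<^bsub>dual R\<^esub>" unfolding term_sum_def using D.finsum_empty by simp
  ultimately show ?case by metis
next
  case (step z c \<mu>)
  then obtain f where f: "mpoly_over R K V f" "z = term_sum f" by blast
  define f' where "f' = f(\<mu> := f \<mu> \<oplus> c)"
  \<comment> \<open>Both sums are taken over \<open>insert \<mu> S\<close>: the monomial \<mu> may
    be absent before the new term is added, and its coefficient may cancel afterwards.\<close>
  define S where "S = {\<nu>. f \<nu> \<noteq> \<zero>} - {\<mu>}"
  have S: "finite S" "\<mu> \<notin> S" using f(1) unfolding S_def mpoly_over_def by auto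
  have SV: "set_mset \<nu> \<subseteq> V" if "\<nu> \<in> insert \<mu> S" for \<nu>
    using that f(1) step.hyps unfolding S_def mpoly_over_def by auto
  have fK: "f \<nu> \<in> K" for \<nu> using f(1) unfolding mpoly_over_def by blast
  have f'K: "f' \<nu> \<in> K" for \<nu> using fK K_props(5) step.hyps unfolding f'_def by simp
  have supp': "{\<nu>. f' \<nu> \<noteq> \<zero>} \<subseteq> insert \<mu> S" unfolding f'_def S_def by auto
  have f': "mpoly_over R K V f'" unfolding mpoly_over_def
  proof (intro conjI allI impI)
    show "finite {\<nu>. f' \<nu> \<noteq> \<zero>}" using supp' S(1) finite_subset by blast
    show "set_mset \<nu> \<subseteq> V" if "f' \<nu> \<noteq> \<zero>" for \<nu> using that supp' SV by blast
  qed (rule f'K)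
  define rest where "rest = finsum (dual R) (\<lambda>\<nu>. T (f \<nu>) \<nu>) S"
  have rc: "rest \<in> carrier (dual R)" unfolding rest_def using T_carrier fK SV by (intro D.finsum_closed) blast
  have ins: "finsum (dual R) (\<lambda>\<nu>. T (g \<nu>) \<nu>) (insert \<mu> S) = T (g \<mu>) \<mu> \<oplus>\<^bsub>dual R\<^esub> finsum (dual R) (\<lambda>\<nu>. T (g \<nu>) \<nu>) S"
    if "\<And>\<nu>. g \<nu> \<in> K" for g
    using T_carrier that SV S by (intro D.finsum_insert) blast+
  have mV: "set_mset \<mu> \<subseteq> V" using step.hyps by blast
  have "term_sum f' = T (f' \<mu>) \<mu> \<oplus>\<^bsub>dual R\<^esub> finsum (dual R) (\<lambda>\<nu>. T (f' \<nu>) \<nu>) S"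
    using term_sum_superset[OF f' _ supp' SV] S(1) ins[OF f'K] by simp
  also have "finsum (dual R) (\<lambda>\<nu>. T (f' \<nu>) \<nu>) S = rest"
    unfolding rest_def
  proof (rule D.finsum_cong')
    show "(\<lambda>\<nu>. T (f \<nu>) \<nu>) \<in> S \<rightarrow> carrier (dual R)" using T_carrier fK SV by blast
    show "T (f' \<nu>) \<nu> = T (f \<nu>) \<nu>" if "\<nu> \<in> S" for \<nu> using that S(2) unfolding f'_def by (metis fun_upd_other)
  qed simp
  also have "T (f' \<mu>) \<mu> = T (f \<mu>) \<mu> \<oplus>\<^bsub>dual R\<^esub> T c \<mu>"
    unfolding f'_def using T_add[OF fK _ mV] step.hyps by (metis fun_upd_same)
  finally have 1: "term_sum f' = (T (f \<mu>) \<mu> \<oplus>\<^bsub>dual R\<^esub> T c \<mu>) \<oplus>\<^bsub>dual R\<^esub> rest" .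
  have "{\<nu>. f \<nu> \<noteq> \<zero>} \<subseteq> insert \<mu> S" unfolding S_def by auto
  from term_sum_superset[OF f(1) _ this SV] have 2: "term_sum f = T (f \<mu>) \<mu> \<oplus>\<^bsub>dual R\<^esub> rest"
    using S(1) ins[OF fK] unfolding rest_def by simp
  have "term_sum f \<oplus>\<^bsub>dual R\<^esub> T c \<mu> = term_sum f'"
    unfolding 1 2 using T_carrier[OF fK mV, of \<mu>] T_carrier[OF _ mV] step.hyps rc
    by (simp only: D.a_ac D.a_closed)
  then show ?case using f' f(2) by metis
qed

text \<open>The second component is the total derivative of \<open>f\<close>. It arises monomial by
  monomial, so the sums over monomials and over variables have to be interchanged.\<close>

lemma term_sum_eq:
  assumes f: "mpoly_over R K V f"
  shows "term_sum f = (mpoly_eval R a f,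
    finsum R (\<lambda>v. mpoly_pderiv_eval R a f v \<otimes> w v) V \<oplus> mpoly_coeffderiv_eval R d a f)"
proof -
  define S where "S = {\<mu>. f \<mu> \<noteq> \<zero>}"
  have S: "finite S" and SV: "\<And>\<mu>. \<mu> \<in> S \<Longrightarrow> set_mset \<mu> \<subseteq> V" and fK: "\<And>\<mu>. f \<mu> \<in> K"
    using f unfolding mpoly_over_def S_def by auto
  have fc: "f \<mu> \<in> carrier R" "d (f \<mu>) \<in> carrier R" for \<mu> using K_props(1) fK d_props(1) by blast+
  have mc: "mono_eval R a \<nu> \<in> carrier R" if "set_mset \<nu> \<subseteq> V" for \<nu>
    using that a by (intro mono_eval_closed) auto
  have mc': "mono_eval R a (\<mu> - {#v#}) \<in> carrier R" if "\<mu> \<in> S" for \<mu> v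
  proof -
    have "set_mset (\<mu> - {#v#}) \<subseteq> V" using SV[OF that] by (meson in_diffD subset_iff)
    then show ?thesis by (rule mc)
  qed
  define p where "p \<mu> v = add_pow R (count \<mu> v) (mono_eval R a (\<mu> - {#v#}))" for \<mu> v
  have pc: "p \<mu> v \<in> carrier R" if "\<mu> \<in> S" for \<mu> v unfolding p_def using mc'[OF that] by simp
  have Tf: "T (f \<mu>) \<mu> = (f \<mu> \<otimes> mono_eval R a \<mu>,
      f \<mu> \<otimes> finsum R (\<lambda>v. p \<mu> v \<otimes> w v) V \<oplus> d (f \<mu>) \<otimes> mono_eval R a \<mu>)" if "\<mu> \<in> S" for \<mu>
    unfolding T_def b_def using mono_eval_dual[OF V SV[OF that] a w] by (simp add: p_def)
  have sc: "finsum R (\<lambda>v. p \<mu> v \<otimes> w v) V \<in> carrier R" if "\<mu> \<in> S" for \<mu>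
    using pc that w by (intro finsum_closed) auto
  have "term_sum f = finsum (dual R) (\<lambda>\<mu>. (f \<mu> \<otimes> mono_eval R a \<mu>,
      f \<mu> \<otimes> finsum R (\<lambda>v. p \<mu> v \<otimes> w v) V \<oplus> d (f \<mu>) \<otimes> mono_eval R a \<mu>)) S"
    unfolding term_sum_def S_def[symmetric] using Tf fc sc mc SV by (intro D.finsum_cong') auto
  also have "\<dots> = (finsum R (\<lambda>\<mu>. f \<mu> \<otimes> mono_eval R a \<mu>) S,
      finsum R (\<lambda>\<mu>. f \<mu> \<otimes> finsum R (\<lambda>v. p \<mu> v \<otimes> w v) V \<oplus> d (f \<mu>) \<otimes> mono_eval R a \<mu>) S)"
    using finsum_dual[OF S, of "\<lambda>\<mu>. (f \<mu> \<otimes> mono_eval R a \<mu>,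
      f \<mu> \<otimes> finsum R (\<lambda>v. p \<mu> v \<otimes> w v) V \<oplus> d (f \<mu>) \<otimes> mono_eval R a \<mu>)"] fc sc mc SV by simp
  also have "finsum R (\<lambda>\<mu>. f \<mu> \<otimes> finsum R (\<lambda>v. p \<mu> v \<otimes> w v) V \<oplus> d (f \<mu>) \<otimes> mono_eval R a \<mu>) S =
      finsum R (\<lambda>\<mu>. f \<mu> \<otimes> finsum R (\<lambda>v. p \<mu> v \<otimes> w v) V) S \<oplus> finsum R (\<lambda>\<mu>. d (f \<mu>) \<otimes> mono_eval R a \<mu>) S"
    using fc sc mc SV by (intro finsum_addf) auto
  also have "finsum R (\<lambda>\<mu>. f \<mu> \<otimes> finsum R (\<lambda>v. p \<mu> v \<otimes> w v) V) S =
      finsum R (\<lambda>\<mu>. finsum R (\<lambda>v. f \<mu> \<otimes> (p \<mu> v \<otimes> w v)) V) S"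
  proof (rule finsum_cong')
    show "(\<lambda>\<mu>. finsum R (\<lambda>v. f \<mu> \<otimes> (p \<mu> v \<otimes> w v)) V) \<in> S \<rightarrow> carrier R"
      using fc pc w by (auto intro!: finsum_closed)
    show "f \<mu> \<otimes> finsum R (\<lambda>v. p \<mu> v \<otimes> w v) V = finsum R (\<lambda>v. f \<mu> \<otimes> (p \<mu> v \<otimes> w v)) V" if "\<mu> \<in> S" for \<mu>
      using pc[OF that] w fc by (intro finsum_rdistr V) auto
  qed simp
  also have "\<dots> = finsum R (\<lambda>v. finsum R (\<lambda>\<mu>. f \<mu> \<otimes> (p \<mu> v \<otimes> w v)) S) V"
    using fc pc w by (intro finsum_swap S V) auto
  also have "\<dots> = finsum R (\<lambda>v. mpoly_pderiv_eval R a f v \<otimes> w v) V"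
  proof (rule finsum_cong')
    have mp: "mpoly_pderiv_eval R a f v = finsum R (\<lambda>\<mu>. f \<mu> \<otimes> p \<mu> v) S" for v
      unfolding mpoly_pderiv_eval_def S_def p_def ..
    show "(\<lambda>v. mpoly_pderiv_eval R a f v \<otimes> w v) \<in> V \<rightarrow> carrier R"
      unfolding mp using fc pc w by (auto intro!: finsum_closed)
    show "finsum R (\<lambda>\<mu>. f \<mu> \<otimes> (p \<mu> v \<otimes> w v)) S = mpoly_pderiv_eval R a f v \<otimes> w v" if v: "v \<in> V" for v
    proof -
      have "mpoly_pderiv_eval R a f v \<otimes> w v = finsum R (\<lambda>\<mu>. (f \<mu> \<otimes> p \<mu> v) \<otimes> w v) S"
        unfolding mp using fc pc w[OF v] by (intro finsum_ldistr S) auto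
      also have "\<dots> = finsum R (\<lambda>\<mu>. f \<mu> \<otimes> (p \<mu> v \<otimes> w v)) S"
        using fc pc w[OF v] by (intro finsum_cong') (auto simp: m_assoc)
      finally show ?thesis by simp
    qed
  qed simp
  finally show ?thesis by (simp add: mpoly_eval_def mpoly_coeffderiv_eval_def S_def)
qed

text \<open>An element (0, y) of the ring \<open>TS\<close> comes from some \<open>f\<close> that
  vanishes at \<open>a\<close>, and y is then the left side of the assumed equation. Fractions are
  covered by \<open>dcl_fnl\<close>.\<close>

theorem polynomial_relations_fnl:
  assumes "\<And>f. mpoly_over R K V f \<Longrightarrow> mpoly_eval R a f = \<zero> \<Longrightarrow>
    finsum R (\<lambda>v. mpoly_pderiv_eval R a f v \<otimes> w v) V \<oplus> mpoly_coeffderiv_eval R d a f = \<zero>"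
  shows "fnl R (dcl R ({(c, d c) | c. c \<in> K} \<union> {(a v, w v) | v. v \<in> V}))"
proof (rule dcl_fnl[OF TS_subring gens_TS])
  show "fnl R TS" unfolding fnl_def
  proof (intro allI impI)
    fix y assume "(\<zero>, y) \<in> TS"
    then obtain f where f: "mpoly_over R K V f" "(\<zero>, y) = term_sum f" using TS_term_sum by blast
    then show "y = \<zero>" using term_sum_eq[OF f(1)] assms[OF f(1)] by simp
  qed
qed

end

end

section \<open>The order on the indices\<close>

lemma lexord_add:
  fixes us vs ws :: "nat list"
  assumes "length us = length vs" "length vs = length ws" "(us, vs) \<in> lexord {(x, y). x < y}"
  shows "(map2 (+) us ws, map2 (+) vs ws) \<in> lexord {(x, y). x < y}"
  using assms by (induction us vs ws rule: list_induct3) auto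

text \<open>Counting predecessors is strictly monotone, and its values form an unbounded initial
  segment of the natural numbers; the inverse is the enumeration.\<close>

lemma ex_rank:
  assumes irrefl: "\<And>x. x \<in> I \<Longrightarrow> \<not> lt x x"
    and trans: "\<And>x y z. x \<in> I \<Longrightarrow> y \<in> I \<Longrightarrow> z \<in> I \<Longrightarrow> lt x y \<Longrightarrow> lt y z \<Longrightarrow> lt x z"
    and total: "\<And>x y. x \<in> I \<Longrightarrow> y \<in> I \<Longrightarrow> x \<noteq> y \<Longrightarrow> lt x y \<or> lt y x"
    and fin: "\<And>x. x \<in> I \<Longrightarrow> finite {y \<in> I. lt y x}" and inf: "infinite I"
  shows "\<exists>en :: nat \<Rightarrow> _. bij_betw en UNIV I \<and> (\<forall>x y. lt (en x) (en y) \<longleftrightarrow> x < y)"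
proof -
  define rk where "rk x = card {y \<in> I. lt y x}" for x
  have mono: "rk x < rk y" if "x \<in> I" "y \<in> I" "lt x y" for x y
  proof -
    have "{z \<in> I. lt z x} \<subset> {z \<in> I. lt z y}" using that trans irrefl by blast
    then show ?thesis unfolding rk_def using fin[OF that(2)] by (rule psubset_card_mono[rotated])
  qed
  have inj: "inj_on rk I"
    by (rule inj_onI) (metis total mono less_irrefl)
  have below: "{..<rk x} \<subseteq> rk ` I" if x: "x \<in> I" for x
  proof -
    have "rk ` {y \<in> I. lt y x} \<subseteq> {..<rk x}" using mono x by auto
    moreover have "card (rk ` {y \<in> I. lt y x}) = rk x"
      using card_image[OF inj_on_subset[OF inj, of "{y \<in> I. lt y x}"]] by (auto simp: rk_def)
    ultimately have "rk ` {y \<in> I. lt y x} = {..<rk x}" by (intro card_subset_eq) auto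
    then show ?thesis by blast
  qed
  have "infinite (rk ` I)" using inf inj finite_imageD by blast
  then have "\<not> rk ` I \<subseteq> {..k}" for k using finite_subset[of "rk ` I" "{..k}"] by auto
  then have "\<exists>x\<in>I. k < rk x" for k by (metis atMost_iff image_subsetI not_le)
  then have "rk ` I = UNIV" using below by blast
  then have bij: "bij_betw rk I UNIV" using inj by (simp add: bij_betw_def)
  define en where "en = inv_into I rk"
  have en: "bij_betw en UNIV I" unfolding en_def by (rule bij_betw_inv_into[OF bij])
  have rk_en: "rk (en k) = k" for k unfolding en_def using bij bij_betw_inv_into_right by fastforce
  have "lt (en x) (en y) \<longleftrightarrow> x < y" for x y
  proof -
    have "en x \<in> I" "en y \<in> I" using en by (auto simp: bij_betw_def)
    then show ?thesis using mono total irrefl rk_en by (metis less_asym less_irrefl)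
  qed
  then show ?thesis using en by blast
qed

section \<open>Multi-indices and shifts\<close>

definition idx :: "nat \<Rightarrow> nat \<Rightarrow> ((nat \<Rightarrow> nat) \<times> nat) set" where
  "idx m n = {(\<xi>, h). mindex m \<xi> \<and> h < n}"

definition shift :: "nat \<Rightarrow> (nat \<Rightarrow> nat) \<times> nat \<Rightarrow> (nat \<Rightarrow> nat) \<times> nat" where
  "shift i p = (madd (fst p) (unitv i), snd p)"

lemma shift_idx: "i < m \<Longrightarrow> p \<in> idx m n \<Longrightarrow> shift i p \<in> idx m n"
  by (auto simp: shift_def idx_def mindex_def madd_def unitv_def)

lemma shift_comm: "shift i (shift j p) = shift j (shift i p)"
  by (auto simp: shift_def madd_def)

lemma msize_shift: "i < m \<Longrightarrow> msize m (fst (shift i p)) = Suc (msize m (fst p))"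
  by (simp add: shift_def msize_def madd_def unitv_def sum.distrib)

text \<open>The key leaves out the last coordinate, which is recovered from the size.\<close>

lemma okey_inj:
  assumes "p \<in> idx m n" "q \<in> idx m n" "okey m p = okey m q"
  shows "p = q"
proof -
  obtain \<xi> h \<eta> g where p: "p = (\<xi>, h)" and q: "q = (\<eta>, g)" by force
  have hg: "h = g" and s: "msize m \<xi> = msize m \<eta>" and l: "map \<xi> [0..<m - 1] = map \<eta> [0..<m - 1]"
    using assms(3) by (auto simp: okey_def p q)
  have low: "\<xi> j = \<eta> j" if "j < m - 1" for j
    using that l by (auto simp: map_eq_conv)
  have "\<xi> j = \<eta> j" for j
  proof -
    consider "m \<le> j" | "j < m - 1" | "j = m - 1" "0 < m" by linarith
    then show ?thesis
    proof cases
      case 1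
      then show ?thesis using assms by (auto simp: p q idx_def mindex_def)
    next
      case 2
      then show ?thesis by (rule low)
    next
      case 3
      then obtain k where k: "m = Suc k" "j = k" using gr0_implies_Suc by auto
      have "(\<Sum>i<k. \<xi> i) = (\<Sum>i<k. \<eta> i)" using low k by (intro sum.cong) auto
      then show ?thesis using s k by (simp add: msize_def)
    qed
  qed
  then show ?thesis using p q hg by auto
qed

lemma olt_trans: "olt m p q \<Longrightarrow> olt m q t \<Longrightarrow> olt m p t"
  unfolding olt_def by (rule lexord_trans) (auto simp: trans_def)

lemma olt_irrefl: "\<not> olt m p p"
  unfolding olt_def by (rule lexord_irreflexive) auto

lemma olt_total: "p \<in> idx m n \<Longrightarrow> q \<in> idx m n \<Longrightarrow> p \<noteq> q \<Longrightarrow> olt m p q \<or> olt m q p"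
  using lexord_linear[of "{(x, y). x < (y::nat)}" "okey m p" "okey m q"] okey_inj[of p m n q]
  unfolding olt_def by (auto simp: linorder_less_linear)

lemma olt_msize: "olt m p q \<Longrightarrow> msize m (fst p) \<le> msize m (fst q)"
  by (auto simp: olt_def okey_def)

lemma olt_shift:
  assumes "olt m p q" "i < m"
  shows "olt m (shift i p) (shift i q)"
proof -
  \<comment> \<open>A shift adds this fixed list to every key. For \<open>i = m - 1\<close> the
    changed coordinate is not part of the key and only the size entry grows.\<close>
  define ws where "ws = 1 # 0 # map (unitv i) [0..<m - 1]"
  have k: "okey m (shift i p) = map2 (+) (okey m p) ws" for p
    using msize_shift[OF assms(2)] unfolding okey_def ws_def
    by (simp add: shift_def madd_def map2_map_map)
  have "length (okey m p) = length (okey m q)" "length (okey m q) = length ws"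
    by (simp_all add: okey_def ws_def)
  then show ?thesis using lexord_add assms(1) unfolding olt_def k by blast
qed

lemma finite_msize: "finite {p \<in> idx m n. msize m (fst p) \<le> s}"
proof -
  have "{p \<in> idx m n. msize m (fst p) \<le> s} \<subseteq>
      {\<xi>. \<forall>j. (j \<in> {..<m} \<longrightarrow> \<xi> j \<in> {..s}) \<and> (j \<notin> {..<m} \<longrightarrow> \<xi> j = 0)} \<times> {..<n}"
  proof (rule subsetI)
    fix p assume p: "p \<in> {p \<in> idx m n. msize m (fst p) \<le> s}"
    have "fst p j \<le> s" if "j < m" for j
      using member_le_sum[of j "{..<m}" "fst p"] p that by (simp add: msize_def)
    then show "p \<in> {\<xi>. \<forall>j. (j \<in> {..<m} \<longrightarrow> \<xi> j \<in> {..s}) \<and> (j \<notin> {..<m} \<longrightarrow> \<xi> j = 0)} \<times> {..<n}"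
      using p by (cases p) (auto simp: idx_def mindex_def)
  qed
  moreover have "finite ({\<xi>. \<forall>j. (j \<in> {..<m} \<longrightarrow> \<xi> j \<in> {..s}) \<and> (j \<notin> {..<m} \<longrightarrow> \<xi> j = (0::nat))} \<times> {..<n})"
    by (intro finite_cartesian_product finite_set_of_finite_funs) auto
  ultimately show ?thesis by (rule finite_subset)
qed

lemma top_idx: "0 < m \<Longrightarrow> h < n \<Longrightarrow> (\<lambda>j. if j = 0 then s else 0, h) \<in> idx m n"
  by (simp add: idx_def mindex_def)

lemma msize_top: "0 < m \<Longrightarrow> msize m (\<lambda>j. if j = 0 then s else 0) = s"
  by (simp add: msize_def sum.delta)

lemma ex_enumeration:
  assumes "0 < m" "0 < n"
  shows "\<exists>en :: nat \<Rightarrow> _. bij_betw en UNIV (idx m n) \<and> (\<forall>x y. olt m (en x) (en y) \<longleftrightarrow> x < y)"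
proof (rule ex_rank)
  show "finite {q \<in> idx m n. olt m q p}" for p
    by (rule finite_subset[OF _ finite_msize[of m n "msize m (fst p)"]]) (auto dest: olt_msize)
  have "inj (\<lambda>s. ((\<lambda>j. if j = 0 then s else (0::nat)), 0::nat))"
    by (rule injI) (auto dest: fun_cong[of _ _ 0])
  moreover have "range (\<lambda>s. ((\<lambda>j. if j = 0 then s else (0::nat)), 0::nat)) \<subseteq> idx m n"
    using top_idx[OF assms] by auto
  ultimately show "infinite (idx m n)"
    using infinite_super range_inj_infinite by blast
qed (auto simp: olt_irrefl intro: olt_trans dest: olt_total)

text \<open>Indices of equal size and equal second component are compared at coordinate 0 first, so
  putting all weight there gives the largest one. A single instance of the differential condition
  thus covers all generators of size less than \<open>s\<close>.\<close>

lemma idx_le_top: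
  assumes "0 < m" "0 < n" "0 < s"
  shows "idx_le m n (\<lambda>j. if j = 0 then s - 1 else 0) (n - 1) = {p \<in> idx m n. msize m (fst p) < s}"
proof -
  define t where "t = ((\<lambda>j::nat. if j = 0 then s - 1 else (0::nat)), n - 1)"
  have t: "t \<in> idx m n" "msize m (fst t) = s - 1"
    using top_idx[OF assms(1), of "n - 1" n "s - 1"] msize_top[OF assms(1), of "s - 1"] assms(2) by (auto simp: t_def)
  have "ole m p t \<longleftrightarrow> msize m (fst p) < s" if p: "p \<in> idx m n" for p
  proof
    assume "ole m p t"
    then have "msize m (fst p) \<le> s - 1" using olt_msize[of m p t] t(2) by (auto simp: ole_def okey_def)
    then show "msize m (fst p) < s" using assms by linarith
  next
    assume less: "msize m (fst p) < s"
    have "\<not> olt m t p"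
    proof
      assume o: "olt m t p"
      obtain \<xi> h where ph: "p = (\<xi>, h)" by force
      \<comment> \<open>An index of size less than \<open>s\<close> that lies above \<open>t\<close>
        would agree with \<open>t\<close> in size, in the second component, in coordinate 0 and
        hence in the whole key.\<close>
      have e: "msize m \<xi> = s - 1" using olt_msize[OF o] less t(2) ph by simp
      have "h \<le> n - 1" using p by (auto simp: ph idx_def)
      then have h: "h = n - 1" and l: "(map (fst t) [0..<m - 1], map \<xi> [0..<m - 1]) \<in> lexord {(x, y). x < y}"
        using o e t(2) by (auto simp: olt_def okey_def ph t_def)
      show False
      proof (cases "m - 1")
        case 0
        then show False using l by simp
      next
        case (Suc k)
        have tl: "map (fst t) [0..<m - 1] = (s - 1) # map (\<lambda>_. 0) [1..<m - 1]"
          "map \<xi> [0..<m - 1] = \<xi> 0 # map \<xi> [1..<m - 1]"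
          unfolding t_def Suc by (simp_all add: upt_conv_Cons del: upt_Suc)
        have "\<xi> 0 \<le> s - 1"
          using member_le_sum[of 0 "{..<m}" \<xi>] e assms(1) by (simp add: msize_def)
        then have x0: "\<xi> 0 = s - 1" and l': "(map (\<lambda>_. 0) [1..<m - 1], map \<xi> [1..<m - 1]) \<in> lexord {(x, y). x < y}"
          using l unfolding tl by auto
        have "(\<Sum>j\<in>{..<m} - {0}. \<xi> j) = 0"
          using e x0 assms(1) sum.remove[of "{..<m}" 0 \<xi>] by (simp add: msize_def)
        then have "\<xi> j = 0" if "j \<in> {1..<m - 1}" for j using that by auto
        then have "map (\<lambda>_. 0) [1..<m - 1] = map \<xi> [1..<m - 1]" by simp
        from l'[unfolded this] show False
          using lexord_irreflexive[of "{(x, y). x < (y::nat)}" "map \<xi> [1..<m - 1]"] by blast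
      qed
    qed
    then show "ole m p t" using olt_total[OF p t(1)] by (auto simp: ole_def)
  qed
  then show ?thesis unfolding idx_le_def idx_def t_def by auto
qed

text \<open>Two leaders below \<open>\<tau>\<close> that arise from minimal leaders of size at most \<open>r\<close> can be connected
  through a third one as soon as \<open>\<tau>\<close> has size more than \<open>2 * r\<close>, because then \<open>\<tau>\<close> lies strictly
  above the join of the two minimal leaders.\<close>

lemma leader_confluence:
  fixes P :: "(nat \<Rightarrow> nat) \<Rightarrow> nat \<Rightarrow> bool" and m n r :: nat
  defines "\<Lambda> \<equiv> {p \<in> idx m n. \<exists>\<rho>. msize m \<rho> \<le> r \<and> (\<forall>j. \<rho> j \<le> fst p j) \<and> P \<rho> (snd p)}"
  assumes t: "2 * r < msize m (fst t)" "t \<in> idx m n"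
    and p: "p \<in> \<Lambda>" "shift i p = t" "i < m" and q: "q \<in> \<Lambda>" "shift j q = t" "j < m"
  shows "\<exists>l<m. \<exists>s\<in>\<Lambda>. shift l s = t \<and>
    ((i = l \<and> p = s) \<or> (\<exists>z\<in>\<Lambda>. p = shift l z \<and> s = shift i z)) \<and>
    ((j = l \<and> q = s) \<or> (\<exists>z\<in>\<Lambda>. q = shift l z \<and> s = shift j z))"
proof -
  define dec where "dec l x = ((fst x)(l := fst x l - 1), snd x)" for l :: nat and x :: "(nat \<Rightarrow> nat) \<times> nat"
  obtain \<rho> where \<rho>: "msize m \<rho> \<le> r" "\<And>k. \<rho> k \<le> fst p k" "P \<rho> (snd p)" using p unfolding \<Lambda>_def by blast
  obtain \<rho>' where \<rho>': "msize m \<rho>' \<le> r" "\<And>k. \<rho>' k \<le> fst q k" "P \<rho>' (snd q)" using q unfolding \<Lambda>_def by blast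
  have fp: "fst t k = fst p k + unitv i k" "fst t k = fst q k + unitv j k" "snd p = snd t" "snd q = snd t" for k
  proof -
    show "fst t k = fst p k + unitv i k" "snd p = snd t" by (simp_all add: p(2)[symmetric] shift_def madd_def)
    show "fst t k = fst q k + unitv j k" "snd q = snd t" by (simp_all add: q(2)[symmetric] shift_def madd_def)
  qed
  \<comment> \<open>The join of \<rho> and \<rho>' is too small to reach the size of
    \<open>t\<close>, so some coordinate \<open>l\<close> of \<open>t\<close> exceeds both and can
    be lowered without leaving either cone.\<close>
  have "msize m (\<lambda>k. max (\<rho> k) (\<rho>' k)) \<le> msize m \<rho> + msize m \<rho>'"
    unfolding msize_def sum.distrib[symmetric] by (rule sum_mono) simp
  then have "(\<Sum>k<m. max (\<rho> k) (\<rho>' k)) < (\<Sum>k<m. fst t k)" using \<rho>(1) \<rho>'(1) t(1) by (simp add: msize_def)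
  then obtain l where l: "l < m" "max (\<rho> l) (\<rho>' l) < fst t l"
    using sum_mono[of "{..<m}" "fst t" "\<lambda>k. max (\<rho> k) (\<rho>' k)"] by (force simp: not_le[symmetric])
  have dec_idx: "dec k x \<in> idx m n" if "x \<in> idx m n" for k x
    using that by (auto simp: dec_def idx_def mindex_def)
  have shift_dec: "shift k (dec k x) = x" if "0 < fst x k" for k x
    using that by (auto simp: shift_def dec_def madd_def unitv_def prod_eq_iff)
  have dec_shift: "dec k (shift k x) = x" for k x
    by (auto simp: shift_def dec_def madd_def unitv_def prod_eq_iff)
  have s: "dec l t \<in> \<Lambda>"
  proof -
    have "\<rho> k \<le> fst (dec l t) k" for k
      using \<rho>(2)[of k] fp(1)[of k] l(2) by (auto simp: dec_def)
    moreover have "snd (dec l t) = snd p" using fp(3) by (simp add: dec_def)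
    ultimately show ?thesis unfolding \<Lambda>_def using \<rho>(1,3) dec_idx[OF t(2), of l] by auto
  qed
  \<comment> \<open>For \<open>i = l\<close> the predecessor is itself \<open>t\<close> lowered at
    \<open>l\<close>. Otherwise it agrees with \<open>t\<close> at \<open>l\<close>, so it can be
    lowered there too, which gives the common predecessor.\<close>
  have connect: "(i = l \<and> p = dec l t) \<or> (\<exists>z\<in>\<Lambda>. p = shift l z \<and> dec l t = shift i z)"
    if p: "p \<in> idx m n" "shift i p = t" "msize m \<rho> \<le> r" "\<And>k. \<rho> k \<le> fst p k" "P \<rho> (snd p)" "\<rho> l < fst t l" for i p \<rho>
  proof (cases "i = l")
    case True
    then have "dec l t = p" using dec_shift[of l p] p(2) by simp
    then show ?thesis using True by simp
  next
    case False
    have fp: "fst t k = fst p k + unitv i k" "snd p = snd t" for k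
      by (simp_all add: p(2)[symmetric] shift_def madd_def)
    have pl: "\<rho> l < fst p l" using p(6) fp(1)[of l] False by (simp add: unitv_def)
    have "dec l p \<in> \<Lambda>"
    proof -
      have "\<rho> k \<le> fst (dec l p) k" for k using p(4)[of k] pl by (auto simp: dec_def)
      moreover have "snd (dec l p) = snd p" by (simp add: dec_def)
      ultimately show ?thesis unfolding \<Lambda>_def using p(3,5) dec_idx[OF p(1), of l] by auto
    qed
    moreover have "p = shift l (dec l p)" using shift_dec[of p l] pl by simp
    moreover have "dec l t = shift i (dec l p)"
      using fp pl False by (auto simp: dec_def shift_def madd_def unitv_def prod_eq_iff)
    ultimately show ?thesis by blast
  qed
  have pq: "p \<in> idx m n" "q \<in> idx m n" using p(1) q(1) unfolding \<Lambda>_def by auto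
  have "shift l (dec l t) = t" using shift_dec[of t l] l(2) by simp
  then show ?thesis
    using s l connect[OF pq(1) p(2) \<rho>(1) \<rho>(2) \<rho>(3)] connect[OF pq(2) q(2) \<rho>'(1) \<rho>'(2) \<rho>'(3)]
    by (intro exI[of _ l] conjI bexI[of _ "dec l t"]) auto
qed

section \<open>Separable leaders\<close>

lemma (in ring) upoly_deriv_eq: "upoly_deriv R p = normalize (deriv_list R p)"
proof -
  have "map (\<lambda>i. add_pow R (length p - 1 - i) (p ! i)) [0..<length p - 1] = deriv_list R p" for p
  proof (induction p)
    case (Cons c p)
    show ?case
    proof (cases p)
      case Nil
      then show ?thesis by simp
    next
      case (Cons c' p')
      have "[0..<length (c # p) - 1] = 0 # map Suc [0..<length p - 1]"
        using Cons by (simp add: upt_conv_Cons map_Suc_upt del: upt_Suc)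
      then show ?thesis using Cons Cons.IH by (simp add: o_def)
    qed
  qed simp
  then show ?thesis by (simp add: upoly_deriv_def)
qed

context field begin

text \<open>Evaluate the Bezout identity for the minimal polynomial and its derivative at the root:
  only the term with the derivative survives.\<close>

lemma separably_algebraic_imp_sep_root:
  assumes F: "subfield F R" and x: "x \<in> carrier R" and s: "separably_algebraic R F x"
  shows "sep_root R F x"
proof -
  note sr = subfieldE(1)[OF F]
  define p where "p = Irr F x"
  have alg: "(algebraic over F) x" using s by (simp add: separably_algebraic_def over_def)
  have p: "p \<in> carrier (F[X])" "eval p x = \<zero>"
    unfolding p_def using IrrE(1,4)[OF F x alg] by auto
  have pF: "set p \<subseteq> F" using p(1) by (auto simp: univ_poly_carrier[symmetric] polynomial_def)
  obtain u v where uv: "u \<in> carrier (F[X])" "v \<in> carrier (F[X])"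
    and e: "(u \<otimes>\<^bsub>F[X]\<^esub> p) \<oplus>\<^bsub>F[X]\<^esub> (v \<otimes>\<^bsub>F[X]\<^esub> upoly_deriv R p) = \<one>\<^bsub>F[X]\<^esub>"
    using s unfolding separably_algebraic_def separable_poly_def p_def by blast
  have dF: "set (deriv_list R p) \<subseteq> F" using subring_deriv_list[OF sr pF] .
  then have dR: "set (deriv_list R p) \<subseteq> carrier R" using subfieldE(3)[OF F] by blast
  have dp: "upoly_deriv R p \<in> carrier (F[X])"
    unfolding upoly_deriv_eq univ_poly_carrier[symmetric] using normalize_gives_polynomial[OF dF] .
  interpret h: ring_hom_ring "F[X]" R "\<lambda>p. eval p x" by (rule eval_ring_hom[OF sr x])
  have "eval u x \<otimes> eval p x \<oplus> eval v x \<otimes> eval (upoly_deriv R p) x = \<one>"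
    using arg_cong[OF e, of "\<lambda>p. eval p x"] uv p(1) dp by (simp add: h.hom_one[simplified])
  then have "eval v x \<otimes> eval (upoly_deriv R p) x = \<one>"
    using p(2) h.hom_closed[OF uv(1)] h.hom_closed[OF uv(2)] h.hom_closed[OF dp] by simp
  then have "eval (upoly_deriv R p) x \<noteq> \<zero>" using h.hom_closed[OF uv(2)] by auto
  then have "eval (deriv_list R p) x \<noteq> \<zero>" unfolding upoly_deriv_eq eval_normalize[OF dR x] .
  then show ?thesis using p(2) pF unfolding sep_root_def by blast
qed

text \<open>The minimal polynomial is X - x, with derivative 1. This turns membership in the field
  of the predecessors into being a leader.\<close>

lemma mem_imp_separably_algebraic:
  assumes F: "subfield F R" and x: "x \<in> F"
  shows "separably_algebraic R F x"
proof -
  note sr = subfieldE(1)[OF F]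
  interpret UP: domain "F[X]" by (rule univ_poly_is_domain[OF sr])
  have xc: "x \<in> carrier R" using x subfieldE(3)[OF F] by blast
  define p where "p = [\<one>, \<ominus> x]"
  have p: "p \<in> carrier (F[X])"
    using x subringE(3,5)[OF sr] by (auto simp: p_def univ_poly_carrier[symmetric] polynomial_def)
  have ev: "eval p x = \<zero>" using xc by (simp add: p_def r_neg)
  have alg: "(algebraic over F) x" using algebraicI[OF p _ ev] by (simp add: p_def)
  have "pirreducible F p" by (rule degree_one_imp_pirreducible[OF F p]) (simp add: p_def)
  then have "p \<in> carrier (F[X]) \<and> pirreducible F p \<and> eval p x = \<zero> \<and> lead_coeff p = \<one>"
    using p ev by (simp add: p_def)
  then have irr: "Irr F x = p"
    unfolding Irr_def by (rule the1_equality[OF minimal_polynomial_is_unique[OF F xc alg]])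
  have "upoly_deriv R p = \<one>\<^bsub>F[X]\<^esub>" unfolding upoly_deriv_eq p_def univ_poly_one by simp
  then have "\<zero>\<^bsub>F[X]\<^esub> \<otimes>\<^bsub>F[X]\<^esub> p \<oplus>\<^bsub>F[X]\<^esub> \<one>\<^bsub>F[X]\<^esub> \<otimes>\<^bsub>F[X]\<^esub> upoly_deriv R p = \<one>\<^bsub>F[X]\<^esub>"
    using p UP.l_null[OF p] by simp
  then have "separable_poly R F p" unfolding separable_poly_def using UP.zero_closed UP.one_closed by blast
  then show ?thesis using alg irr by (simp add: separably_algebraic_def over_def)
qed

lemma eval_in_subspace:
  assumes E: "subfield E R" and V: "V \<subseteq> carrier R" "\<zero> \<in> V"
      "\<And>u v. u \<in> V \<Longrightarrow> v \<in> V \<Longrightarrow> u \<oplus> v \<in> V" "\<And>c v. c \<in> E \<Longrightarrow> v \<in> V \<Longrightarrow> c \<otimes> v \<in> V"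
    and p: "set p \<subseteq> V" and x: "x \<in> E"
  shows "eval p x \<in> V"
  using p
proof (induction p)
  case (Cons c p)
  have "x [^] n \<in> E" for n :: nat
    using x subringE[OF subfieldE(1)[OF E]] by (induction n) auto
  moreover have "x [^] length p \<in> carrier R" using x subfieldE(3)[OF E] by auto
  ultimately have "c \<otimes> x [^] length p \<in> V"
    using Cons.prems V m_comm[of c "x [^] length p"] by auto
  then show ?case using Cons V by simp
qed (simp add: V)

end

section \<open>The enumerated generators and their leaders\<close>

locale diff_kernel = field L for L (structure) +
  fixes K :: "'a set" and der :: "nat \<Rightarrow> 'a \<Rightarrow> 'a" and m r n :: nat
    and a :: "(nat \<Rightarrow> nat) \<times> nat \<Rightarrow> 'a" and en :: "nat \<Rightarrow> (nat \<Rightarrow> nat) \<times> nat"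
  assumes pos: "0 < m" "0 < r" "0 < n"
    and K: "subfield K L" and der: "comm_derivations L K m der"
    and a_mem: "\<And>\<xi> h. mindex m \<xi> \<Longrightarrow> msize m \<xi> \<le> 2 * r \<Longrightarrow> h < n \<Longrightarrow> a (\<xi>, h) \<in> carrier L"
    and diff_cond: "diff_condition L K der m r n a"
    and min_leader: "\<And>\<sigma> k. mindex m \<sigma> \<Longrightarrow> msize m \<sigma> \<le> 2 * r \<Longrightarrow> k < n \<Longrightarrow>
           min_sep_leader L K m r n a \<sigma> k \<Longrightarrow> msize m \<sigma> \<le> r"
    and en_bij: "bij_betw en UNIV (idx m n)"
    and en_less: "\<And>x y. olt m (en x) (en y) \<longleftrightarrow> x < y"
begin

definition sz :: "nat \<Rightarrow> nat" where "sz x = msize m (fst (en x))"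
definition sh :: "nat \<Rightarrow> nat \<Rightarrow> nat" where "sh i x = inv_into UNIV en (shift i (en x))"
definition b :: "nat \<Rightarrow> 'a" where "b x = a (en x)"
definition N :: "nat \<Rightarrow> nat" where "N s = (LEAST x. s \<le> sz x)"
definition F :: "nat \<Rightarrow> 'a set" where "F x = generate_field L (K \<union> b ` {..<x})"
definition sep :: "nat \<Rightarrow> bool" where "sep x \<longleftrightarrow> sep_leader L K m n a (fst (en x)) (snd (en x))"
text \<open>Up to size \<open>2 * r\<close> these are the numbers of the separable leaders, by
  \<open>Lam_imp_sep\<close> and \<open>sep_imp_Lam\<close>. Lying above a leader of size at most
  \<open>r\<close> also makes sense for larger indices, where no generators are given.\<close>

definition Lam :: "nat set" where
  "Lam = {x. \<exists>\<rho>. msize m \<rho> \<le> r \<and> (\<forall>j. \<rho> j \<le> fst (en x) j) \<and> sep_leader L K m n a \<rho> (snd (en x))}"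

lemma en_idx: "en x \<in> idx m n"
  using en_bij by (auto simp: bij_betw_def)

lemma en_inj: "en x = en y \<Longrightarrow> x = y"
  using en_bij by (auto simp: bij_betw_def inj_on_def)

lemma en_surj: "p \<in> idx m n \<Longrightarrow> \<exists>x. en x = p"
  using en_bij by (auto simp: bij_betw_def image_iff) (metis rangeE)

lemma en_sh: "i < m \<Longrightarrow> en (sh i x) = shift i (en x)"
  unfolding sh_def using shift_idx[OF _ en_idx] en_bij by (intro f_inv_into_f) (auto simp: bij_betw_def)

lemma sz_sh: "i < m \<Longrightarrow> sz (sh i x) = Suc (sz x)"
  by (simp add: sz_def en_sh msize_shift)

lemma sz_mono: "x \<le> y \<Longrightarrow> sz x \<le> sz y"
  using en_less[of x y] olt_msize[of m "en x" "en y"] by (cases "x = y") (auto simp: sz_def)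

lemma sh_mono: "i < m \<Longrightarrow> x < y \<Longrightarrow> sh i x < sh i y"
  using olt_shift[of m "en x" "en y" i] en_less by (simp add: en_sh[symmetric])

lemma sh_gt: "i < m \<Longrightarrow> x < sh i x"
  using sz_sh[of i x] sz_mono[of "sh i x" x] by (cases "x < sh i x") auto

lemma sh_comm: "i < m \<Longrightarrow> j < m \<Longrightarrow> sh i (sh j x) = sh j (sh i x)"
  by (intro en_inj) (simp add: en_sh shift_comm)

lemma less_N_iff: "x < N s \<longleftrightarrow> sz x < s"
proof -
  obtain y where "en y = (\<lambda>j. if j = 0 then s else 0, 0)" using en_surj[OF top_idx[OF pos(1,3)]] by blast
  then have "s \<le> sz y" using msize_top[OF pos(1)] by (simp add: sz_def)
  then have "s \<le> sz (N s)" unfolding N_def by (rule LeastI)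
  moreover have "sz x < s" if "x < N s" using not_less_Least[OF that[unfolded N_def]] by simp
  ultimately show ?thesis using sz_mono[of "N s" x] by (meson le_trans not_le)
qed

lemma b_carrier: "sz x \<le> 2 * r \<Longrightarrow> b x \<in> carrier L"
  using a_mem[of "fst (en x)" "snd (en x)"] en_idx[of x] by (auto simp: b_def sz_def idx_def)

lemma K_carrier: "K \<subseteq> carrier L"
  using subfieldE(3)[OF K] .

lemma F_gens: "x \<le> N (Suc (2 * r)) \<Longrightarrow> K \<union> b ` {..<x} \<subseteq> carrier L"
proof (rule Un_least[OF K_carrier], rule image_subsetI)
  fix y assume "x \<le> N (Suc (2 * r))" "y \<in> {..<x}"
  then have "y < N (Suc (2 * r))" by simp
  then have "sz y \<le> 2 * r" using less_N_iff[of y "Suc (2 * r)"] by simp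
  then show "b y \<in> carrier L" by (rule b_carrier)
qed

lemma F_subfield: "x \<le> N (Suc (2 * r)) \<Longrightarrow> subfield (F x) L"
  unfolding F_def using generate_field_is_subfield[OF F_gens] .

lemma F_mono: "x \<le> y \<Longrightarrow> y \<le> N (Suc (2 * r)) \<Longrightarrow> F x \<subseteq> F y"
  unfolding F_def using F_gens by (intro mono_generate_field) auto

lemma F_mem: "x < y \<Longrightarrow> b x \<in> F y" "c \<in> K \<Longrightarrow> c \<in> F y"
  unfolding F_def by (auto intro: generate_field.incl)

lemma sep_iff: "sep x \<longleftrightarrow> separably_algebraic L (F x) (b x)"
proof -
  have "idx_lt m n (fst (en x)) (snd (en x)) = en ` {..<x}"
  proof
    show "en ` {..<x} \<subseteq> idx_lt m n (fst (en x)) (snd (en x))"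
    proof (rule image_subsetI)
      fix y assume "y \<in> {..<x}"
      then have "olt m (en y) (en x)" using en_less by simp
      then show "en y \<in> idx_lt m n (fst (en x)) (snd (en x))"
        using en_idx[of y] by (auto simp: idx_lt_def idx_def)
    qed
    show "idx_lt m n (fst (en x)) (snd (en x)) \<subseteq> en ` {..<x}"
    proof
      fix p assume p: "p \<in> idx_lt m n (fst (en x)) (snd (en x))"
      then have "p \<in> idx m n" and o: "olt m p (en x)" by (auto simp: idx_lt_def idx_def)
      then obtain y where y: "en y = p" using en_surj by blast
      then have "y < x" using o en_less[of y x] by simp
      then show "p \<in> en ` {..<x}" using y by blast
    qed
  qed
  then show ?thesis by (simp add: sep_def sep_leader_def F_def b_def image_image)
qed

lemma sep_sep_root: "sep x \<Longrightarrow> sz x \<le> 2 * r \<Longrightarrow> sep_root L (F x) (b x)"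
  using separably_algebraic_imp_sep_root[OF F_subfield b_carrier] sep_iff less_N_iff[of x "Suc (2 * r)"] by simp

lemma mem_F_sep: "b x \<in> F x \<Longrightarrow> sz x \<le> 2 * r \<Longrightarrow> sep x"
  using mem_imp_separably_algebraic[OF F_subfield] sep_iff less_N_iff[of x "Suc (2 * r)"] by simp

definition S :: "nat \<Rightarrow> nat \<Rightarrow> ('a \<times> 'a) set" where
  "S i s = {(c, der i c) | c. c \<in> K} \<union> {(b x, b (sh i x)) | x. x < s}"

lemma derivation: "i < m \<Longrightarrow> derivation L K (der i)"
  using der by (simp add: comm_derivations_def)

lemma der_K: "i < m \<Longrightarrow> c \<in> K \<Longrightarrow> der i c \<in> K"
  using derivation by (simp add: derivation_def)

lemma S_carrier:
  assumes i: "i < m" and s: "s \<le> N (2 * r)"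
  shows "S i s \<subseteq> carrier L \<times> carrier L"
proof -
  have "b x \<in> carrier L \<and> b (sh i x) \<in> carrier L" if "x < s" for x
  proof -
    have "sz x < 2 * r" using that s less_N_iff[of x "2 * r"] by simp
    then show ?thesis using b_carrier[of x] b_carrier[of "sh i x"] sz_sh[OF i] by simp
  qed
  then show ?thesis unfolding S_def using K_carrier der_K[OF i] by auto
qed

lemma S_fst: "i < m \<Longrightarrow> s \<le> N (2 * r) \<Longrightarrow> fst ` dcl L (S i s) = F s"
proof -
  assume "i < m" "s \<le> N (2 * r)"
  have "fst ` S i s = K \<union> b ` {..<s}" unfolding S_def by force
  then show ?thesis using dcl_fst[OF S_carrier] \<open>i < m\<close> \<open>s \<le> N (2 * r)\<close> by (simp add: F_def)
qed

lemma S_fnl: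
  assumes i: "i < m"
  shows "fnl L (dcl L (S i (N (2 * r))))"
proof -
  define V where "V = {p \<in> idx m n. msize m (fst p) < 2 * r}"
  \<comment> \<open>The last index of size \<open>2 * r - 1\<close>; its instance of the
    differential condition covers all generators of size less than \<open>2 * r\<close> at
    once.\<close>
  define \<sigma> where "\<sigma> = (\<lambda>j::nat. if j = 0 then 2 * r - 1 else 0)"
  have V: "V = idx_le m n \<sigma> (n - 1)"
    unfolding V_def \<sigma>_def using idx_le_top[of m n "2 * r"] pos by simp
  have \<sigma>: "mindex m \<sigma>" "msize m \<sigma> + 1 \<le> 2 * r" "n - 1 < n"
    using top_idx[of m "n - 1" n "2 * r - 1"] msize_top[of m "2 * r - 1"] pos by (auto simp: \<sigma>_def idx_def)
  have fin: "finite V" unfolding V_def by (rule finite_subset[OF _ finite_msize[of m n "2 * r"]]) auto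
  have V_en: "V = en ` {..<N (2 * r)}"
  proof
    show "en ` {..<N (2 * r)} \<subseteq> V" using en_idx less_N_iff[of _ "2 * r"] by (auto simp: V_def sz_def)
    show "V \<subseteq> en ` {..<N (2 * r)}"
    proof
      fix p assume p: "p \<in> V"
      then obtain x where "en x = p" using en_surj[of p] by (auto simp: V_def)
      then show "p \<in> en ` {..<N (2 * r)}" using p less_N_iff[of x "2 * r"] by (auto simp: V_def sz_def)
    qed
  qed
  have mem: "a v \<in> carrier L" "a (shift i v) \<in> carrier L" if "v \<in> V" for v
  proof -
    obtain x where x: "v = en x" "x < N (2 * r)" using \<open>v \<in> V\<close> V_en by auto
    then have "sz x < 2 * r" using less_N_iff by simp
    then show "a v \<in> carrier L" "a (shift i v) \<in> carrier L"
      using b_carrier[of x] b_carrier[of "sh i x"] sz_sh[OF i, of x] en_sh[OF i, of x] x by (simp_all add: b_def)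
  qed
  have "fnl L (dcl L ({(c, der i c) | c. c \<in> K} \<union> {(a v, a (shift i v)) | v. v \<in> V}))"
  proof (rule polynomial_relations_fnl[OF K derivation[OF i] fin mem refl refl])
    fix f assume f: "mpoly_over L K V f" "mpoly_eval L a f = \<zero>"
    have "finsum L (\<lambda>(\<eta>, g). mpoly_pderiv_eval L a f (\<eta>, g) \<otimes> a (madd \<eta> (unitv i), g)) (idx_le m n \<sigma> (n - 1))
        \<oplus> mpoly_coeffderiv_eval L (der i) a f = \<zero>"
      using diff_cond f \<sigma> i unfolding diff_condition_def V by blast
    then show "finsum L (\<lambda>v. mpoly_pderiv_eval L a f v \<otimes> a (shift i v)) V \<oplus> mpoly_coeffderiv_eval L (der i) a f = \<zero>"
      unfolding V by (simp add: shift_def split_def)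
  qed
  moreover have "{(a v, a (shift i v)) | v. v \<in> V} = {(b x, b (sh i x)) | x. x < N (2 * r)}"
    unfolding V_en b_def en_sh[OF i] by (simp only: image_iff lessThan_iff Bex_def) blast
  ultimately show ?thesis unfolding S_def by simp
qed

text \<open>Differentiating a separable equation for \<open>b x\<close> expresses \<open>b (sh i x)\<close> linearly in terms of
  the derivatives of the coefficients.\<close>

lemma derivative_in_subspace:
  assumes x: "x < N (2 * r)" and i: "i < m" and sr: "sep_root L (F x) (b x)"
    and E: "subfield E L" "F (Suc x) \<subseteq> E"
    and V: "V \<subseteq> carrier L" "\<zero> \<in> V" "\<And>u v. u \<in> V \<Longrightarrow> v \<in> V \<Longrightarrow> u \<oplus> v \<in> V"
      "\<And>c v. c \<in> E \<Longrightarrow> v \<in> V \<Longrightarrow> c \<otimes> v \<in> V"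
    and KV: "K \<subseteq> V" and bV: "\<And>z. z < x \<Longrightarrow> b (sh i z) \<in> V"
  shows "b (sh i x) \<in> V"
proof -
  have N: "N (2 * r) \<le> N (Suc (2 * r))"
    using less_N_iff[of "N (Suc (2 * r))" "2 * r"] less_N_iff[of "N (Suc (2 * r))" "Suc (2 * r)"] by linarith
  have bx: "b x \<in> E" using E F_mem(1)[of x "Suc x"] by auto
  have FxE: "F x \<subseteq> E" using E F_mono[of x "Suc x"] x N by auto
  obtain p where p: "set p \<subseteq> F x" "eval p (b x) = \<zero>" "eval (deriv_list L p) (b x) \<noteq> \<zero>"
    using sr unfolding sep_root_def by blast
  obtain zs where zs: "set zs \<subseteq> dcl L (S i x)" "map fst zs = p"
    using lift_list[of p "dcl L (S i x)"] p(1) S_fst[OF i, of x] x by auto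
  have "u \<in> E \<and> v \<in> V" if "(u, v) \<in> S i x" for u v
    using that FxE F_mem[of _ x] KV der_K[OF i] bV unfolding S_def by auto
  then have SE: "fst ` S i x \<subseteq> E" and SV: "snd ` S i x \<subseteq> V" by force+
  have Sx: "S i x \<subseteq> carrier L \<times> carrier L" using S_carrier[OF i] x by simp
  have "snd z \<in> V" if "z \<in> dcl L (S i x)" for z
    using dcl_snd[OF Sx E(1) SE SV V that] by blast
  then have sV: "set (map snd zs) \<subseteq> V" using zs by auto
  \<comment> \<open>The lifted coefficients come from the closure up to \<open>x\<close>, but the
    relation has to be read in a single-valued closure that also contains the pair of
    \<open>b x\<close>.\<close>
  have sub: "S i x \<subseteq> S i (N (2 * r))" using x unfolding S_def by fastforce
  have "eval (map snd zs) (b x) \<oplus> eval (deriv_list L (map fst zs)) (b x) \<otimes> b (sh i x) = \<zero>"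
  proof (rule fnl_relation[OF S_carrier[OF i] S_fnl[OF i]])
    show "set zs \<subseteq> dcl L (S i (N (2 * r)))" using zs(1) dcl_mono[OF sub] by blast
    show "(b x, b (sh i x)) \<in> dcl L (S i (N (2 * r)))" using x by (intro dcl.incl) (auto simp: S_def)
  qed (use p zs in simp_all)
  then have rel: "eval (map snd zs) (b x) \<oplus> eval (deriv_list L p) (b x) \<otimes> b (sh i x) = \<zero>" using zs by simp
  define e where "e = eval (deriv_list L p) (b x)"
  define s where "s = eval (map snd zs) (b x)"
  have sV': "s \<in> V" unfolding s_def by (rule eval_in_subspace[OF E(1) V sV bx])
  have eE: "e \<in> E" unfolding e_def
    using subring_eval[OF subfieldE(1)[OF E(1)] _ bx] subring_deriv_list[OF subfieldE(1)[OF E(1)]] p(1) FxE by blast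
  have c: "s \<in> carrier L" "e \<in> carrier L" "b (sh i x) \<in> carrier L"
  proof -
    have "sz x < 2 * r" using x less_N_iff by simp
    then show "b (sh i x) \<in> carrier L" using b_carrier[of "sh i x"] sz_sh[OF i] by simp
  qed (use sV' V(1) eE subfieldE(3)[OF E(1)] in auto)
  have e0: "e \<noteq> \<zero>" using p by (simp add: e_def)
  then have i1: "inv e \<in> E" "inv e \<in> carrier L" "inv e \<otimes> e = \<one>"
    using subfield_m_inv(1,3)[OF E(1), of e] eE subfieldE(3)[OF E(1)] by auto
  have "b (sh i x) = inv e \<otimes> (s \<oplus> e \<otimes> b (sh i x)) \<oplus> (\<ominus> (inv e)) \<otimes> s"
  proof -
    have "inv e \<otimes> (s \<oplus> e \<otimes> b (sh i x)) \<oplus> (\<ominus> (inv e)) \<otimes> s = (inv e \<otimes> e) \<otimes> b (sh i x)"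
      using c i1(2) by algebra
    then show ?thesis using i1 c by simp
  qed
  also have "\<dots> = (\<ominus> (inv e)) \<otimes> s" using rel c i1 unfolding e_def[symmetric] s_def[symmetric] by simp
  finally show ?thesis using V(4)[OF _ sV'] subringE(5)[OF subfieldE(1)[OF E(1)] i1(1)] by simp
qed

lemma N_mono: "s \<le> s' \<Longrightarrow> N s \<le> N s'"
  using less_N_iff[of "N s'" s] less_N_iff[of "N s'" s'] by linarith

lemma sh_less_N: "i < m \<Longrightarrow> x < N (2 * r) \<Longrightarrow> sh i x < N (Suc (2 * r))"
  using less_N_iff sz_sh by simp

text \<open>For \<open>z < x\<close> the shift of \<open>z\<close> precedes that of
  \<open>x\<close>. So the field of the predecessors of \<open>sh i x\<close> contains everything
  that enters the linear equation for \<open>b (sh i x)\<close>, and it can itself serve as the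
  space \<open>V\<close>.\<close>

lemma sep_sh:
  assumes "sep x" "sz x < 2 * r" "i < m"
  shows "b (sh i x) \<in> F (sh i x)"
proof -
  have x: "x < N (2 * r)" using assms less_N_iff by simp
  have le: "sh i x \<le> N (Suc (2 * r))" using sh_less_N[OF assms(3) x] by simp
  note sub = F_subfield[OF le]
  note cl = subringE[OF subfieldE(1)[OF sub]]
  have lt: "x < sh i x" using sh_gt assms by simp
  show ?thesis
  proof (rule derivative_in_subspace[OF x assms(3) sep_sep_root[OF assms(1)] F_subfield F_mono, where V = "F (sh i x)"])
    show "F (sh i x) \<subseteq> carrier L" using subfieldE(3)[OF sub] .
    show "c \<otimes> v \<in> F (sh i x)" if "c \<in> F (Suc x)" "v \<in> F (sh i x)" for c v
      using that F_mono[of "Suc x" "sh i x"] lt le cl(6) by auto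
    show "b (sh i z) \<in> F (sh i x)" if "z < x" for z using F_mem(1) sh_mono[OF assms(3) that] by simp
  qed (use assms lt le cl F_mem in auto)
qed

lemma sep_sh_sep: "sep x \<Longrightarrow> sz x < 2 * r \<Longrightarrow> i < m \<Longrightarrow> sep (sh i x)"
  using mem_F_sep[OF sep_sh] sz_sh by simp

text \<open>A path from \<rho> to \<tau> raises one coordinate at a time, and each step is covered
  by \<open>sep_sh_sep\<close>.\<close>

lemma sep_leader_upward:
  assumes \<rho>: "sep_leader L K m n a \<rho> k" "k < n"
  shows "mindex m \<tau> \<Longrightarrow> (\<And>j. \<rho> j \<le> \<tau> j) \<Longrightarrow> msize m \<tau> \<le> 2 * r \<Longrightarrow> sep_leader L K m n a \<tau> k"
proof (induction "msize m \<tau>" arbitrary: \<tau> rule: less_induct)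
  case less
  show ?case
  proof (cases "\<tau> = \<rho>")
    case True
    then show ?thesis using \<rho> by simp
  next
    case False
    then obtain j where j: "\<rho> j < \<tau> j" using less.prems(2) by (metis ext le_neq_implies_less)
    have jm: "j < m" using j less.prems(1) by (metis mindex_def not_le not_less_zero)
    define \<tau>' where "\<tau>' = \<tau>(j := \<tau> j - 1)"
    have m': "mindex m \<tau>'" using less.prems(1) by (auto simp: \<tau>'_def mindex_def)
    have le': "\<rho> i \<le> \<tau>' i" for i using less.prems(2)[of i] j by (auto simp: \<tau>'_def)
    obtain x where x: "en x = (\<tau>', k)" using en_surj[of "(\<tau>', k)"] m' \<rho>(2) by (auto simp: idx_def)
    have t: "shift j (en x) = (\<tau>, k)"
      using j by (auto simp: x shift_def madd_def \<tau>'_def unitv_def)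
    have sz: "msize m \<tau> = Suc (msize m \<tau>')" using msize_shift[OF jm, of "en x"] x t by simp
    have "sep_leader L K m n a \<tau>' k" using less.hyps[of \<tau>'] m' le' sz less.prems(3) by simp
    then have "sep x" "sz x < 2 * r" using x sz less.prems(3) by (simp_all add: sep_def sz_def)
    then have "sep (sh j x)" using sep_sh_sep jm by blast
    then show ?thesis using en_sh[OF jm, of x] t by (simp add: sep_def)
  qed
qed

lemma Lam_imp_sep: "x \<in> Lam \<Longrightarrow> sz x \<le> 2 * r \<Longrightarrow> sep x"
  using sep_leader_upward[of _ "snd (en x)" "fst (en x)"] en_idx[of x]
  unfolding Lam_def sep_def sz_def idx_def by auto

text \<open>A leader of least size below the given one is a minimal leader, and the hypothesis on
  minimal leaders bounds its size by \<open>r\<close>.\<close>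

lemma sep_imp_Lam:
  assumes "sep x" "sz x \<le> 2 * r"
  shows "x \<in> Lam"
proof -
  obtain \<tau> k where x: "en x = (\<tau>, k)" by force
  have \<tau>: "mindex m \<tau>" "k < n" using en_idx[of x] x by (auto simp: idx_def)
  define Q where "Q \<rho> \<longleftrightarrow> mindex m \<rho> \<and> (\<forall>j. \<rho> j \<le> \<tau> j) \<and> sep_leader L K m n a \<rho> k" for \<rho>
  have "Q \<tau>" using assms(1) x \<tau> by (simp add: Q_def sep_def)
  then obtain \<rho> where \<rho>: "Q \<rho>" "\<And>\<rho>'. Q \<rho>' \<Longrightarrow> msize m \<rho> \<le> msize m \<rho>'"
    using ex_has_least_nat[of Q \<tau> "msize m"] by blast
  have small: "msize m \<rho> \<le> 2 * r" using \<rho>(2)[OF \<open>Q \<tau>\<close>] assms(2) x by (simp add: sz_def)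
  have "min_sep_leader L K m r n a \<rho> k"
    unfolding min_sep_leader_def
  proof (intro conjI notI)
    show "sep_leader L K m n a \<rho> k" using \<rho>(1) by (simp add: Q_def)
    assume "\<exists>\<rho>'. mindex m \<rho>' \<and> msize m \<rho>' \<le> 2 * r \<and> (\<forall>i. \<rho>' i \<le> \<rho> i) \<and> \<rho>' \<noteq> \<rho> \<and> sep_leader L K m n a \<rho>' k"
    then obtain \<rho>' where h: "mindex m \<rho>'" "\<And>i. \<rho>' i \<le> \<rho> i" "\<rho>' \<noteq> \<rho>" "sep_leader L K m n a \<rho>' k" by blast
    have "Q \<rho>'" using h \<rho>(1) le_trans unfolding Q_def by blast
    then have le: "msize m \<rho> \<le> msize m \<rho>'" by (rule \<rho>(2))
    obtain j where j: "\<rho>' j < \<rho> j" using h(2,3) by (metis ext le_neq_implies_less)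
    have "j < m" using j \<rho>(1) unfolding Q_def by (metis mindex_def not_le not_less_zero)
    then have "msize m \<rho>' < msize m \<rho>"
      unfolding msize_def using h(2) j by (intro sum_strict_mono_ex1) auto
    then show False using le by simp
  qed
  then have "msize m \<rho> \<le> r" using min_leader \<rho>(1) small \<tau> unfolding Q_def by blast
  then show ?thesis using \<rho>(1) x unfolding Lam_def Q_def by auto
qed

lemma Lam_sh: "i < m \<Longrightarrow> x \<in> Lam \<Longrightarrow> sh i x \<in> Lam"
proof -
  assume i: "i < m" and "x \<in> Lam"
  then obtain \<rho> where \<rho>: "msize m \<rho> \<le> r" "\<And>j. \<rho> j \<le> fst (en x) j" "sep_leader L K m n a \<rho> (snd (en x))"
    unfolding Lam_def by blast
  have "\<rho> j \<le> fst (en (sh i x)) j" for j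
    using \<rho>(2)[of j] by (simp add: en_sh[OF i] shift_def madd_def)
  moreover have "snd (en (sh i x)) = snd (en x)" by (simp add: en_sh[OF i] shift_def)
  ultimately show ?thesis using \<rho>(1,3) unfolding Lam_def by auto
qed

text \<open>Since \<rho> has smaller size than the index, some coordinate can be lowered without
  leaving the cone above \<rho>.\<close>

lemma Lam_pred:
  assumes "y \<in> Lam" "r < sz y"
  shows "\<exists>i<m. \<exists>p\<in>Lam. sh i p = y"
proof -
  obtain \<rho> where \<rho>: "msize m \<rho> \<le> r" "\<And>j. \<rho> j \<le> fst (en y) j" "sep_leader L K m n a \<rho> (snd (en y))"
    using assms(1) unfolding Lam_def by blast
  have "(\<Sum>j<m. \<rho> j) < (\<Sum>j<m. fst (en y) j)" using \<rho>(1) assms(2) by (simp add: msize_def sz_def)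
  then obtain i where i: "i < m" "\<rho> i < fst (en y) i"
    using sum_mono[of "{..<m}" "fst (en y)" \<rho>] by (force simp: not_le[symmetric])
  define p where "p = ((fst (en y))(i := fst (en y) i - 1), snd (en y))"
  have "p \<in> idx m n" using en_idx[of y] by (auto simp: p_def idx_def mindex_def)
  then obtain x where x: "en x = p" using en_surj by blast
  have "shift i p = en y" using i(2) by (auto simp: p_def shift_def madd_def unitv_def prod_eq_iff)
  then have "sh i x = y" using en_sh[OF i(1), of x] x by (intro en_inj) simp
  moreover have "x \<in> Lam"
  proof -
    have "\<rho> j \<le> fst (en x) j" for j using \<rho>(2)[of j] i(2) by (auto simp: x p_def)
    moreover have "snd (en x) = snd (en y)" by (simp add: x p_def)
    ultimately show ?thesis using \<rho>(1,3) unfolding Lam_def by auto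
  qed
  ultimately show ?thesis using i(1) by blast
qed

lemma Lam_confluence:
  assumes y: "N (Suc (2 * r)) \<le> y" and i: "i < m" and j: "j < m" and p: "p \<in> Lam" "sh i p = y"
    and q: "q \<in> Lam" "sh j q = y"
  shows "\<exists>l<m. \<exists>s\<in>Lam. sh l s = y \<and>
        ((i = l \<and> p = s) \<or> (\<exists>z\<in>Lam. p = sh l z \<and> s = sh i z)) \<and>
        ((j = l \<and> q = s) \<or> (\<exists>z\<in>Lam. q = sh l z \<and> s = sh j z))"
proof -
  define P where "P \<rho> k = sep_leader L K m n a \<rho> k" for \<rho> k
  define \<Lambda> where "\<Lambda> = {p \<in> idx m n. \<exists>\<rho>. msize m \<rho> \<le> r \<and> (\<forall>j. \<rho> j \<le> fst p j) \<and> P \<rho> (snd p)}"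
  have Lam_iff: "en x \<in> \<Lambda> \<longleftrightarrow> x \<in> Lam" for x
    using en_idx[of x] by (simp add: \<Lambda>_def Lam_def P_def)
  have sh_iff: "shift l (en x) = en z \<longleftrightarrow> sh l x = z" if "l < m" for l x z
    using en_sh[OF that, of x] en_inj by metis
  have "2 * r < msize m (fst (en y))" using y less_N_iff[of y "Suc (2 * r)"] by (simp add: sz_def)
  moreover have "en p \<in> \<Lambda>" "en q \<in> \<Lambda>" using p(1) q(1) Lam_iff by simp_all
  moreover have "shift i (en p) = en y" "shift j (en q) = en y" using sh_iff i j p(2) q(2) by simp_all
  ultimately obtain l s where l: "l < m" "s \<in> \<Lambda>" "shift l s = en y"
      "(i = l \<and> en p = s) \<or> (\<exists>z\<in>\<Lambda>. en p = shift l z \<and> s = shift i z)"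
      "(j = l \<and> en q = s) \<or> (\<exists>z\<in>\<Lambda>. en q = shift l z \<and> s = shift j z)"
    using leader_confluence[where P = P and n = n and r = r and m = m, folded \<Lambda>_def, OF _ en_idx _ _ i _ _ j]
    by metis
  have lift: "\<exists>x. z = en x \<and> x \<in> Lam" if "z \<in> \<Lambda>" for z
  proof -
    have "z \<in> idx m n" using that by (simp add: \<Lambda>_def)
    then show ?thesis using en_surj that Lam_iff by metis
  qed
  obtain s' where s': "s = en s'" "s' \<in> Lam" using lift[OF l(2)] by blast
  have tr: "(i = l \<and> p = s') \<or> (\<exists>z\<in>Lam. p = sh l z \<and> s' = sh i z)"
    if im: "i < m" and h: "(i = l \<and> en p = s) \<or> (\<exists>z\<in>\<Lambda>. en p = shift l z \<and> s = shift i z)" for i p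
    using h
  proof
    assume "i = l \<and> en p = s"
    then show ?thesis using s' en_inj by blast
  next
    assume "\<exists>z\<in>\<Lambda>. en p = shift l z \<and> s = shift i z"
    then obtain z where "en p = shift l (en z)" "en s' = shift i (en z)" "z \<in> Lam" using lift s' by metis
    then show ?thesis using sh_iff[OF im] sh_iff[OF l(1)] by metis
  qed
  show ?thesis using l(1) s'(2) l(3)[unfolded s'(1) sh_iff[OF l(1)]] tr[OF i l(4)] tr[OF j l(5)] by blast
qed

end

section \<open>The generators of size \<open>2 * r\<close>\<close>

locale kernel_tower = diff_kernel L K der m r n a en + W: field W
  for L (structure) and K der m r n a en and W :: "'c ring" +
  fixes \<iota> :: "'a \<Rightarrow> 'c" and A :: "nat \<Rightarrow> 'c set" and t :: "nat \<Rightarrow> 'c"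
  assumes hom: "\<iota> \<in> ring_hom L W" and inj: "inj_on \<iota> (carrier L)" and A0: "\<iota> ` carrier L \<subseteq> A 0"
    and A: "\<And>s. subfield (A s) W" "\<And>s. A s \<subseteq> A (Suc s)"
    and t: "\<And>s. t s \<in> A (Suc s)" "\<And>s. transc W (A s) (t s)"
begin

interpretation h: ring_hom_ring L W \<iota>
  by (rule ring_hom_ringI2[OF ring_axioms W.ring_axioms hom])

lemma t_carrier: "t s \<in> carrier W"
  using t(1) subfieldE(3)[OF A(1)] by blast

lemma hom_generate_field:
  assumes "H \<subseteq> carrier L" "x \<in> generate_field L H"
  shows "\<iota> x \<in> generate_field W (\<iota> ` H)"
  using assms(2)
proof (induction rule: generate_field.induct)
  case (m_inv x)
  have x: "x \<in> carrier L" using generate_field_in_carrier[OF assms(1)] m_inv by blast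
  then have i: "inv x \<in> carrier L" "x \<otimes> inv x = \<one>" using m_inv field_Units by auto
  then have "\<iota> x \<otimes>\<^bsub>W\<^esub> \<iota> (inv x) = \<one>\<^bsub>W\<^esub>" using x by (simp flip: h.hom_mult)
  then have "inv\<^bsub>W\<^esub> (\<iota> x) = \<iota> (inv x)" using W.comm_inv_char x i by simp
  moreover have "\<iota> x \<noteq> \<zero>\<^bsub>W\<^esub>" using \<open>\<iota> x \<otimes>\<^bsub>W\<^esub> \<iota> (inv x) = \<one>\<^bsub>W\<^esub>\<close> i by auto
  ultimately show ?case using generate_field.m_inv[OF m_inv.IH] by simp
next
  case (eng_add x y)
  then show ?case using generate_field_in_carrier[OF assms(1)] generate_field.eng_add by (metis h.hom_add)
next
  case (eng_mult x y)
  then show ?case using generate_field_in_carrier[OF assms(1)] generate_field.eng_mult by (metis h.hom_mult)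
next
  case (a_inv x)
  then show ?case using generate_field_in_carrier[OF assms(1)] generate_field.a_inv by (metis h.hom_a_inv)
next
  case (incl x)
  then show ?case by (simp add: generate_field.incl)
next
  case one
  show ?case using generate_field.one by (metis h.hom_one)
qed

abbreviation "N0 \<equiv> N (2 * r)"
abbreviation "N1 \<equiv> N (Suc (2 * r))"

lemma N01: "N0 \<le> N1"
  by (rule N_mono) simp

lemma F0_subfield: "subfield (F N0) L"
  by (rule F_subfield[OF N01])

lemmas F0_closed = subringE[OF subfieldE(1)[OF F0_subfield]]

lemma F0_carrier: "c \<in> F N0 \<Longrightarrow> c \<in> carrier L"
  using subfieldE(3)[OF F0_subfield] by blast

lemma b_carrier': "x < N1 \<Longrightarrow> b x \<in> carrier L"
  using b_carrier less_N_iff[of x "Suc (2 * r)"] by simp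

text \<open>The non-leaders of size \<open>2 * r\<close> may be inseparable over their predecessors, so they are replaced
  by independent transcendental elements. Since they are linearly independent over \<open>F N0\<close>, the \<open>F N0\<close>-linear relation \<open>Phi\<close> that
  performs this replacement is functional.\<close>

inductive_set Phi :: "nat \<Rightarrow> ('a \<times> 'c) set" for s where
  base: "c \<in> F N0 \<Longrightarrow> (c, \<iota> c) \<in> Phi s"
| step: "(y, y') \<in> Phi s \<Longrightarrow> c \<in> F N0 \<Longrightarrow> N0 \<le> x \<Longrightarrow> x < s \<Longrightarrow> x \<notin> Lam \<Longrightarrow>
    (y \<oplus> c \<otimes> b x, y' \<oplus>\<^bsub>W\<^esub> \<iota> c \<otimes>\<^bsub>W\<^esub> t x) \<in> Phi s"

lemma Phi_mono:
  assumes s: "s \<le> s'" and "(y, y') \<in> Phi s"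
  shows "(y, y') \<in> Phi s'"
  using assms(2)
proof (induction rule: Phi.induct)
  case (base c)
  then show ?case by (rule Phi.base)
next
  case (step y y' c x)
  then show ?case using s by (intro Phi.step) auto
qed

lemma Phi_carrier: "s \<le> N1 \<Longrightarrow> (y, y') \<in> Phi s \<Longrightarrow> y \<in> carrier L \<and> y' \<in> carrier W"
proof -
  assume s: "s \<le> N1" and "(y, y') \<in> Phi s"
  from this(2) show ?thesis
  proof (induction rule: Phi.induct)
    case (base c)
    then show ?case using F0_carrier by simp
  next
    case (step y y' c x)
    then show ?case using s F0_carrier b_carrier'[of x] t_carrier by simp
  qed
qed

lemma Phi_add:
  assumes s: "s \<le> N1" and "(y, y') \<in> Phi s" "(z, z') \<in> Phi s"
  shows "(y \<oplus> z, y' \<oplus>\<^bsub>W\<^esub> z') \<in> Phi s"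
  using assms(2)
proof (induction rule: Phi.induct)
  case (base c)
  note b = base
  from assms(3) show ?case
  proof (induction rule: Phi.induct)
    case (base d)
    then show ?case using Phi.base[of "c \<oplus> d"] F0_closed(7)[OF b] F0_carrier b by simp
  next
    case (step y y' d x)
    have c: "c \<in> carrier L" "y \<in> carrier L" "y' \<in> carrier W" "d \<in> carrier L" "b x \<in> carrier L"
      using Phi_carrier[OF s] F0_carrier b step b_carrier' s by auto
    have "c \<oplus> (y \<oplus> d \<otimes> b x) = (c \<oplus> y) \<oplus> d \<otimes> b x"
      "\<iota> c \<oplus>\<^bsub>W\<^esub> (y' \<oplus>\<^bsub>W\<^esub> \<iota> d \<otimes>\<^bsub>W\<^esub> t x) = (\<iota> c \<oplus>\<^bsub>W\<^esub> y') \<oplus>\<^bsub>W\<^esub> \<iota> d \<otimes>\<^bsub>W\<^esub> t x"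
      using c t_carrier by (simp_all add: a_assoc W.a_assoc)
    then show ?case using Phi.step[OF step.IH step.hyps(2-5)] by simp
  qed
next
  case (step y y' d x)
  have c: "z \<in> carrier L" "z' \<in> carrier W" "y \<in> carrier L" "y' \<in> carrier W" "d \<in> carrier L" "b x \<in> carrier L"
    using Phi_carrier[OF s] F0_carrier assms(3) step b_carrier' s by auto
  have "(y \<oplus> d \<otimes> b x) \<oplus> z = (y \<oplus> z) \<oplus> d \<otimes> b x"
    "(y' \<oplus>\<^bsub>W\<^esub> \<iota> d \<otimes>\<^bsub>W\<^esub> t x) \<oplus>\<^bsub>W\<^esub> z' = (y' \<oplus>\<^bsub>W\<^esub> z') \<oplus>\<^bsub>W\<^esub> \<iota> d \<otimes>\<^bsub>W\<^esub> t x"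
    using c t_carrier by (simp_all add: a_ac W.a_ac)
  then show ?case using Phi.step[OF step.IH step.hyps(2-5)] by simp
qed

lemma Phi_scale:
  assumes s: "s \<le> N1" and "(y, y') \<in> Phi s" and d: "d \<in> F N0"
  shows "(d \<otimes> y, \<iota> d \<otimes>\<^bsub>W\<^esub> y') \<in> Phi s"
  using assms(2)
proof (induction rule: Phi.induct)
  case (base c)
  then show ?case using Phi.base[of "d \<otimes> c"] F0_closed(6)[OF d] F0_carrier d by simp
next
  case (step y y' c x)
  have c: "y \<in> carrier L" "y' \<in> carrier W" "d \<in> carrier L" "c \<in> carrier L" "b x \<in> carrier L"
    using Phi_carrier[OF s] F0_carrier d step b_carrier' s by auto
  have "d \<otimes> (y \<oplus> c \<otimes> b x) = d \<otimes> y \<oplus> (d \<otimes> c) \<otimes> b x"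
    "\<iota> d \<otimes>\<^bsub>W\<^esub> (y' \<oplus>\<^bsub>W\<^esub> \<iota> c \<otimes>\<^bsub>W\<^esub> t x) = \<iota> d \<otimes>\<^bsub>W\<^esub> y' \<oplus>\<^bsub>W\<^esub> \<iota> (d \<otimes> c) \<otimes>\<^bsub>W\<^esub> t x"
    using c t_carrier by (simp_all add: r_distr m_assoc W.r_distr W.m_assoc)
  then show ?case using Phi.step[OF step.IH F0_closed(6)[OF d step.hyps(2)] step.hyps(3-5)] by simp
qed

lemma Phi_gen: "N0 \<le> x \<Longrightarrow> x < s \<Longrightarrow> s \<le> N1 \<Longrightarrow> x \<notin> Lam \<Longrightarrow> (b x, t x) \<in> Phi s"
  using Phi.step[OF Phi.base[OF F0_closed(2)] F0_closed(3), of x s] b_carrier' t_carrier by simp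

lemma Phi_F: "N0 \<le> s \<Longrightarrow> s \<le> N1 \<Longrightarrow> (y, y') \<in> Phi s \<Longrightarrow> y \<in> F s"
proof -
  assume s: "N0 \<le> s" "s \<le> N1" and "(y, y') \<in> Phi s"
  note cl = subringE[OF subfieldE(1)[OF F_subfield[OF s(2)]]]
  from \<open>(y, y') \<in> Phi s\<close> show ?thesis
  proof (induction rule: Phi.induct)
    case (base c)
    then show ?case using F_mono[OF s] by blast
  next
    case (step y y' c x)
    then show ?case using F_mono[OF s] F_mem(1)[of x s] cl(6,7) by blast
  qed
qed

text \<open>In a relation, collect the terms at the last generator into one coefficient. If it were
  nonzero, \<open>b s\<close> would be expressed through its predecessors and \<open>s\<close> would
  be a leader; so it is zero and the relation is shorter.\<close>

lemma Phi_fnl: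
  assumes "N0 \<le> s" "s \<le> N1" "(\<zero>, y') \<in> Phi s"
  shows "y' = \<zero>\<^bsub>W\<^esub>"
  using assms
proof (induction s arbitrary: y' rule: dec_induct)
  case base
  have "y' = \<iota> y" if "(y, y') \<in> Phi N0" for y y'
    using that by (induction rule: Phi.induct) auto
  from this[OF base(2)] show ?case by simp
next
  case (step s)
  have s: "s \<le> N1" "Suc s \<le> N1" "s < N1" using step by auto
  \<comment> \<open>The rules of \<open>Phi\<close> may use the number \<open>s\<close> repeatedly
    and in any order; these contributions are merged into one.\<close>
  have split: "(z, z') \<in> Phi s \<or> (s \<notin> Lam \<and> (\<exists>c y y'. c \<in> F N0 \<and> (y, y') \<in> Phi s \<and>
      (z, z') = (y \<oplus> c \<otimes> b s, y' \<oplus>\<^bsub>W\<^esub> \<iota> c \<otimes>\<^bsub>W\<^esub> t s)))"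
    if "(z, z') \<in> Phi (Suc s)" for z z'
    using that
  proof (induction rule: Phi.induct)
    case (base c)
    then show ?case using Phi.base by blast
  next
    case (step y y' c x)
    have cc: "c \<in> carrier L" "b x \<in> carrier L" "b s \<in> carrier L" "t x \<in> carrier W" "t s \<in> carrier W"
      using F0_carrier step b_carrier' s t_carrier by auto
    from step.IH show ?case
    proof
      assume "(y, y') \<in> Phi s"
      then show ?thesis using step Phi.step[of y y' s c x] by (cases "x = s") auto
    next
      assume "s \<notin> Lam \<and> (\<exists>d w w'. d \<in> F N0 \<and> (w, w') \<in> Phi s \<and>
          (y, y') = (w \<oplus> d \<otimes> b s, w' \<oplus>\<^bsub>W\<^esub> \<iota> d \<otimes>\<^bsub>W\<^esub> t s))"
      then obtain d w w' where d: "s \<notin> Lam" "d \<in> F N0" "(w, w') \<in> Phi s"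
        and y: "y = w \<oplus> d \<otimes> b s" "y' = w' \<oplus>\<^bsub>W\<^esub> \<iota> d \<otimes>\<^bsub>W\<^esub> t s" by blast
      have dc: "d \<in> carrier L" "w \<in> carrier L" "w' \<in> carrier W"
        using F0_carrier d(2) Phi_carrier[OF s(1) d(3)] by auto
      show ?thesis
      proof (cases "x = s")
        case True
        have "y \<oplus> c \<otimes> b x = w \<oplus> (d \<oplus> c) \<otimes> b s"
          "y' \<oplus>\<^bsub>W\<^esub> \<iota> c \<otimes>\<^bsub>W\<^esub> t x = w' \<oplus>\<^bsub>W\<^esub> \<iota> (d \<oplus> c) \<otimes>\<^bsub>W\<^esub> t s"
          using cc dc by (simp_all add: y True l_distr W.l_distr a_assoc W.a_assoc)
        then show ?thesis using d F0_closed(7)[OF d(2) step.hyps(2)] by blast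
      next
        case False
        then have "(w \<oplus> c \<otimes> b x, w' \<oplus>\<^bsub>W\<^esub> \<iota> c \<otimes>\<^bsub>W\<^esub> t x) \<in> Phi s"
          using Phi.step[OF d(3)] step by auto
        moreover have "y \<oplus> c \<otimes> b x = (w \<oplus> c \<otimes> b x) \<oplus> d \<otimes> b s"
          "y' \<oplus>\<^bsub>W\<^esub> \<iota> c \<otimes>\<^bsub>W\<^esub> t x = (w' \<oplus>\<^bsub>W\<^esub> \<iota> c \<otimes>\<^bsub>W\<^esub> t x) \<oplus>\<^bsub>W\<^esub> \<iota> d \<otimes>\<^bsub>W\<^esub> t s"
          using cc dc by (simp_all add: y a_ac W.a_ac)
        ultimately show ?thesis using d(1,2) by blast
      qed
    qed
  qed
  from split[OF step.prems(2)] show ?case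
  proof
    assume "(\<zero>, y') \<in> Phi s"
    then show ?thesis using step.IH s by blast
  next
    assume "s \<notin> Lam \<and> (\<exists>c y w. c \<in> F N0 \<and> (y, w) \<in> Phi s \<and>
      (\<zero>, y') = (y \<oplus> c \<otimes> b s, w \<oplus>\<^bsub>W\<^esub> \<iota> c \<otimes>\<^bsub>W\<^esub> t s))"
    then obtain c y w where c: "s \<notin> Lam" "c \<in> F N0" "(y, w) \<in> Phi s"
      and zz: "(\<zero>, y') = (y \<oplus> c \<otimes> b s, w \<oplus>\<^bsub>W\<^esub> \<iota> c \<otimes>\<^bsub>W\<^esub> t s)" by blast
    from zz have z: "y \<oplus> c \<otimes> b s = \<zero>" "y' = w \<oplus>\<^bsub>W\<^esub> \<iota> c \<otimes>\<^bsub>W\<^esub> t s" by simp_all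
    have cc: "c \<in> carrier L" "b s \<in> carrier L" "y \<in> carrier L"
      using F0_carrier c(2) b_carrier' s Phi_carrier[OF s(1) c(3)] by auto
    show ?thesis
    proof (cases "c = \<zero>")
      case True
      then have "y = \<zero>" using z cc by simp
      then have "w = \<zero>\<^bsub>W\<^esub>" using step.IH s c(3) by blast
      then show ?thesis using z True t_carrier by simp
    next
      case False
      note sub = F_subfield[OF s(1)]
      note cl = subringE[OF subfieldE(1)[OF sub]]
      have i: "inv c \<in> carrier L" "inv c \<otimes> c = \<one>" using False cc field_Units by auto
      have "c \<in> F s" using c(2) F_mono[OF step.hyps(1) s(1)] by blast
      then have "inv c \<in> F s" using subfield_m_inv(1)[OF sub] False by auto
      then have "(\<ominus> (inv c)) \<otimes> y \<in> F s" using cl(5,6) Phi_F[OF step.hyps(1) s(1) c(3)] by blast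
      moreover have "b s = (inv c \<otimes> c) \<otimes> b s" using i cc by simp
      moreover have "\<dots> = inv c \<otimes> (y \<oplus> c \<otimes> b s) \<oplus> (\<ominus> (inv c)) \<otimes> y"
        using i(1) cc by algebra
      ultimately have "b s \<in> F s" using z i cc by simp
      then have "s \<in> Lam" using mem_F_sep[THEN sep_imp_Lam] less_N_iff[of s "Suc (2 * r)"] s by simp
      then show ?thesis using c by blast
    qed
  qed
qed

text \<open>A leader of size \<open>2 * r\<close> is a shift of a leader \<open>p\<close> of size
  \<open>2 * r - 1\<close>, and \<open>derivative_in_subspace\<close> applies with the domain of
  \<open>Phi x\<close> as \<open>V\<close>. The other shifts involved precede \<open>x\<close>: they
  have smaller size, or are non-leaders, or are covered by induction.\<close>

lemma leader_in_Phi: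
  assumes "x \<in> Lam" "N0 \<le> x" "x < N1"
  shows "\<exists>y'. (b x, y') \<in> Phi x"
  using assms
proof (induction x rule: less_induct)
  case (less x)
  have xN: "x \<le> N1" using less.prems by simp
  have "2 * r \<le> sz x" using less.prems(2) less_N_iff[of x "2 * r"] by simp
  then have "r < sz x" using pos(2) by linarith
  then obtain i p where p: "i < m" "p \<in> Lam" "sh i p = x" using Lam_pred less.prems(1) by blast
  have pN: "p < N0" using less.prems(3) sz_sh[OF p(1), of p] p(3) less_N_iff by simp
  have szp: "sz p \<le> 2 * r" using pN less_N_iff[of p "2 * r"] by simp
  have Vz: "b (sh i z) \<in> fst ` Phi x" if z: "z < p" for z
  proof -
    have lt: "sh i z < x" using sh_mono[OF p(1) z] p(3) by simp
    have "\<exists>y'. (b (sh i z), y') \<in> Phi x"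
    proof (cases "sh i z < N0")
      case True
      then show ?thesis using Phi.base[OF F_mem(1)] by blast
    next
      case False
      show ?thesis
      proof (cases "sh i z \<in> Lam")
        case True
        then show ?thesis using less.IH[OF lt] False lt less.prems(3) Phi_mono[of "sh i z" x] by auto
      next
        case False': False
        then show ?thesis using Phi_gen[of "sh i z" x] False lt xN by auto
      qed
    qed
    then show ?thesis by force
  qed
  have "b (sh i p) \<in> fst ` Phi x"
  proof (rule derivative_in_subspace[OF pN p(1) sep_sep_root[OF Lam_imp_sep[OF p(2) szp] szp] F0_subfield])
    show "F (Suc p) \<subseteq> F N0" using F_mono[of "Suc p" N0] pN N01 by simp
    show "fst ` Phi x \<subseteq> carrier L" using Phi_carrier[OF xN] by auto
    show "\<zero> \<in> fst ` Phi x" using Phi.base[OF F0_closed(2)] by force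
    show "u \<oplus> v \<in> fst ` Phi x" if "u \<in> fst ` Phi x" "v \<in> fst ` Phi x" for u v
      using that Phi_add[OF xN] by force
    show "c \<otimes> v \<in> fst ` Phi x" if "c \<in> F N0" "v \<in> fst ` Phi x" for c v
      using that Phi_scale[OF xN] by force
    show "K \<subseteq> fst ` Phi x" using Phi.base[OF F_mem(2)] by force
  qed (rule Vz)
  then show ?case using p(3) by force
qed

text \<open>The value at a leader is sought in \<open>Phi x\<close> and not in
  \<open>Phi N1\<close>, so that it lies in the field generated by the earlier values, as
  \<open>u0_leader\<close> needs.\<close>

definition u0 :: "nat \<Rightarrow> 'c" where
  "u0 x = (if x < N0 then \<iota> (b x) else if x \<in> Lam then SOME y'. (b x, y') \<in> Phi x else t x)"

lemma u0_Phi: "x < N1 \<Longrightarrow> (b x, u0 x) \<in> Phi N1"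
proof -
  assume x: "x < N1"
  consider "x < N0" | "N0 \<le> x" "x \<in> Lam" | "N0 \<le> x" "x \<notin> Lam" by linarith
  then show ?thesis
  proof cases
    case 1
    then show ?thesis using Phi.base[OF F_mem(1)] by (simp add: u0_def)
  next
    case 2
    then have "(b x, u0 x) \<in> Phi x" using someI_ex[OF leader_in_Phi] x by (simp add: u0_def)
    then show ?thesis using Phi_mono[of x N1] x by simp
  next
    case 3
    then show ?thesis using Phi_gen[of x N1] x by (simp add: u0_def)
  qed
qed

lemma u0_image: "x \<le> N0 \<Longrightarrow> \<iota> ` (K \<union> b ` {..<x}) = \<iota> ` K \<union> u0 ` {..<x}"
  unfolding image_Un image_image u0_def by (intro arg_cong2[where f = "(\<union>)"] image_cong) auto

lemma iota_F: "x \<le> N0 \<Longrightarrow> c \<in> F x \<Longrightarrow> \<iota> c \<in> generate_field W (\<iota> ` K \<union> u0 ` {..<x})"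
  using hom_generate_field[OF F_gens, of x c] u0_image[of x] N01 by (simp add: F_def)

lemma u0_leader:
  assumes "x \<in> Lam" "N0 \<le> x" "x < N1"
  shows "u0 x \<in> generate_field W (\<iota> ` K \<union> u0 ` {..<x})"
proof -
  have "(b x, u0 x) \<in> Phi x" using someI_ex[OF leader_in_Phi[OF assms]] assms by (simp add: u0_def)
  have low: "\<iota> c \<in> generate_field W (\<iota> ` K \<union> u0 ` {..<x})" if "c \<in> F N0" for c
    using iota_F[OF le_refl that]
    by (induction rule: generate_field.induct) (use assms(2) in \<open>auto intro: generate_field.intros\<close>)
  show ?thesis using \<open>(b x, u0 x) \<in> Phi x\<close>
  proof (induction rule: Phi.induct)
    case (base c)
    then show ?case by (rule low)
  next
    case (step y y' c z)
    have "t z = u0 z" using step by (simp add: u0_def)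
    then have "t z \<in> generate_field W (\<iota> ` K \<union> u0 ` {..<x})" using step by (auto intro: generate_field.incl)
    then show ?case
      using step.IH low[OF step.hyps(2)] by (intro generate_field.eng_add generate_field.eng_mult) auto
  qed
qed

definition B :: "nat \<Rightarrow> ('c \<times> 'c) set" where
  "B i = {(\<iota> c, \<iota> (der i c)) | c. c \<in> K}"

text \<open>The given derivation on \<open>F N0\<close>, followed by the linear map with graph
  \<open>Phi N1\<close>, is again a derivation. Its graph, read over the image of \<iota>, is the
  ring \<open>R0\<close>.\<close>

lemma base_fnl:
  assumes i: "i < m"
  shows "fnl W (dcl W (B i \<union> {(u0 x, u0 (sh i x)) | x. x < N0}))"
proof -
  interpret D: cring "dual W" by (rule W.dual_cring)
  define R0 where "R0 = {(\<iota> x, y') | x y y'. (x, y) \<in> dcl L (S i N0) \<and> (y, y') \<in> Phi N1}"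
  have R0I: "(\<iota> x, y') \<in> R0" if "(x, y) \<in> dcl L (S i N0)" "(y, y') \<in> Phi N1" for x y y'
    using that unfolding R0_def by blast
  have SF: "x \<in> F N0" if "(x, y) \<in> dcl L (S i N0)" for x y
    using that S_fst[OF i, of N0] by force
  have Sc: "x \<in> carrier L" "y \<in> carrier L" if "(x, y) \<in> dcl L (S i N0)" for x y
    using that dcl_carrier[OF S_carrier[OF i, of N0]] by auto
  have PW: "y' \<in> carrier W" if "(y, y') \<in> Phi N1" for y y' using that Phi_carrier[of N1] by blast
  have "subring R0 (dual W)"
  proof (rule D.subringI)
    show "R0 \<subseteq> carrier (dual W)" unfolding R0_def using Sc PW by auto
    have "(\<zero>, \<zero>\<^bsub>W\<^esub>) \<in> Phi N1" using Phi.base[OF F0_closed(2)] by simp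
    from R0I[OF dcl.one this] show "\<one>\<^bsub>dual W\<^esub> \<in> R0" by simp
  next
    fix h assume "h \<in> R0"
    then obtain x y y' where h: "h = (\<iota> x, y')" "(x, y) \<in> dcl L (S i N0)" "(y, y') \<in> Phi N1"
      unfolding R0_def by blast
    have "(\<ominus> \<one> \<otimes> y, \<iota> (\<ominus> \<one>) \<otimes>\<^bsub>W\<^esub> y') \<in> Phi N1"
      by (rule Phi_scale[OF le_refl h(3) F0_closed(5)[OF F0_closed(3)]])
    moreover have "\<ominus> \<one> \<otimes> y = \<ominus> y" "\<iota> (\<ominus> \<one>) \<otimes>\<^bsub>W\<^esub> y' = \<ominus>\<^bsub>W\<^esub> y'"
      using Sc[OF h(2)] PW[OF h(3)] by (simp_all add: l_minus W.l_minus)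
    ultimately have "(\<iota> (\<ominus> x), \<ominus>\<^bsub>W\<^esub> y') \<in> R0" using R0I[OF dcl.a_inv[OF h(2)]] by simp
    then show "\<ominus>\<^bsub>dual W\<^esub> h \<in> R0"
      using W.dual_neg[of "\<iota> x" y'] Sc[OF h(2)] PW[OF h(3)] by (simp add: h(1))
  next
    fix h1 h2 assume "h1 \<in> R0" "h2 \<in> R0"
    then obtain x y y' z w w' where h: "h1 = (\<iota> x, y')" "(x, y) \<in> dcl L (S i N0)" "(y, y') \<in> Phi N1"
      "h2 = (\<iota> z, w')" "(z, w) \<in> dcl L (S i N0)" "(w, w') \<in> Phi N1"
      unfolding R0_def by blast
    note c = Sc[OF h(2)] Sc[OF h(5)] PW[OF h(3)] PW[OF h(6)]
    have "(\<iota> (x \<oplus> z), y' \<oplus>\<^bsub>W\<^esub> w') \<in> R0"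
      by (rule R0I[OF dcl.add[OF h(2,5)] Phi_add[OF le_refl h(3,6)]])
    then show "h1 \<oplus>\<^bsub>dual W\<^esub> h2 \<in> R0" using c by (simp add: h(1,4))
    \<comment> \<open>The Leibniz rule survives because the arguments \<open>x\<close> and
      \<open>z\<close> are scalars from \<open>F N0\<close>, over which \<open>Phi\<close> is
      linear.\<close>
    have "(x \<otimes> w \<oplus> z \<otimes> y, \<iota> x \<otimes>\<^bsub>W\<^esub> w' \<oplus>\<^bsub>W\<^esub> \<iota> z \<otimes>\<^bsub>W\<^esub> y') \<in> Phi N1"
      by (intro Phi_add Phi_scale le_refl h SF[OF h(2)] SF[OF h(5)])
    moreover have "x \<otimes> w \<oplus> z \<otimes> y = x \<otimes> w \<oplus> y \<otimes> z"
      "\<iota> x \<otimes>\<^bsub>W\<^esub> w' \<oplus>\<^bsub>W\<^esub> \<iota> z \<otimes>\<^bsub>W\<^esub> y' = \<iota> x \<otimes>\<^bsub>W\<^esub> w' \<oplus>\<^bsub>W\<^esub> y' \<otimes>\<^bsub>W\<^esub> \<iota> z"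
      using c by (simp_all add: m_comm W.m_comm)
    ultimately have "(\<iota> (x \<otimes> z), \<iota> x \<otimes>\<^bsub>W\<^esub> w' \<oplus>\<^bsub>W\<^esub> y' \<otimes>\<^bsub>W\<^esub> \<iota> z) \<in> R0"
      using R0I[OF dcl.mult[OF h(2,5)]] by simp
    then show "h1 \<otimes>\<^bsub>dual W\<^esub> h2 \<in> R0" using c by (simp add: h(1,4))
  qed
  moreover have "B i \<union> {(u0 x, u0 (sh i x)) | x. x < N0} \<subseteq> R0"
  proof (rule Un_least; clarify)
    fix x' y' assume "(x', y') \<in> B i"
    then obtain c where c: "c \<in> K" "x' = \<iota> c" "y' = \<iota> (der i c)" unfolding B_def by blast
    have "(c, der i c) \<in> dcl L (S i N0)" using c(1) by (intro dcl.incl) (auto simp: S_def)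
    moreover have "(der i c, \<iota> (der i c)) \<in> Phi N1" by (intro Phi.base F_mem(2) der_K i c)
    ultimately show "(x', y') \<in> R0" unfolding c(2,3) by (rule R0I)
  next
    fix x assume x: "x < N0"
    have "(b x, b (sh i x)) \<in> dcl L (S i N0)" using x by (intro dcl.incl) (auto simp: S_def)
    moreover have "(b (sh i x), u0 (sh i x)) \<in> Phi N1" using u0_Phi sh_less_N[OF i x] by blast
    ultimately have "(\<iota> (b x), u0 (sh i x)) \<in> R0" by (rule R0I)
    then show "(u0 x, u0 (sh i x)) \<in> R0" using x by (simp add: u0_def)
  qed
  moreover have "fnl W R0"
    unfolding fnl_def
  proof (intro allI impI)
    fix y' assume "(\<zero>\<^bsub>W\<^esub>, y') \<in> R0"
    then obtain x y where h: "\<iota> x = \<zero>\<^bsub>W\<^esub>" "(x, y) \<in> dcl L (S i N0)" "(y, y') \<in> Phi N1"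
      unfolding R0_def by force
    have "\<iota> x = \<iota> \<zero>" using h(1) by simp
    then have "x = \<zero>" using inj_onD[OF inj _ Sc(1)[OF h(2)] zero_closed] by blast
    then have "y = \<zero>" using S_fnl[OF i] h(2) unfolding fnl_def by blast
    then show "y' = \<zero>\<^bsub>W\<^esub>" using Phi_fnl[OF N01 le_refl] h(3) by blast
  qed
  ultimately show ?thesis by (intro W.dcl_fnl)
qed

lemma sep_root_iota:
  assumes "x < N0" "x \<in> Lam"
  shows "sep_root W (generate_field W (\<iota> ` K \<union> u0 ` {..<x})) (u0 x)"
proof -
  have szx: "sz x \<le> 2 * r" using assms(1) less_N_iff[of x "2 * r"] by simp
  obtain p where p: "set p \<subseteq> F x" "eval p (b x) = \<zero>" "eval (deriv_list L p) (b x) \<noteq> \<zero>"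
    using sep_sep_root[OF Lam_imp_sep[OF assms(2) szx] szx] unfolding sep_root_def by blast
  have pc: "set p \<subseteq> carrier L" using p(1) subfieldE(3)[OF F_subfield[of x]] assms(1) N01 by auto
  have bx: "b x \<in> carrier L" by (rule b_carrier[OF szx])
  have ap: "\<iota> (add_pow L k c) = add_pow W k (\<iota> c)" if "c \<in> carrier L" for k :: nat and c
    using that by (induction k) auto
  have dl: "deriv_list W (map \<iota> p) = map \<iota> (deriv_list L p)"
    using pc by (induction p) (auto simp: ap)
  have "W.eval (map \<iota> p) (\<iota> (b x)) = \<zero>\<^bsub>W\<^esub>"
    using h.eval_hom'[OF bx pc] p(2) by simp
  moreover have "W.eval (deriv_list W (map \<iota> p)) (\<iota> (b x)) \<noteq> \<zero>\<^bsub>W\<^esub>"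
  proof
    assume "W.eval (deriv_list W (map \<iota> p)) (\<iota> (b x)) = \<zero>\<^bsub>W\<^esub>"
    then have "\<iota> (eval (deriv_list L p) (b x)) = \<iota> \<zero>"
      unfolding dl using h.eval_hom'[OF bx deriv_list_carrier[OF pc]] by simp
    then show False
      using p(3) inj_onD[OF inj _ eval_in_carrier[OF deriv_list_carrier[OF pc] bx] zero_closed] by blast
  qed
  moreover have "set (map \<iota> p) \<subseteq> generate_field W (\<iota> ` K \<union> u0 ` {..<x})"
    using p(1) iota_F[of x] assms(1) by auto
  moreover have u0x: "u0 x = \<iota> (b x)" using assms(1) by (simp add: u0_def)
  ultimately show ?thesis unfolding sep_root_def u0x by blast
qed

lemma jet_extension: "jet_extension W (\<iota> ` K) m B A t Lam sh N0 N1 u0"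
proof (intro jet_extension.intro jet_extension_axioms.intro W.field_axioms, goal_cases)
  case (1 i)
  then show ?case unfolding B_def using der_K by auto
next
  case (2 i)
  then show ?case unfolding B_def by force
next
  case (3 i j)
  have "\<iota> c \<in> comm_set (B i) (B j)" if c: "c \<in> K" for c
  proof -
    have "der j (der i c) = der i (der j c)" using der 3 c unfolding comm_derivations_def by blast
    then have "(\<iota> (der j c), \<iota> (der j (der i c))) \<in> B i" unfolding B_def using der_K[OF 3(2) c] by auto
    moreover have "(\<iota> c, \<iota> (der i c)) \<in> B i" "(\<iota> c, \<iota> (der j c)) \<in> B j"
      "(\<iota> (der i c), \<iota> (der j (der i c))) \<in> B j"
      unfolding B_def using c der_K[OF 3(1) c] by auto
    ultimately show ?thesis unfolding comm_set_def by blast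
  qed
  then show ?case by blast
next
  case (4 s)
  show ?case by (rule A(1))
next
  case (5 s)
  show ?case by (rule A(2))
next
  case 6
  show ?case using A0 K_carrier by blast
next
  case (7 s)
  show ?case by (rule t(1))
next
  case (8 s)
  show ?case by (rule t(2))
next
  case (9 i x y)
  then show ?case by (rule sh_mono)
next
  case (10 i x)
  then show ?case by (rule sh_gt)
next
  case (11 i j x)
  then show ?case by (rule sh_comm)
next
  case 12
  show ?case by (rule N01)
next
  case (13 i x)
  then show ?case by (rule sh_less_N)
next
  case (14 i x)
  then show ?case using less_N_iff[of x "2 * r"] less_N_iff[of "sh i x" "Suc (2 * r)"] sz_sh[of i x] by simp
next
  case (15 i x)
  then show ?case by (rule Lam_sh)
next
  case (16 x)
  then have "b x \<in> carrier L" using b_carrier' N01 by simp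
  then show ?case using 16 A0 by (auto simp: u0_def)
next
  case (17 x)
  then show ?case by (simp add: u0_def)
next
  case (18 x)
  then show ?case by (intro u0_leader)
next
  case (19 x)
  then show ?case by (rule sep_root_iota)
next
  case (20 i)
  then show ?case by (rule base_fnl)
next
  case (21 y)
  then have "r < sz y" using less_N_iff[of y "Suc (2 * r)"] by simp
  then show ?case using Lam_pred 21 by blast
next
  case (22 y i j p q)
  from Lam_confluence[OF 22(1-4,6,5,7)] show ?case .
qed

theorem kernel_extension:
  "\<exists>(M :: 'c ring) D. field M \<and> comm_derivations M (carrier M) m D \<and> \<iota> \<in> ring_hom (L\<lparr>carrier := F N0\<rparr>) M \<and>
    (\<forall>i<m. \<forall>c\<in>K. D i (\<iota> c) = \<iota> (der i c)) \<and>
    (\<forall>i<m. \<forall>x. sz x + 1 < 2 * r \<longrightarrow> D i (\<iota> (b x)) = \<iota> (b (sh i x)))"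
proof -
  interpret J: jet_extension W "\<iota> ` K" m B A t Lam sh N0 N1 u0 by (rule jet_extension)
  obtain u D where u0: "\<forall>x<N1. u x = u0 x" and ur: "range u \<subseteq> carrier W"
    and D1: "comm_derivations W (generate_field W (\<iota> ` K \<union> range u)) m D"
    and D0: "\<forall>i<m. (\<forall>(x, y)\<in>B i. D i x = y) \<and> (\<forall>x. D i (u x) = u (sh i x))"
    using J.extension by (elim exE conjE)
  have u: "u x = u0 x" if "x < N1" for x using u0 that by blast
  have D2: "D i (fst z) = snd z" if "i < m" "z \<in> B i" for i z
  proof -
    have "\<forall>(x, y)\<in>B i. D i x = y" using mp[OF spec[OF D0, of i] that(1)] by (rule conjunct1)
    then show ?thesis using that(2) by (cases z) auto
  qed
  have D3: "D i (u x) = u (sh i x)" if "i < m" for i x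
    using spec[OF conjunct2[OF mp[OF spec[OF D0, of i] that]], of x] .
  define M where "M = W\<lparr>carrier := generate_field W (\<iota> ` K \<union> range u)\<rparr>"
  have "\<iota> ` K \<union> range u \<subseteq> carrier W" using ur J.K_carrier by blast
  then have "field M" unfolding M_def by (rule W.generate_field_is_field)
  moreover have "comm_derivations M (carrier M) m D"
    using D1 unfolding M_def comm_derivations_def derivation_def by simp
  moreover have "\<iota> \<in> ring_hom (L\<lparr>carrier := F N0\<rparr>) M"
  proof -
    have "\<iota> c \<in> generate_field W (\<iota> ` K \<union> range u)" if "c \<in> F N0" for c
    proof -
      have "\<iota> c \<in> generate_field W (\<iota> ` K \<union> u0 ` {..<N0})" using iota_F that by blast
      then show ?thesis
      proof (induction rule: generate_field.induct)
        case (incl z)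
        have "u0 ` {..<N0} \<subseteq> range u"
        proof (rule image_subsetI)
          fix x assume "x \<in> {..<N0}"
          then have "u0 x = u x" using u[of x] N01 by simp
          then show "u0 x \<in> range u" by simp
        qed
        then show ?case using incl by (intro generate_field.incl) blast
      qed (auto intro: generate_field.intros)
    qed
    then show ?thesis
      using ring_hom_memE(2-4)[OF hom] F0_carrier by (intro ring_hom_memI) (auto simp: M_def)
  qed
  moreover have "D i (\<iota> c) = \<iota> (der i c)" if "i < m" "c \<in> K" for i c
    using D2[OF that(1), of "(\<iota> c, \<iota> (der i c))"] that(2) unfolding B_def by auto
  moreover have "D i (\<iota> (b x)) = \<iota> (b (sh i x))" if "i < m" "sz x + 1 < 2 * r" for i x
  proof -
    \<comment> \<open>Both the generator and its shift are below \<open>N0\<close>, where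
      \<open>u0\<close> is still the image of the given generator.\<close>
    have "x < N0" "sh i x < N0" using that less_N_iff sz_sh by auto
    then show ?thesis using u D3[OF that(1), of x] N01 by (simp add: u0_def)
  qed
  ultimately show ?thesis by (intro exI[of _ M] exI[of _ D] conjI allI ballI impI)
qed

end

theorem theorem4p3:
  fixes L :: "'a ring" and K :: "'a set" and der :: "nat \<Rightarrow> 'a \<Rightarrow> 'a"
    and m r n :: nat and a :: "(nat \<Rightarrow> nat) \<times> nat \<Rightarrow> 'a"
  assumes "m > 0" and "r > 0" and "n > 0"
    and "field L" and "subfield K L"
    and "comm_derivations L K m der"
    and "\<And>\<xi> h. mindex m \<xi> \<Longrightarrow> msize m \<xi> \<le> 2 * r \<Longrightarrow> h < n \<Longrightarrow> a (\<xi>, h) \<in> carrier L"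
    and "diff_condition L K der m r n a"
    and "\<And>\<sigma> k. mindex m \<sigma> \<Longrightarrow> msize m \<sigma> \<le> 2 * r \<Longrightarrow> k < n \<Longrightarrow>
           min_sep_leader L K m r n a \<sigma> k \<Longrightarrow> msize m \<sigma> \<le> r"
  shows "\<exists>(M :: ('a \<times> nat) ring) (\<iota> :: 'a \<Rightarrow> 'a \<times> nat) (D :: nat \<Rightarrow> 'a \<times> nat \<Rightarrow> 'a \<times> nat).
    field M \<and> comm_derivations M (carrier M) m D \<and>
    (let F = generate_field L (K \<union> a ` {(\<xi>, h). mindex m \<xi> \<and> msize m \<xi> < 2 * r \<and> h < n}) in
      \<iota> \<in> ring_hom (L\<lparr>carrier := F\<rparr>) M \<and> inj_on \<iota> F) \<and>
    (\<forall>i<m. \<forall>x\<in>K. D i (\<iota> x) = \<iota> (der i x)) \<and>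
    (\<forall>i<m. \<forall>k<n. \<forall>\<sigma>. mindex m \<sigma> \<and> msize m \<sigma> + 1 < 2 * r \<longrightarrow>
        D i (\<iota> (a (\<sigma>, k))) = \<iota> (a (madd \<sigma> (unitv i), k)))"
proof -
  interpret L: field L by (rule assms(4))
  obtain en :: "nat \<Rightarrow> (nat \<Rightarrow> nat) \<times> nat"
    where en: "bij_betw en UNIV (idx m n)" "\<forall>x y. olt m (en x) (en y) \<longleftrightarrow> x < y"
    using ex_enumeration[OF assms(1,3)] by (elim exE conjE)
  interpret DK: diff_kernel L K der m r n a en
    by (rule diff_kernel.intro[OF assms(4) diff_kernel_axioms.intro[OF assms(1-3,5-9) en(1) spec[OF spec[OF en(2)]]]])
  obtain W :: "('a \<times> nat) ring" and \<iota> A t where W: "field W" "\<iota> \<in> ring_hom L W" "inj_on \<iota> (carrier L)"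
      "\<iota> ` carrier L \<subseteq> A 0"
    and At: "\<forall>s. subfield (A s) W \<and> A s \<subseteq> A (Suc s) \<and> t s \<in> A (Suc s) \<and> transc W (A s) (t s)"
    using transcendental_tower[OF assms(4)] by (elim exE conjE)
  interpret KT: kernel_tower L K der m r n a en W \<iota> A t
    using At by (intro kernel_tower.intro kernel_tower_axioms.intro DK.diff_kernel_axioms W) blast+
  obtain M :: "('a \<times> nat) ring" and D where M: "field M" "comm_derivations M (carrier M) m D"
      "\<iota> \<in> ring_hom (L\<lparr>carrier := DK.F (DK.N (2 * r))\<rparr>) M"
    and DK: "\<forall>i<m. \<forall>c\<in>K. D i (\<iota> c) = \<iota> (der i c)"
    and Db: "\<forall>i<m. \<forall>x. DK.sz x + 1 < 2 * r \<longrightarrow> D i (\<iota> (DK.b x)) = \<iota> (DK.b (DK.sh i x))"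
    using KT.kernel_extension by (elim exE conjE)
  have "a ` {(\<xi>, h). mindex m \<xi> \<and> msize m \<xi> < 2 * r \<and> h < n} = DK.b ` {..<DK.N (2 * r)}"
  proof
    show "DK.b ` {..<DK.N (2 * r)} \<subseteq> a ` {(\<xi>, h). mindex m \<xi> \<and> msize m \<xi> < 2 * r \<and> h < n}"
    proof (rule image_subsetI)
      fix x assume "x \<in> {..<DK.N (2 * r)}"
      then have "msize m (fst (en x)) < 2 * r" using DK.less_N_iff by (simp add: DK.sz_def)
      then have "en x \<in> {(\<xi>, h). mindex m \<xi> \<and> msize m \<xi> < 2 * r \<and> h < n}"
        using DK.en_idx[of x] by (auto simp: idx_def)
      then show "DK.b x \<in> a ` {(\<xi>, h). mindex m \<xi> \<and> msize m \<xi> < 2 * r \<and> h < n}"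
        unfolding DK.b_def by (rule imageI)
    qed
    show "a ` {(\<xi>, h). mindex m \<xi> \<and> msize m \<xi> < 2 * r \<and> h < n} \<subseteq> DK.b ` {..<DK.N (2 * r)}"
    proof (rule image_subsetI)
      fix p assume p: "p \<in> {(\<xi>, h). mindex m \<xi> \<and> msize m \<xi> < 2 * r \<and> h < n}"
      then obtain x where x: "en x = p" using DK.en_surj[of p] by (auto simp: idx_def)
      then have "x < DK.N (2 * r)" using p DK.less_N_iff by (auto simp: DK.sz_def)
      then show "a p \<in> DK.b ` {..<DK.N (2 * r)}" using x by (auto simp: DK.b_def)
    qed
  qed
  then have F: "generate_field L (K \<union> a ` {(\<xi>, h). mindex m \<xi> \<and> msize m \<xi> < 2 * r \<and> h < n}) = DK.F (DK.N (2 * r))"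
    by (simp add: DK.F_def)
  have inj: "inj_on \<iota> (DK.F (DK.N (2 * r)))"
    using inj_on_subset[OF W(3)] subfieldE(3)[OF KT.F0_subfield] by blast
  have Da: "D i (\<iota> (a (\<sigma>, k))) = \<iota> (a (madd \<sigma> (unitv i), k))"
    if "i < m" "k < n" "mindex m \<sigma>" "msize m \<sigma> + 1 < 2 * r" for i k \<sigma>
  proof -
    have "(\<sigma>, k) \<in> idx m n" using that by (simp add: idx_def)
    then obtain x where x: "en x = (\<sigma>, k)" using DK.en_surj by blast
    have "DK.b x = a (\<sigma>, k)" "DK.b (DK.sh i x) = a (madd \<sigma> (unitv i), k)" "DK.sz x = msize m \<sigma>"
      using DK.en_sh[OF that(1), of x] by (simp_all add: DK.b_def DK.sz_def x shift_def)
    then show ?thesis using Db that by metis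
  qed
  show ?thesis
    unfolding F Let_def
  proof (intro exI[of _ M] exI[of _ \<iota>] exI[of _ D] conjI M DK inj allI impI)
    fix i k \<sigma> assume "i < m" "k < n" "mindex m \<sigma> \<and> msize m \<sigma> + 1 < 2 * r"
    then show "D i (\<iota> (a (\<sigma>, k))) = \<iota> (a (madd \<sigma> (unitv i), k))" by (intro Da) simp_all
  qed
qed

end
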